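(* Let $n\ge1$. Let $\Delta^{\rm inv}$ be an integrated local functional of the ladder fields $\hat\phi^{(1)},\hat\phi^{(2)}$ on $\mathbb R^{n+2}$, of ghost number $0$ and with the dimension of the classical action (see context), satisfying $$\mathcal B\Delta^{\rm inv}=0,\qquad \hat{\mathcal W}^{\rm S}_{(\xi)}\Delta^{\rm inv}=0\ \ (\text{for all }\xi),\qquad \hat{\mathcal G}\Delta^{\rm inv}=0,\qquad \hat{\mathcal F}\Delta^{\rm inv}=0 .$$ Then $\Delta^{\rm inv}$ is a linear superposition of the functionals $$\int_{\mathbb R^{n+2}}\frac1{(n+2)!}\,\nabla^{n+2}\prod_{k=1}^{K}{\rm Tr}\,c^{n_k},\qquad \sum_{k=1}^Kn_k=n+2,\quad n_k\ \text{odd},$$ where $c=\hat\phi^{(1)}_0$. In particular there is no non-zero trivial invariant counterterm, i.e. no non-zero functional of the form $\delta\Delta^-$ that is independent of the global ghosts $\xi,\varepsilon,u,v$, with $\Delta^-$ an integrated local functional of the ladder fields of ghost number $-1$ (and of the dimension of the classical action).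
   Context: Let $G$ be a simple Lie group with basis $T_a$ of its Lie algebra in the fundamental representation, ${\rm Tr}\,T_aT_b=\delta_{ab}$. The ladder fields $\hat\phi^{(A)}_p$, $A=1,2$, $0\le p\le n+2$, are Lie-algebra-valued $p$-forms on flat $\mathbb R^{n+2}$; $\hat\phi^{(1)}_p$ has ghost number $1-p$ and $\hat\phi^{(2)}_p$ has ghost number $n-p$. Write $c=\hat\phi^{(1)}_0$, $B^n_0=\hat\phi^{(2)}_0$. The grading of a form is the parity of (ghost number + form degree) and $[\cdot,\cdot]$ is the graded commutator. Forms whose degree is outside $0,\dots,n+2$ are zero. Local functionals: integrals over $\mathbb R^{n+2}$ (i.e. modulo total derivatives) of $(n+2)$-forms which are polynomials, without field-independent term, in the fields and their derivatives, with Poincaré invariance (in particular translation invariance). Dimension: the components of $\hat\phi^{(A)}_p$ have canonical dimension $p$ and each derivative $\partial_\mu$ has dimension 1; a functional has the dimension of the classical action if its integrand density has dimension $n+2$. Operators on the ladder fields (extended as graded derivations): - $\mathcal B\hat\phi^{(1)}_p=d\hat\phi^{(1)}_{p-1}+\frac12\sum_{q}[\hat\phi^{(1)}_q,\hat\phi^{(1)}_{p-q}]$ and $\mathcal B\hat\phi^{(2)}_p=d\hat\phi^{(2)}_{p-1}+\sum_{q}[\hat\phi^{(1)}_q,\hat\phi^{(2)}_{p-q}]$; $\mathcal B^2=0$. - $\hat{\mathcal W}^{\rm S}_{(\xi)}\hat\phi^{(A)}_p=-i_\xi\hat\phi^{(A)}_{p+1}$ for $p\le n+1$, and $0$ for $p=n+2$,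 for a constant vector $\xi$. Write $\hat{\mathcal W}^{\rm S}_{(\xi)}=\xi^\mu\hat{\mathcal W}^{\rm S}_\mu$. - $\mathcal W^{\rm T}_{(\varepsilon)}\hat\phi^{(A)}_p=\mathcal L_\varepsilon\hat\phi^{(A)}_p$ (translations). - $\hat{\mathcal G}=\int_{\mathbb R^{n+2}}\frac{\delta}{\delta B^n_0}$ (constant Lie-algebra-valued shifts of $B^n_0$) and $\hat{\mathcal F}=\int_{\mathbb R^{n+2}}\sum_{p=0}^{n+2}\big[\hat\phi^{(1)}_p,\frac{\delta}{\delta\hat\phi^{(2)}_p}\big]$. - The ladder climbing operator is the derivation $\nabla=dx^\mu\hat{\mathcal W}^{\rm S}_\mu$, acting by $\nabla\hat\phi^{(A)}_p=(p+1)\hat\phi^{(A)}_{p+1}$ for $0\le p\le n+1$ and $\nabla\hat\phi^{(A)}_{n+2}=0$. - With global ghosts $\xi^\mu,\varepsilon^\mu$ (constants of ghost numbers $2,1$) and $u,v$ (Lie-algebra-valued constants of ghost numbers $n,n-1$), graded by the parity of their ghost number, the coboundary operator is $\delta=\mathcal B+\hat{\mathcal W}^{\rm S}_{(\xi)}+\mathcal W^{\rm T}_{(\varepsilon)}+{\rm Tr}(u\hat{\mathcal G}+v\hat{\mathcal F})+\xi^\mu\frac{\partial}{\partial\varepsilon^\mu}+{\rm Tr}(u\frac{\partial}{\partial v})$, with sign conventions such that $\delta^2=0$.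
   Formalization: Local functionals are restricted to polynomials in traces of products of the matrix-valued fields and derivatives (for arbitrary component polynomials the claim fails, e.g. n=1, SU(3)); the ghosts u,v have ghost numbers n+1,n instead of n,n-1, as δ²=0 requires. *)

theory Defs
  imports "HOL-Analysis.Analysis" "HOL-Library.Poly_Mapping" "HOL-Library.Multiset"
begin

section \<open>Simple matrix Lie algebras\<close>

text \<open>
  The group enters only through its Lie algebra, given by the matrices \<open>T a\<close> in the
  representation.  Since \<open>Tr (T a T b) = \<delta>\<^sub>a\<^sub>b\<close> forces factors of the imaginary unit between a basis
  of a compact real form and the \<open>T a\<close>, simplicity is required of the complex span of the \<open>T a\<close>.
\<close>

definition mat_commutator :: "complex^'m^'m \<Rightarrow> complex^'m^'m \<Rightarrow> complex^'m^'m"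
  where "mat_commutator M N = M ** N - N ** M"

definition lin_comb :: "('a::finite \<Rightarrow> complex^'m^'m) \<Rightarrow> ('a \<Rightarrow> complex) \<Rightarrow> complex^'m^'m"
  where "lin_comb T z = (\<chi> i j. \<Sum>a\<in>UNIV. z a * T a $ i $ j)"

definition lie_span :: "('a::finite \<Rightarrow> complex^'m^'m) \<Rightarrow> (complex^'m^'m) set"
  where "lie_span T = range (lin_comb T)"

definition complex_subspace :: "(complex^'m^'m) set \<Rightarrow> bool"
  where "complex_subspace S \<longleftrightarrow> 0 \<in> S \<and> (\<forall>M\<in>S. \<forall>N\<in>S. M + N \<in> S) \<and>
    (\<forall>z. \<forall>M\<in>S. (\<chi> i j. z * M $ i $ j) \<in> S)"

definition lie_ideal :: "(complex^'m^'m) set \<Rightarrow> (complex^'m^'m) set \<Rightarrow> bool"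
  where "lie_ideal I L \<longleftrightarrow> I \<subseteq> L \<and> complex_subspace I \<and>
    (\<forall>M\<in>L. \<forall>N\<in>I. mat_commutator M N \<in> I)"

definition simple_lie_algebra :: "(complex^'m^'m) set \<Rightarrow> bool"
  where "simple_lie_algebra L \<longleftrightarrow> complex_subspace L \<and>
    (\<forall>M\<in>L. \<forall>N\<in>L. mat_commutator M N \<in> L) \<and>
    (\<exists>M\<in>L. \<exists>N\<in>L. mat_commutator M N \<noteq> 0) \<and>
    (\<forall>I. lie_ideal I L \<longrightarrow> I = {0} \<or> I = L)"

definition simple_lie_basis :: "('a::finite \<Rightarrow> complex^'m^'m) \<Rightarrow> bool"
  where "simple_lie_basis T \<longleftrightarrow> simple_lie_algebra (lie_span T) \<and>
    (\<forall>a b. trace (T a ** T b) = (if a = b then 1 else 0))"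


section \<open>The graded-commutative algebra of jets, forms and global ghosts\<close>

datatype ladder = Phi1 | Phi2

text \<open>
  \<open>Fld A a I J\<close> is the derivative \<open>\<partial>\<^sub>J\<close> (\<open>J\<close> a multiset of directions) of the component of
  \<open>\<phi>\<^sup>(\<^sup>A\<^sup>)\<^sub>p\<close>, \<open>p = card I\<close>, along \<open>T a\<close> and \<open>dx\<^sup>\<mu>\<^sup>1 \<dots> dx\<^sup>\<mu>\<^sup>p\<close>, where
  \<open>\<mu>\<^sub>1 < \<dots> < \<mu>\<^sub>p\<close> are the elements of \<open>I\<close>.
\<close>

datatype 'a gen =
    Dx nat
  | Fld ladder 'a "nat set" "nat multiset"
  | Xi nat
  | Eps nat
  | U 'a
  | V 'a

fun form_deg :: "'a gen \<Rightarrow> nat" where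
  "form_deg (Dx \<mu>) = 1"
| "form_deg _ = 0"

text \<open>
  \<open>Tr(u G)\<close> has to raise the ghost number by one and \<open>G\<close> lowers it by \<open>n\<close>, while \<open>F\<close> lowers it
  by \<open>n - 1\<close>.  Hence \<open>u\<close> and \<open>v\<close> have ghost numbers \<open>n + 1\<close> and \<open>n\<close>; with the opposite parities
  the square of \<open>Tr(u G)\<close>, and so that of the coboundary operator, would not vanish.
\<close>

fun ghost :: "nat \<Rightarrow> 'a gen \<Rightarrow> int" where
  "ghost n (Dx \<mu>) = 0"
| "ghost n (Fld Phi1 a I J) = 1 - int (card I)"
| "ghost n (Fld Phi2 a I J) = int n - int (card I)"
| "ghost n (Xi \<mu>) = 2"
| "ghost n (Eps \<mu>) = 1"
| "ghost n (U a) = int n + 1"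
| "ghost n (V a) = int n"

fun dimension :: "'a gen \<Rightarrow> nat" where
  "dimension (Fld A a I J) = card I + size J"
| "dimension _ = 0"

definition odd_gen :: "nat \<Rightarrow> 'a gen \<Rightarrow> bool"
  where "odd_gen n x \<longleftrightarrow> odd (ghost n x + int (form_deg x))"

text \<open>
  The free graded-commutative algebra is handled as the free associative algebra (finitely
  supported functions on words) together with the ideal of graded commutators.
\<close>

instantiation list :: (type) monoid_add
begin
definition "zero_list = ([] :: 'a list)"
definition "plus_list = (append :: 'a list \<Rightarrow> 'a list \<Rightarrow> 'a list)"
instance by standard (simp_all add: zero_list_def plus_list_def)
end

type_synonym 'a alg = "'a gen list \<Rightarrow>\<^sub>0 complex"

definition cst :: "complex \<Rightarrow> 'a alg"
  where "cst z = Poly_Mapping.single [] z"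

definition mon :: "'a gen list \<Rightarrow> 'a alg"
  where "mon w = Poly_Mapping.single w 1"

abbreviation gen :: "'a gen \<Rightarrow> 'a alg"
  where "gen x \<equiv> mon [x]"

abbreviation dx :: "nat \<Rightarrow> 'a alg"
  where "dx \<mu> \<equiv> gen (Dx \<mu>)"

definition koszul :: "bool \<Rightarrow> bool \<Rightarrow> complex"
  where "koszul s t = (if s \<and> t then -1 else 1)"

inductive_set comm_ideal :: "nat \<Rightarrow> 'a alg set" for n :: nat where
  comm: "p * (gen x * gen y - cst (koszul (odd_gen n x) (odd_gen n y)) * (gen y * gen x)) * q
    \<in> comm_ideal n"
| zero: "0 \<in> comm_ideal n"
| add: "p \<in> comm_ideal n \<Longrightarrow> q \<in> comm_ideal n \<Longrightarrow> p + q \<in> comm_ideal n"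

text \<open>
  The derivation of parity \<open>s\<close> (\<open>True\<close> means odd) with values \<open>f\<close> on the generators.
\<close>

fun der_word :: "nat \<Rightarrow> bool \<Rightarrow> ('a gen \<Rightarrow> 'a alg) \<Rightarrow> 'a gen list \<Rightarrow> 'a alg" where
  "der_word n s f [] = 0"
| "der_word n s f (x # w) =
    f x * mon w + cst (koszul s (odd_gen n x)) * gen x * der_word n s f w"

definition derivation :: "nat \<Rightarrow> bool \<Rightarrow> ('a gen \<Rightarrow> 'a alg) \<Rightarrow> 'a alg \<Rightarrow> 'a alg"
  where "derivation n s f X =
    (\<Sum>w\<in>Poly_Mapping.keys X. cst (Poly_Mapping.lookup X w) * der_word n s f w)"

definition partial :: "nat \<Rightarrow> nat \<Rightarrow> 'a alg \<Rightarrow> 'a alg"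
  where "partial n \<mu> = derivation n False
    (\<lambda>x. case x of Fld A a I J \<Rightarrow> gen (Fld A a I (add_mset \<mu> J)) | _ \<Rightarrow> 0)"

definition ext_d :: "nat \<Rightarrow> 'a alg \<Rightarrow> 'a alg"
  where "ext_d n = derivation n True
    (\<lambda>x. case x of Fld A a I J \<Rightarrow> \<Sum>\<mu><n+2. dx \<mu> * gen (Fld A a I (add_mset \<mu> J)) | _ \<Rightarrow> 0)"

text \<open>
  Integrals of forms over \<open>\<real>\<^sup>n\<^sup>+\<^sup>2\<close>: two densities give the same functional if and only if they
  differ by a total derivative.
\<close>

definition functional_eq :: "nat \<Rightarrow> 'a alg \<Rightarrow> 'a alg \<Rightarrow> bool"
  where "functional_eq n X Y \<longleftrightarrow> (\<exists>R\<in>comm_ideal n. \<exists>\<alpha>. X - Y = R + ext_d n \<alpha>)"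


section \<open>Ladder fields and operators\<close>

definition phi :: "nat \<Rightarrow> ladder \<Rightarrow> 'a \<Rightarrow> nat \<Rightarrow> 'a alg"
  where "phi n A a p = (\<Sum>I | I \<subseteq> {..<n+2} \<and> card I = p.
    mon (map Dx (sorted_list_of_set I)) * gen (Fld A a I {#}))"

definition phi_mat ::
  "('a::finite \<Rightarrow> complex^'m^'m) \<Rightarrow> nat \<Rightarrow> ladder \<Rightarrow> nat \<Rightarrow> 'a alg^'m^'m"
  where "phi_mat T n A p = (\<chi> i j. \<Sum>a\<in>UNIV. cst (T a $ i $ j) * phi n A a p)"

text \<open>The component along \<open>T a\<close> of a Lie-algebra-valued form; the \<open>T a\<close> are orthonormal.\<close>

definition lie_comp :: "('a \<Rightarrow> complex^'m^'m) \<Rightarrow> 'a \<Rightarrow> 'a alg^'m^'m \<Rightarrow> 'a alg"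
  where "lie_comp T a M = trace ((\<chi> i j. cst (T a $ i $ j)) ** M)"

definition graded_comm ::
  "bool \<Rightarrow> bool \<Rightarrow> 'a alg^'m^'m \<Rightarrow> 'a alg^'m^'m \<Rightarrow> 'a alg^'m^'m"
  where "graded_comm s t X Y = X ** Y - (\<chi> i j. cst (koszul s t) * (Y ** X) $ i $ j)"

definition contract :: "nat \<Rightarrow> nat \<Rightarrow> 'a alg \<Rightarrow> 'a alg"
  where "contract n \<mu> = derivation n True
    (\<lambda>x. case x of Dx \<nu> \<Rightarrow> (if \<mu> = \<nu> then 1 else 0) | _ \<Rightarrow> 0)"

text \<open>
  For a \<open>p\<close>-form \<open>\<Sum>\<^sub>I dx\<^sup>I \<omega>\<^sub>I\<close> and \<open>card I = p\<close>, \<open>form_comp n I\<close> returns \<open>\<omega>\<^sub>I\<close>.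
\<close>

definition form_comp :: "nat \<Rightarrow> nat set \<Rightarrow> 'a alg \<Rightarrow> 'a alg"
  where "form_comp n I = fold (contract n) (sorted_list_of_set I)"

text \<open>
  The derivation \<open>D\<close> of parity \<open>s\<close> that commutes with the \<open>\<partial>\<^sub>\<mu>\<close>, annihilates the \<open>dx\<^sup>\<mu>\<close> and the
  global ghosts, and satisfies \<open>D \<phi>\<^sup>(\<^sup>A\<^sup>)\<^sup>,\<^sup>a\<^sub>p = R A a p\<close>.  The sign arises
  from moving \<open>D\<close> through \<open>dx\<^sup>I\<close>.
\<close>

definition field_derivation ::
  "nat \<Rightarrow> bool \<Rightarrow> (ladder \<Rightarrow> 'a \<Rightarrow> nat \<Rightarrow> 'a alg) \<Rightarrow> 'a alg \<Rightarrow> 'a alg"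
  where "field_derivation n s R = derivation n s
    (\<lambda>x. case x of
        Fld A a I J \<Rightarrow> cst (koszul s (odd (card I))) *
          fold (partial n) (sorted_list_of_multiset J) (form_comp n I (R A a (card I)))
      | _ \<Rightarrow> 0)"

definition d_prev ::
  "('a::finite \<Rightarrow> complex^'m^'m) \<Rightarrow> nat \<Rightarrow> ladder \<Rightarrow> nat \<Rightarrow> 'a alg^'m^'m"
  where "d_prev T n A p =
    (if p = 0 then 0 else (\<chi> i j. ext_d n (phi_mat T n A (p - 1) $ i $ j)))"

definition BRS :: "('a::finite \<Rightarrow> complex^'m^'m) \<Rightarrow> nat \<Rightarrow> 'a alg \<Rightarrow> 'a alg"
  where "BRS T n = field_derivation n True (\<lambda>A a p. case A of
      Phi1 \<Rightarrow> lie_comp T a (d_prev T n Phi1 p) + cst (1/2) * lie_comp T a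
        (\<Sum>q\<le>p. graded_comm True True (phi_mat T n Phi1 q) (phi_mat T n Phi1 (p - q)))
    | Phi2 \<Rightarrow> lie_comp T a (d_prev T n Phi2 p) + lie_comp T a
        (\<Sum>q\<le>p. graded_comm True (odd n) (phi_mat T n Phi1 q) (phi_mat T n Phi2 (p - q))))"

text \<open>\<open>phi n A a (n + 3) = 0\<close>, so the case \<open>p = n + 2\<close> needs no separate treatment.\<close>

definition WS :: "nat \<Rightarrow> nat \<Rightarrow> 'a alg \<Rightarrow> 'a alg"
  where "WS n \<mu> = field_derivation n True (\<lambda>A a p. - contract n \<mu> (phi n A a (p + 1)))"

definition WS_vec :: "nat \<Rightarrow> (nat \<Rightarrow> real) \<Rightarrow> 'a alg \<Rightarrow> 'a alg"
  where "WS_vec n \<xi> X = (\<Sum>\<mu><n+2. cst (of_real (\<xi> \<mu>)) * WS n \<mu> X)"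

definition WS_ghost :: "nat \<Rightarrow> 'a alg \<Rightarrow> 'a alg"
  where "WS_ghost n = field_derivation n True
    (\<lambda>A a p. - (\<Sum>\<mu><n+2. gen (Xi \<mu>) * contract n \<mu> (phi n A a (p + 1))))"

definition WT_ghost :: "nat \<Rightarrow> 'a alg \<Rightarrow> 'a alg"
  where "WT_ghost n = field_derivation n True
    (\<lambda>A a p. \<Sum>\<mu><n+2. gen (Eps \<mu>) * partial n \<mu> (phi n A a p))"

definition opG :: "nat \<Rightarrow> 'a \<Rightarrow> 'a alg \<Rightarrow> 'a alg"
  where "opG n a = field_derivation n (odd n)
    (\<lambda>A b p. if A = Phi2 \<and> p = 0 \<and> b = a then 1 else 0)"

definition opF :: "('a::finite \<Rightarrow> complex^'m^'m) \<Rightarrow> nat \<Rightarrow> 'a \<Rightarrow> 'a alg \<Rightarrow> 'a alg"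
  where "opF T n a = field_derivation n (even n) (\<lambda>A b p. case A of
      Phi1 \<Rightarrow> 0
    | Phi2 \<Rightarrow> lie_comp T b
        (graded_comm False True (\<chi> i j. cst (T a $ i $ j)) (phi_mat T n Phi1 p)))"

definition uG :: "nat \<Rightarrow> 'a alg \<Rightarrow> 'a alg"
  where "uG n = field_derivation n True
    (\<lambda>A b p. if A = Phi2 \<and> p = 0 then gen (U b) else 0)"

definition vF :: "('a::finite \<Rightarrow> complex^'m^'m) \<Rightarrow> nat \<Rightarrow> 'a alg \<Rightarrow> 'a alg"
  where "vF T n = field_derivation n True (\<lambda>A b p. case A of
      Phi1 \<Rightarrow> 0
    | Phi2 \<Rightarrow> lie_comp T b (graded_comm (odd n) True
        (\<chi> i j. \<Sum>a\<in>UNIV. cst (T a $ i $ j) * gen (V a)) (phi_mat T n Phi1 p)))"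

text \<open>
  The operators acting on the global ghosts; given the conventions above, the signs are the ones
  for which the coboundary operator squares to zero.
\<close>

definition ghost_shift :: "nat \<Rightarrow> 'a alg \<Rightarrow> 'a alg"
  where "ghost_shift n = derivation n True
    (\<lambda>x. case x of Eps \<mu> \<Rightarrow> - gen (Xi \<mu>) | V a \<Rightarrow> cst ((-1) ^ n) * gen (U a) | _ \<Rightarrow> 0)"

definition coboundary :: "('a::finite \<Rightarrow> complex^'m^'m) \<Rightarrow> nat \<Rightarrow> 'a alg \<Rightarrow> 'a alg"
  where "coboundary T n X =
    BRS T n X + WS_ghost n X + WT_ghost n X + (uG n X + vF T n X) + ghost_shift n X"

text \<open>
  Here the \<open>WS n \<mu>\<close> are odd and anticommute with the \<open>dx\<^sup>\<mu>\<close>; the sign is the one for which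
  \<open>\<nabla> \<phi>\<^sub>p = (p + 1) \<phi>\<^sub>p\<^sub>+\<^sub>1\<close>.
\<close>

definition climb :: "nat \<Rightarrow> 'a alg \<Rightarrow> 'a alg"
  where "climb n X = - (\<Sum>\<mu><n+2. dx \<mu> * WS n \<mu> X)"


section \<open>Local functionals\<close>

text \<open>
  Infinitesimal Lorentz transformations for the metric \<open>diag(\<eta> 0, \<dots>, \<eta> (n+1))\<close>: the Lie
  derivative along \<open>\<omega>\<^sup>\<mu>\<^sub>\<nu> x\<^sup>\<nu> \<partial>\<^sub>\<mu>\<close>.  Its transport term \<open>\<omega>\<^sup>\<mu>\<^sub>\<nu> x\<^sup>\<nu> \<partial>\<^sub>\<mu>\<close> is a total
  derivative on densities without explicit dependence on \<open>x\<close>, since \<open>\<omega>\<close> is traceless; what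
  remains rotates the form indices and the derivative indices.
\<close>

definition lorentz_alg :: "nat \<Rightarrow> (nat \<Rightarrow> real) \<Rightarrow> (nat \<Rightarrow> nat \<Rightarrow> real) \<Rightarrow> bool"
  where "lorentz_alg n \<eta> \<omega> \<longleftrightarrow>
    (\<forall>\<mu><n+2. \<forall>\<nu><n+2. \<eta> \<mu> * \<omega> \<mu> \<nu> + \<eta> \<nu> * \<omega> \<nu> \<mu> = 0)"

definition rotate_dx :: "nat \<Rightarrow> (nat \<Rightarrow> nat \<Rightarrow> real) \<Rightarrow> 'a alg \<Rightarrow> 'a alg"
  where "rotate_dx n \<omega> = derivation n False
    (\<lambda>x. case x of Dx \<mu> \<Rightarrow> \<Sum>\<nu><n+2. cst (of_real (\<omega> \<mu> \<nu>)) * dx \<nu> | _ \<Rightarrow> 0)"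

definition lorentz :: "nat \<Rightarrow> (nat \<Rightarrow> nat \<Rightarrow> real) \<Rightarrow> 'a alg \<Rightarrow> 'a alg"
  where "lorentz n \<omega> = derivation n False
    (\<lambda>x. case x of
        Fld A a I J \<Rightarrow>
          fold (partial n) (sorted_list_of_multiset J)
            (form_comp n I (rotate_dx n \<omega> (phi n A a (card I)))) +
          (\<Sum>\<mu><n+2. \<Sum>\<nu><n+2. cst (of_nat (count J \<mu>) * of_real (\<omega> \<nu> \<mu>)) *
            gen (Fld A a I (add_mset \<nu> (J - {#\<mu>#}))))
      | _ \<Rightarrow> 0)"

text \<open>
  Number-valued polynomials in the matrix-valued fields and their derivatives, i.e. polynomials
  in traces of products of such matrices.  Polynomials in the individual components with
  coefficients that are not built from traces are not admitted: without rigid gauge invariance the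
  BRS variation of \<open>\<integral> \<nabla>\<^sup>n\<^sup>+\<^sup>2 (y\<^sub>a\<^sub>b\<^sub>\<dots> c\<^sup>a c\<^sup>b \<dots>)\<close> satisfies all
  constraints imposed on an invariant counterterm, for arbitrary constants \<open>y\<close>.
\<close>

definition jet_mat ::
  "('a::finite \<Rightarrow> complex^'m^'m) \<Rightarrow> ladder \<times> nat set \<times> nat multiset \<Rightarrow> 'a alg^'m^'m"
  where "jet_mat T = (\<lambda>(A, I, J). \<chi> i j. \<Sum>a\<in>UNIV. cst (T a $ i $ j) * gen (Fld A a I J))"

inductive_set trace_poly :: "('a::finite \<Rightarrow> complex^'m^'m) \<Rightarrow> 'a alg set"
  for T :: "'a \<Rightarrow> complex^'m^'m" where
  const: "cst z \<in> trace_poly T"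
| form: "dx \<mu> \<in> trace_poly T"
| trace: "trace (foldr (\<lambda>x M. jet_mat T x ** M) xs (mat 1)) \<in> trace_poly T"
| add: "X \<in> trace_poly T \<Longrightarrow> Y \<in> trace_poly T \<Longrightarrow> X + Y \<in> trace_poly T"
| mult: "X \<in> trace_poly T \<Longrightarrow> Y \<in> trace_poly T \<Longrightarrow> X * Y \<in> trace_poly T"

fun is_field :: "'a gen \<Rightarrow> bool" where
  "is_field (Fld A a I J) = True"
| "is_field _ = False"

fun ghost_free_gen :: "nat \<Rightarrow> 'a gen \<Rightarrow> bool" where
  "ghost_free_gen n (Dx \<mu>) \<longleftrightarrow> \<mu> < n + 2"
| "ghost_free_gen n (Fld A a I J) \<longleftrightarrow> I \<subseteq> {..<n+2} \<and> set_mset J \<subseteq> {..<n+2}"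
| "ghost_free_gen n _ \<longleftrightarrow> False"

definition ghost_free :: "nat \<Rightarrow> 'a alg \<Rightarrow> bool"
  where "ghost_free n X \<longleftrightarrow> (\<forall>w\<in>Poly_Mapping.keys X. \<forall>x\<in>set w. ghost_free_gen n x)"

text \<open>
  Densities of the local functionals of ghost number \<open>g\<close> with the dimension of the classical
  action.
\<close>

definition local_functional ::
  "('a::finite \<Rightarrow> complex^'m^'m) \<Rightarrow> nat \<Rightarrow> (nat \<Rightarrow> real) \<Rightarrow> int \<Rightarrow> 'a alg \<Rightarrow> bool"
  where "local_functional T n \<eta> g X \<longleftrightarrow>
    X \<in> trace_poly T \<and> ghost_free n X \<and>
    (\<forall>w\<in>Poly_Mapping.keys X.
      (\<exists>x\<in>set w. is_field x) \<and>
      sum_list (map form_deg w) = n + 2 \<and>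
      sum_list (map (ghost n) w) = g \<and>
      sum_list (map dimension w) = n + 2) \<and>
    (\<forall>\<omega>. lorentz_alg n \<eta> \<omega> \<longrightarrow> functional_eq n (lorentz n \<omega> X) 0)"

definition tr_power :: "'a alg^'m^'m \<Rightarrow> nat \<Rightarrow> 'a alg"
  where "tr_power M k = trace (((\<lambda>N. M ** N) ^^ k) (mat 1))"

definition counterterm :: "('a::finite \<Rightarrow> complex^'m^'m) \<Rightarrow> nat \<Rightarrow> nat list \<Rightarrow> 'a alg"
  where "counterterm T n ks = cst (1 / fact (n + 2)) *
    (climb n ^^ (n + 2)) (prod_list (map (tr_power (phi_mat T n Phi1 0)) ks))"

end

(* Proof idea.  The vector supersymmetry operators W_mu anticommute and have a common contracting
   homotopy: with the odd derivations k_mu that remove mu from the form index of a ladder field,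
   {W_mu, k_nu} = delta_mu_nu N, where N counts fields.  The k_mu commute with total derivatives, so
   an invariant functional is N^(-n-2) W_0 ... W_(n+1) k_0 ... k_(n+1) of itself, up to sign.  The k_mu
   lower the dimension, which is n + 2, by one each; hence what W_0 ... W_(n+1) is applied to
   contains only undifferentiated 0-forms c and B.  By the same homotopy the shift symmetry of B
   descends to this polynomial, which therefore does not contain B, and a trace polynomial in the odd
   matrix c is spanned by products of traces of odd powers of c.  Finally W_0 ... W_(n+1) on top forms
   is a multiple of the (n+2)-nd power of the climbing operator.

   For the triviality statement, the parts of the coboundary of Delta^- linear in xi and in u show that
   Delta^- is again supersymmetric and shift invariant, hence of the same form; its BRS variation
   vanishes because [B, nabla] = d and the BRS variation of Tr c^k, k odd, is Tr c^(k+1) = 0. *)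

theory Submission
  imports Defs
begin

text \<open>Densities live in the free associative algebra, so identities hold only up to graded
  commutators (\<open>ceq\<close>) and, for functionals, up to total derivatives. Operator
  identities are therefore not computed on polynomials: \<open>gder\<close> collects the linear maps
  that descend to the graded-commutative quotient, graded commutators of such maps are again of this
  kind, and two of them that agree on generators agree. The homotopy rests on a Clifford-type
  relation: on form indices \<open>WS n \<mu>\<close> acts as exterior multiplication and its
  partner \<open>desc n \<mu>\<close> as contraction. Inverting the field number N is legitimate
  because each word of an admissible density contains a field; for the shift of the descended
  polynomial the same follows from its ghost number n + 2 + g - n > 0, where g is the ghost number
  of the functional. Both g = 0 and g = -1 are covered by one lemma, with m = n + 2 + g factors c.
  Total derivatives are disposed of by counting: d adds one derivative, so a derivative-free
  polynomial that is a total derivative vanishes.\<close>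

section \<open>The free algebra as a complex vector space with the words as basis\<close>

definition smul :: "complex \<Rightarrow> 'a alg \<Rightarrow> 'a alg" (infixr "\<odot>" 75)
  where "z \<odot> X = cst z * X"

lemma cst_add: "cst (y + z) = cst y + cst z"
  by (simp add: cst_def single_add)

lemma cst_mult: "cst (y * z) = cst y * cst z"
  by (simp add: cst_def mult_single plus_list_def)

lemma mon_Nil: "mon [] = 1"
  unfolding mon_def by (metis single_one zero_list_def)

lemma cst_0 [simp]: "cst 0 = 0" and cst_1 [simp]: "cst 1 = 1"
  by (simp_all add: cst_def single_one mon_Nil[unfolded mon_def])

lemma mon_append: "mon (u @ v) = mon u * mon v"
  by (simp add: mon_def mult_single plus_list_def)

lemma mon_Cons: "mon (x # w) = gen x * mon w"
  using mon_append[of "[x]" w] by simp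

lemma smul_mon: "z \<odot> mon w = Poly_Mapping.single w z"
  by (simp add: smul_def cst_def mon_def mult_single plus_list_def)

lemma alg_sum: "X = (\<Sum>w\<in>Poly_Mapping.keys X. Poly_Mapping.lookup X w \<odot> mon w)"
proof (rule poly_mapping_eqI)
  fix v
  have "Poly_Mapping.lookup (\<Sum>w\<in>Poly_Mapping.keys X. Poly_Mapping.lookup X w \<odot> mon w) v
     = (\<Sum>w\<in>Poly_Mapping.keys X. if w = v then Poly_Mapping.lookup X w else 0)"
    by (auto simp: lookup_sum smul_mon lookup_single when_def intro!: sum.cong)
  also have "\<dots> = Poly_Mapping.lookup X v"
    by (simp add: sum.delta in_keys_iff)
  finally show "Poly_Mapping.lookup X v =
    Poly_Mapping.lookup (\<Sum>w\<in>Poly_Mapping.keys X. Poly_Mapping.lookup X w \<odot> mon w) v" by simp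
qed

text \<open>Scalars sit on the empty word, the unit of concatenation, so they commute with
  everything exactly and not merely modulo graded commutators. This makes the product bilinear for
  \<open>\<odot>\<close>.\<close>

lemma cst_central: "X * cst z = cst z * X"
proof -
  have *: "mon w * cst z = cst z * mon w" for w :: "'a gen list"
    by (simp add: cst_def mon_def mult_single plus_list_def)
  have "cst y * mon w * cst z = cst z * (cst y * mon w)" for y and w :: "'a gen list"
    by (simp add: cst_def mon_def mult_single plus_list_def mult.commute)
  then show ?thesis
    by (subst (1 2) alg_sum[of X]) (simp add: sum_distrib_left sum_distrib_right smul_def)
qed

interpretation alg: vector_space smul
  by standard
    (auto simp: smul_def cst_add cst_mult algebra_simps)

lemma smul_mult_left [simp]: "(z \<odot> X) * Y = z \<odot> (X * Y)"
  by (simp add: smul_def mult.assoc)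

lemma smul_mult_right [simp]: "X * (z \<odot> Y) = z \<odot> (X * Y)"
  by (metis smul_def mult.assoc cst_central)

lemma smul_1: "cst z = z \<odot> 1"
  by (simp add: smul_def)

section \<open>Linear maps and linear extension from words\<close>

abbreviation clin :: "('a alg \<Rightarrow> 'b alg) \<Rightarrow> bool"
  where "clin \<equiv> module_hom smul smul"

lemma clinI:
  assumes "\<And>X Y. F (X + Y) = F X + F Y" "\<And>z X. F (z \<odot> X) = z \<odot> F X"
  shows "clin F"
  using assms by (simp add: module_hom_iff alg.module_axioms)

lemma clin_expand:
  assumes "clin F"
  shows "F X = (\<Sum>w\<in>Poly_Mapping.keys X. Poly_Mapping.lookup X w \<odot> F (mon w))"
  by (subst alg_sum[of X]) (simp add: module_hom.sum[OF assms] module_hom.scale[OF assms])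

text \<open>Agreement is demanded only on words occurring in \<open>X\<close>, so that support and
  degree hypotheses on \<open>X\<close> can be used word by word.\<close>

lemma clin_eqI:
  assumes "clin F" "clin G" "\<And>w. w \<in> Poly_Mapping.keys X \<Longrightarrow> F (mon w) = G (mon w)"
  shows "F X = G X"
  by (simp only: clin_expand[OF assms(1), of X] clin_expand[OF assms(2), of X] assms(3) cong: sum.cong)

lemma clin_compose: "clin F \<Longrightarrow> clin G \<Longrightarrow> clin (\<lambda>X. F (G X))"
  using module_hom_compose[of smul smul G smul F] by (simp add: comp_def)

lemma clin_mult_left: "clin (\<lambda>X. Y * X)"
  by (rule clinI) (simp_all add: algebra_simps)

lemma clin_mult_right: "clin (\<lambda>X. X * Y)"
  by (rule clinI) (simp_all add: algebra_simps)

lemma clin_scale: "clin F \<Longrightarrow> clin (\<lambda>X. z \<odot> F X)"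
  by (rule clinI) (simp_all add: module_hom.add module_hom.scale alg.scale_right_distrib mult.commute)

text \<open>\<open>derivation\<close> and the weight operators \<open>wt\<close> are both of this
  shape, which is how they inherit linearity.\<close>

definition word_ext :: "('a gen list \<Rightarrow> 'b alg) \<Rightarrow> 'a alg \<Rightarrow> 'b alg"
  where "word_ext F X = (\<Sum>w\<in>Poly_Mapping.keys X. Poly_Mapping.lookup X w \<odot> F w)"

lemma word_ext_superset:
  assumes "finite A" "Poly_Mapping.keys X \<subseteq> A"
  shows "word_ext F X = (\<Sum>w\<in>A. Poly_Mapping.lookup X w \<odot> F w)"
  unfolding word_ext_def using assms
  by (intro sum.mono_neutral_left) (auto simp: in_keys_iff)

lemma lookup_smul: "Poly_Mapping.lookup (z \<odot> X) w = z * Poly_Mapping.lookup X w"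
proof -
  have *: "Poly_Mapping.lookup (z \<odot> (y \<odot> mon v)) w = z * Poly_Mapping.lookup (y \<odot> mon v) w" for y v
    unfolding alg.scale_scale unfolding smul_mon by (simp add: lookup_single when_def)
  have "Poly_Mapping.lookup (z \<odot> X) w = Poly_Mapping.lookup (\<Sum>v\<in>Poly_Mapping.keys X. z \<odot> (Poly_Mapping.lookup X v \<odot> mon v)) w"
    by (subst alg_sum[of X]) (simp add: alg.scale_sum_right)
  also have "\<dots> = z * Poly_Mapping.lookup (\<Sum>v\<in>Poly_Mapping.keys X. Poly_Mapping.lookup X v \<odot> mon v) w"
    unfolding lookup_sum sum_distrib_left by (simp only: *)
  finally show ?thesis by (simp flip: alg_sum)
qed

lemma keys_smul: "Poly_Mapping.keys (z \<odot> X) \<subseteq> Poly_Mapping.keys X"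
  by (auto simp: in_keys_iff lookup_smul)

lemma clin_word_ext: "clin (word_ext (F :: 'a gen list \<Rightarrow> 'b alg))"
proof (rule clinI)
  fix X Y :: "'a alg"
  let ?A = "Poly_Mapping.keys X \<union> Poly_Mapping.keys Y"
  have "word_ext F X = (\<Sum>w\<in>?A. Poly_Mapping.lookup X w \<odot> F w)"
    "word_ext F Y = (\<Sum>w\<in>?A. Poly_Mapping.lookup Y w \<odot> F w)"
    "word_ext F (X + Y) = (\<Sum>w\<in>?A. Poly_Mapping.lookup (X + Y) w \<odot> F w)"
    by (auto intro!: word_ext_superset dest!: subsetD[OF Poly_Mapping.keys_add])
  then show "word_ext F (X + Y) = word_ext F X + word_ext F Y"
    by (simp add: lookup_add alg.scale_left_distrib sum.distrib)
next
  fix z and X :: "'a alg"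
  have "word_ext F (z \<odot> X) = (\<Sum>w\<in>Poly_Mapping.keys X. Poly_Mapping.lookup (z \<odot> X) w \<odot> F w)"
    by (intro word_ext_superset keys_smul) auto
  then show "word_ext F (z \<odot> X) = z \<odot> word_ext F X"
    by (simp add: lookup_smul word_ext_def alg.scale_sum_right)
qed

lemma word_ext_mon [simp]: "word_ext F (mon w) = F w"
  by (simp add: word_ext_def mon_def)

lemma derivation_word_ext: "derivation n s f = word_ext (der_word n s f)"
  by (simp add: fun_eq_iff derivation_def word_ext_def smul_def)

lemma clin_derivation: "clin (derivation n s f)"
  unfolding derivation_word_ext by (rule clin_word_ext)

lemma derivation_mon [simp]: "derivation n s f (mon w) = der_word n s f w"
  by (simp add: derivation_word_ext)

lemma der_word_Cons: "der_word n s f (x # w) =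
    f x * mon w + koszul s (odd_gen n x) \<odot> (gen x * der_word n s f w)"
  by (simp add: smul_def mult.assoc)

declare der_word.simps(2) [simp del]
declare der_word_Cons [simp]

section \<open>Gradings and supports\<close>

text \<open>
  Additive integer gradings of words.  All operators below are homogeneous for the grading
  \<open>tot\<close> by ghost number plus form degree, whose parity gives the Koszul signs.
\<close>

definition gr :: "('a gen \<Rightarrow> int) \<Rightarrow> int \<Rightarrow> 'a alg \<Rightarrow> bool"
  where "gr \<nu> k X \<longleftrightarrow> (\<forall>w\<in>Poly_Mapping.keys X. sum_list (map \<nu> w) = k)"

definition supp :: "'a gen set \<Rightarrow> 'a alg \<Rightarrow> bool"
  where "supp S X \<longleftrightarrow> (\<forall>w\<in>Poly_Mapping.keys X. set w \<subseteq> S)"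

lemma gr_0 [simp]: "gr \<nu> k 0" by (simp add: gr_def)

lemma gr_add: "gr \<nu> k X \<Longrightarrow> gr \<nu> k Y \<Longrightarrow> gr \<nu> k (X + Y)"
  using Poly_Mapping.keys_add[of X Y] by (auto simp: gr_def)

lemma gr_smul: "gr \<nu> k X \<Longrightarrow> gr \<nu> k (z \<odot> X)"
  using keys_smul[of z X] by (auto simp: gr_def)

lemma gr_sum: "(\<And>i. i \<in> A \<Longrightarrow> gr \<nu> k (f i)) \<Longrightarrow> gr \<nu> k (\<Sum>i\<in>A. f i)"
  by (induction A rule: infinite_finite_induct) (auto intro: gr_add)

lemma gr_mon_iff [simp]: "gr \<nu> k (mon w) \<longleftrightarrow> sum_list (map \<nu> w) = k"
  by (simp add: gr_def mon_def)

lemma gr_minus: "gr \<nu> k X \<Longrightarrow> gr \<nu> k (- X)"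
  using gr_smul[of \<nu> k X "-1"] by simp

lemma gr_diff: "gr \<nu> k X \<Longrightarrow> gr \<nu> k Y \<Longrightarrow> gr \<nu> k (X - Y)"
  using gr_add[of \<nu> k X "- Y"] gr_minus by auto

lemma gr_mult: "gr \<nu> k X \<Longrightarrow> gr \<nu> l Y \<Longrightarrow> gr \<nu> (k + l) (X * Y)"
  using Poly_Mapping.keys_mult[of X Y] unfolding gr_def plus_list_def by fastforce

lemma gr_1 [simp]: "gr \<nu> k 1 \<longleftrightarrow> k = 0"
  by (subst mon_Nil[symmetric]) auto

lemma supp_0 [simp]: "supp S 0" by (simp add: supp_def)

lemma supp_add: "supp S X \<Longrightarrow> supp S Y \<Longrightarrow> supp S (X + Y)"
  using Poly_Mapping.keys_add[of X Y] by (auto simp: supp_def)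

lemma supp_smul: "supp S X \<Longrightarrow> supp S (z \<odot> X)"
  using keys_smul[of z X] by (auto simp: supp_def)

lemma supp_sum: "(\<And>i. i \<in> A \<Longrightarrow> supp S (f i)) \<Longrightarrow> supp S (\<Sum>i\<in>A. f i)"
  by (induction A rule: infinite_finite_induct) (auto intro: supp_add)

lemma supp_mon [simp]: "supp S (mon w) \<longleftrightarrow> set w \<subseteq> S"
  by (simp add: supp_def mon_def)

lemma supp_minus: "supp S X \<Longrightarrow> supp S (- X)"
  using supp_smul[of S X "-1"] by simp

lemma supp_diff: "supp S X \<Longrightarrow> supp S Y \<Longrightarrow> supp S (X - Y)"
  using supp_add[of S X "- Y"] supp_minus by auto

lemma supp_mult: "supp S X \<Longrightarrow> supp S Y \<Longrightarrow> supp S (X * Y)"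
  using Poly_Mapping.keys_mult[of X Y] unfolding supp_def plus_list_def by fastforce

lemma supp_1 [simp]: "supp S 1"
  by (subst mon_Nil[symmetric]) auto

lemma supp_mono: "supp S X \<Longrightarrow> S \<subseteq> S' \<Longrightarrow> supp S' X"
  by (auto simp: supp_def)

lemma supp_UNIV [simp]: "supp UNIV X"
  by (simp add: supp_def)

lemma der_word_supp:
  "(\<And>x. x \<in> S \<Longrightarrow> supp S (f x)) \<Longrightarrow> set w \<subseteq> S \<Longrightarrow> supp S (der_word n s f w)"
  by (induction w) (auto intro!: supp_add supp_mult supp_smul)

lemma derivation_supp:
  assumes "\<And>x. x \<in> S \<Longrightarrow> supp S (f x)" "supp S X"
  shows "supp S (derivation n s f X)"
  unfolding derivation_word_ext word_ext_def
  using assms(2) by (intro supp_sum supp_smul der_word_supp assms(1)) (auto simp: supp_def)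

lemma der_word_gr:
  "(\<And>x. x \<in> S \<Longrightarrow> gr \<nu> (\<nu> x + e) (f x)) \<Longrightarrow> set w \<subseteq> S \<Longrightarrow>
    gr \<nu> (sum_list (map \<nu> w) + e) (der_word n s f w)"
proof (induction w)
  case (Cons x w)
  have "gr \<nu> ((\<nu> x + e) + sum_list (map \<nu> w)) (f x * mon w)"
    "gr \<nu> (\<nu> x + (sum_list (map \<nu> w) + e)) (gen x * der_word n s f w)"
    using Cons by (auto intro!: gr_mult)
  then show ?case by (auto intro!: gr_add gr_smul simp: algebra_simps)
qed auto

lemma derivation_gr:
  assumes "\<And>x. x \<in> S \<Longrightarrow> gr \<nu> (\<nu> x + e) (f x)" "supp S X" "gr \<nu> k X"
  shows "gr \<nu> (k + e) (derivation n s f X)"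
  unfolding derivation_word_ext word_ext_def
  using assms(2,3) der_word_gr[OF assms(1)]
  by (intro gr_sum gr_smul) (auto simp: supp_def gr_def)

definition tot :: "nat \<Rightarrow> 'a gen \<Rightarrow> int"
  where "tot n x = ghost n x + int (form_deg x)"

lemma odd_gen_tot: "odd_gen n x = odd (tot n x)"
  by (simp add: odd_gen_def tot_def)

text \<open>Koszul signs as a function of integer degrees. Degrees rather than parities compose
  additively, also for operators of negative degree such as contractions.\<close>

definition sg :: "int \<Rightarrow> int \<Rightarrow> complex"
  where "sg j k = koszul (odd j) (odd k)"

lemma koszul_square [simp]: "koszul s t * koszul s t = 1" "koszul s t * (koszul s t * z) = z"
  by (auto simp: koszul_def)

lemma sg_square [simp]: "sg j k * sg j k = 1" "sg j k * (sg j k * z) = z"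
  by (auto simp: sg_def)

lemma sg_add: "sg (i + j) k = sg i k * sg j k" "sg k (i + j) = sg k i * sg k j"
  by (auto simp: sg_def koszul_def)

lemma sg_commute: "sg j k = sg k j"
  by (auto simp: sg_def koszul_def)

lemma sg_0 [simp]: "sg 0 k = 1" "sg k 0 = 1"
  by (auto simp: sg_def koszul_def)

text \<open>No generators are reordered, so the Leibniz rule holds exactly in the free algebra; the
  sign collects the parity of the whole prefix.\<close>

lemma der_word_append:
  "der_word n s f (u @ w) = der_word n s f u * mon w +
    koszul s (odd (sum_list (map (tot n) u))) \<odot> (mon u * der_word n s f w)"
proof (induction u)
  case Nil
  show ?case by (simp add: koszul_def mon_Nil)
next
  case (Cons x u)
  have *: "koszul s (odd (tot n x)) * koszul s (odd k) = koszul s (odd (tot n x + k))" for k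
    by (auto simp: koszul_def)
  show ?case
    by (simp add: Cons odd_gen_tot mon_append mon_Cons[of x u] distrib_left distrib_right
        mult.assoc * alg.scale_right_distrib add.assoc del: even_add odd_add)
qed

text \<open>Only the left factor has to be homogeneous, since the derivation moves past it
  alone.\<close>

lemma derivation_mult:
  assumes "gr (tot n) k X"
  shows "derivation n s f (X * Y) =
    derivation n s f X * Y + koszul s (odd k) \<odot> (X * derivation n s f Y)"
proof -
  let ?D = "derivation n s f"
  have D: "clin ?D" by (rule clin_derivation)
  have "?D (mon u * Y) = ?D (mon u) * Y + koszul s (odd k) \<odot> (mon u * ?D Y)"
    if u: "u \<in> Poly_Mapping.keys X" for u
  proof (rule clin_eqI[where F = "\<lambda>Y. ?D (mon u * Y)" and
      G = "\<lambda>Y. ?D (mon u) * Y + koszul s (odd k) \<odot> (mon u * ?D Y)"])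
    show "clin (\<lambda>Y. ?D (mon u * Y))" by (intro clin_compose[OF D] clin_mult_left)
    show "clin (\<lambda>Y. ?D (mon u) * Y + koszul s (odd k) \<odot> (mon u * ?D Y))"
      by (rule clinI) (simp_all add: module_hom.add[OF D] module_hom.scale[OF D] distrib_left distrib_right alg.scale_right_distrib mult.commute[of "_::complex"])
    fix w
    have "sum_list (map (tot n) u) = k" using u assms by (simp add: gr_def)
    then show "?D (mon u * mon w) = ?D (mon u) * mon w + koszul s (odd k) \<odot> (mon u * ?D (mon w))"
      by (simp flip: mon_append add: der_word_append)
  qed
  note * = this
  show ?thesis
  proof (rule clin_eqI[where F = "\<lambda>X. ?D (X * Y)" and G = "\<lambda>X. ?D X * Y + koszul s (odd k) \<odot> (X * ?D Y)"])
    show "clin (\<lambda>X. ?D (X * Y))" by (intro clin_compose[OF D] clin_mult_right)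
    show "clin (\<lambda>X. ?D X * Y + koszul s (odd k) \<odot> (X * ?D Y))"
      by (rule clinI) (simp_all add: module_hom.add[OF D] module_hom.scale[OF D] distrib_left distrib_right alg.scale_right_distrib mult.commute[of "_::complex"])
  qed (rule *)
qed

section \<open>Congruence modulo graded commutators\<close>

definition ceq :: "nat \<Rightarrow> 'a alg \<Rightarrow> 'a alg \<Rightarrow> bool"
  where "ceq n X Y \<longleftrightarrow> X - Y \<in> comm_ideal n"

lemma ideal_mult:
  assumes "X \<in> comm_ideal n"
  shows "Y * X * Z \<in> comm_ideal n"
  using assms
proof induction
  case (comm p x y q)
  have "Y * (p * (gen x * gen y - cst (koszul (odd_gen n x) (odd_gen n y)) * (gen y * gen x)) * q) * Z
    = (Y * p) * (gen x * gen y - cst (koszul (odd_gen n x) (odd_gen n y)) * (gen y * gen x)) * (q * Z)"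
    by (simp only: mult.assoc)
  then show ?case using comm_ideal.comm by metis
qed (auto intro: comm_ideal.intros simp: distrib_left distrib_right)

lemma ideal_mult_left: "X \<in> comm_ideal n \<Longrightarrow> Y * X \<in> comm_ideal n"
  using ideal_mult[of X n Y 1] by simp

lemma ideal_mult_right: "X \<in> comm_ideal n \<Longrightarrow> X * Y \<in> comm_ideal n"
  using ideal_mult[of X n 1 Y] by simp

lemma ideal_smul: "X \<in> comm_ideal n \<Longrightarrow> z \<odot> X \<in> comm_ideal n"
  unfolding smul_def by (rule ideal_mult_left)

lemma ideal_minus: "X \<in> comm_ideal n \<Longrightarrow> - X \<in> comm_ideal n"
  using ideal_smul[of X n "-1"] by simp

lemma ideal_diff: "X \<in> comm_ideal n \<Longrightarrow> Y \<in> comm_ideal n \<Longrightarrow> X - Y \<in> comm_ideal n"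
  using comm_ideal.add[of X n "- Y"] ideal_minus by auto

lemma ideal_sum: "(\<And>i. i \<in> A \<Longrightarrow> f i \<in> comm_ideal n) \<Longrightarrow> (\<Sum>i\<in>A. f i) \<in> comm_ideal n"
  by (induction A rule: infinite_finite_induct) (auto intro: comm_ideal.intros)

lemma ceq_refl [simp, intro]: "ceq n X X"
  by (simp add: ceq_def comm_ideal.zero)

lemma ceq_sym: "ceq n X Y \<Longrightarrow> ceq n Y X"
  unfolding ceq_def using ideal_minus by fastforce

lemma ceq_trans [trans]: "ceq n X Y \<Longrightarrow> ceq n Y Z \<Longrightarrow> ceq n X Z"
  unfolding ceq_def using comm_ideal.add by fastforce

lemma ceq_eq_trans [trans]: "ceq n X Y \<Longrightarrow> Y = Z \<Longrightarrow> ceq n X Z"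
  "X = Y \<Longrightarrow> ceq n Y Z \<Longrightarrow> ceq n X Z"
  by auto

lemma ceq_add: "ceq n X Y \<Longrightarrow> ceq n X' Y' \<Longrightarrow> ceq n (X + X') (Y + Y')"
  unfolding ceq_def using comm_ideal.add by (fastforce simp: add_diff_add)

lemma ceq_smul: "ceq n X Y \<Longrightarrow> ceq n (z \<odot> X) (z \<odot> Y)"
  unfolding ceq_def using ideal_smul[of "X - Y" n z] by (simp add: alg.scale_right_diff_distrib)

lemma ceq_minus: "ceq n X Y \<Longrightarrow> ceq n (- X) (- Y)"
  using ceq_smul[of n X Y "-1"] by simp

lemma ceq_diff: "ceq n X Y \<Longrightarrow> ceq n X' Y' \<Longrightarrow> ceq n (X - X') (Y - Y')"
  using ceq_add[of n X Y "- X'" "- Y'"] ceq_minus by auto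

lemma ceq_sum: "(\<And>i. i \<in> A \<Longrightarrow> ceq n (f i) (g i)) \<Longrightarrow> ceq n (\<Sum>i\<in>A. f i) (\<Sum>i\<in>A. g i)"
  unfolding ceq_def using ideal_sum[of A "\<lambda>i. f i - g i" n] by (simp add: sum_subtractf)

lemma ceq_mult: "ceq n X Y \<Longrightarrow> ceq n X' Y' \<Longrightarrow> ceq n (X * X') (Y * Y')"
proof -
  assume "ceq n X Y" "ceq n X' Y'"
  then have "(X - Y) * X' + Y * (X' - Y') \<in> comm_ideal n"
    unfolding ceq_def by (intro comm_ideal.add ideal_mult_left ideal_mult_right)
  then show ?thesis by (simp add: ceq_def algebra_simps)
qed

text \<open>The ideal is generated by commutators of single generators, so \<open>x\<close> is moved
  past the word letter by letter and the signs multiply to that of the total degree.\<close>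

lemma ceq_gen_mon: "ceq n (gen x * mon v) (sg (tot n x) (sum_list (map (tot n) v)) \<odot> (mon v * gen x))"
proof (induction v)
  case (Cons y v)
  let ?k = "sum_list (map (tot n) v)"
  have "1 * (gen x * gen y - cst (koszul (odd_gen n x) (odd_gen n y)) * (gen y * gen x)) * mon v
    \<in> comm_ideal n" by (rule comm_ideal.comm)
  then have "ceq n (gen x * gen y * mon v) (sg (tot n x) (tot n y) \<odot> (gen y * gen x * mon v))"
    by (simp add: ceq_def smul_def sg_def odd_gen_tot algebra_simps)
  also have "ceq n \<dots> (sg (tot n x) (tot n y) \<odot> (gen y * (sg (tot n x) ?k \<odot> (mon v * gen x))))"
    unfolding mult.assoc by (intro ceq_smul ceq_mult ceq_refl Cons)
  finally show ?case by (simp add: mon_Cons[of y v] sg_add mult.assoc)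
qed (simp add: mon_Nil)

lemma ceq_mon_mon: "ceq n (mon u * mon v)
    (sg (sum_list (map (tot n) u)) (sum_list (map (tot n) v)) \<odot> (mon v * mon u))"
proof (induction u)
  case (Cons x u)
  let ?k = "sum_list (map (tot n) v)" and ?l = "sum_list (map (tot n) u)"
  have "ceq n (gen x * (mon u * mon v)) (gen x * (sg ?l ?k \<odot> (mon v * mon u)))"
    by (intro ceq_mult Cons ceq_refl)
  also have "\<dots> = sg ?l ?k \<odot> ((gen x * mon v) * mon u)" by (simp add: mult.assoc)
  also have "ceq n \<dots> (sg ?l ?k \<odot> ((sg (tot n x) ?k \<odot> (mon v * gen x)) * mon u))"
    by (intro ceq_smul ceq_mult ceq_refl ceq_gen_mon)
  finally show ?case by (simp add: mon_Cons[of x u] sg_add mult.assoc mult.commute)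
qed (simp add: mon_Nil)

text \<open>Bilinear extension of \<open>ceq_mon_mon\<close>; homogeneity of both factors provides
  one common sign for all pairs of words.\<close>

lemma supercommute:
  assumes X: "gr (tot n) k X" and Y: "gr (tot n) l Y"
  shows "ceq n (X * Y) (sg k l \<odot> (Y * X))"
proof -
  let ?a = "Poly_Mapping.lookup X" and ?b = "Poly_Mapping.lookup Y"
  have "ceq n (\<Sum>u\<in>Poly_Mapping.keys X. \<Sum>v\<in>Poly_Mapping.keys Y. ?a u \<odot> (?b v \<odot> (mon u * mon v)))
     (\<Sum>u\<in>Poly_Mapping.keys X. \<Sum>v\<in>Poly_Mapping.keys Y. ?a u \<odot> (?b v \<odot> (sg k l \<odot> (mon v * mon u))))"
    using X Y ceq_mon_mon[of n] unfolding gr_def by (intro ceq_sum ceq_smul) force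
  also have "(\<Sum>u\<in>Poly_Mapping.keys X. \<Sum>v\<in>Poly_Mapping.keys Y. ?a u \<odot> (?b v \<odot> (mon u * mon v)))
     = (\<Sum>u\<in>Poly_Mapping.keys X. \<Sum>v\<in>Poly_Mapping.keys Y. (?a u \<odot> mon u) * (?b v \<odot> mon v))"
    by (simp add: mult.commute)
  also have "\<dots> = X * Y"
    by (simp only: sum_product[symmetric] alg_sum[symmetric])
  also have "(\<Sum>u\<in>Poly_Mapping.keys X. \<Sum>v\<in>Poly_Mapping.keys Y. ?a u \<odot> (?b v \<odot> (sg k l \<odot> (mon v * mon u))))
     = sg k l \<odot> (\<Sum>u\<in>Poly_Mapping.keys X. \<Sum>v\<in>Poly_Mapping.keys Y. (?b v \<odot> mon v) * (?a u \<odot> mon u))"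
    by (simp add: alg.scale_sum_right mult_ac)
  also have "(\<Sum>u\<in>Poly_Mapping.keys X. \<Sum>v\<in>Poly_Mapping.keys Y. (?b v \<odot> mon v) * (?a u \<odot> mon u)) = Y * X"
    by (subst sum.swap, simp only: sum_product[symmetric] alg_sum[symmetric])
  finally show ?thesis .
qed

text \<open>By linearity the factors around a generator commutator may be taken to be words. Serves
  derivations and weight operators alike.\<close>

lemma clin_ideal:
  assumes F: "clin F"
    and *: "\<And>u x y v. F (mon u * (gen x * gen y - koszul (odd_gen n x) (odd_gen n y) \<odot> (gen y * gen x)) * mon v)
      \<in> comm_ideal n"
    and X: "X \<in> comm_ideal n"
  shows "F X \<in> comm_ideal n"
  using X
proof induction
  case (comm p x y q)
  let ?c = "gen x * gen y - koszul (odd_gen n x) (odd_gen n y) \<odot> (gen y * gen x)"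
  have "F (p * ?c * q) = (\<Sum>u\<in>Poly_Mapping.keys p. \<Sum>v\<in>Poly_Mapping.keys q.
     Poly_Mapping.lookup p u \<odot> (Poly_Mapping.lookup q v \<odot> F (mon u * ?c * mon v)))"
    by (subst alg_sum[of p], subst alg_sum[of q], subst sum.swap)
     (simp add: sum_distrib_left sum_distrib_right alg.scale_sum_right mult.commute
       module_hom.sum[OF F] module_hom.scale[OF F])
  also have "\<dots> \<in> comm_ideal n"
    by (intro ideal_sum ideal_smul *)
  finally show ?case by (simp add: smul_def)
qed (auto simp: module_hom.zero[OF F] module_hom.add[OF F] intro: comm_ideal.intros)

declare sum.lessThan_Suc [simp del]

section \<open>Graded derivations modulo graded commutators\<close>

text \<open>
  The Leibniz rule is required only modulo graded commutators; this makes the class closed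
  under left multiplication by homogeneous elements.
\<close>

definition gder :: "nat \<Rightarrow> int \<Rightarrow> ('a alg \<Rightarrow> 'a alg) \<Rightarrow> bool"
  where "gder n e F \<longleftrightarrow> clin F \<and> (\<forall>X\<in>comm_ideal n. F X \<in> comm_ideal n) \<and>
    (\<forall>k X. gr (tot n) k X \<longrightarrow> gr (tot n) (k + e) (F X)) \<and>
    (\<forall>k X Y. gr (tot n) k X \<longrightarrow> ceq n (F (X * Y)) (F X * Y + sg e k \<odot> (X * F Y)))"

lemma gderI:
  assumes "clin F" "\<And>X. X \<in> comm_ideal n \<Longrightarrow> F X \<in> comm_ideal n"
    "\<And>k X. gr (tot n) k X \<Longrightarrow> gr (tot n) (k + e) (F X)"
    "\<And>k X Y. gr (tot n) k X \<Longrightarrow> ceq n (F (X * Y)) (F X * Y + sg e k \<odot> (X * F Y))"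
  shows "gder n e F"
  using assms by (auto simp: gder_def)

lemma gder_clin: "gder n e F \<Longrightarrow> clin F"
  and gder_ideal: "gder n e F \<Longrightarrow> X \<in> comm_ideal n \<Longrightarrow> F X \<in> comm_ideal n"
  and gder_gr: "gder n e F \<Longrightarrow> gr (tot n) k X \<Longrightarrow> gr (tot n) (k + e) (F X)"
  and gder_mult: "gder n e F \<Longrightarrow> gr (tot n) k X \<Longrightarrow>
    ceq n (F (X * Y)) (F X * Y + sg e k \<odot> (X * F Y))"
  by (auto simp: gder_def)

lemmas gder_add = gder_clin[THEN module_hom.add]
  and gder_smul = gder_clin[THEN module_hom.scale]
  and gder_diff = gder_clin[THEN module_hom.diff]
  and gder_minus = gder_clin[THEN module_hom.neg]
  and gder_sum = gder_clin[THEN module_hom.sum]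
  and gder_0 = gder_clin[THEN module_hom.zero]

lemma gder_ceq: "gder n e F \<Longrightarrow> ceq n X Y \<Longrightarrow> ceq n (F X) (F Y)"
  unfolding ceq_def by (metis gder_diff gder_ideal)

text \<open>From 1 = 1 * 1 the Leibniz rule gives F 1 = F 1 + F 1; only a congruence results because
  the rule itself is one.\<close>

lemma gder_1:
  assumes "gder n e F" shows "ceq n (F 1) 0"
proof -
  have "ceq n (F (1 * 1)) (F 1 * 1 + sg e 0 \<odot> (1 * F 1))"
    by (rule gder_mult[OF assms]) simp
  then have "F 1 - (F 1 + F 1) \<in> comm_ideal n" by (simp add: ceq_def)
  then have "- (F 1 - (F 1 + F 1)) \<in> comm_ideal n" by (rule ideal_minus)
  then show ?thesis by (simp add: ceq_def)
qed

text \<open>Descent to the quotient: a derivation maps the graded commutator of x and y to graded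
  commutators of f x with y and of f y with x, and these lie in the ideal by
  \<open>supercommute\<close> because \<open>f\<close> is homogeneous.\<close>

lemma gder_derivation:
  assumes f: "\<And>x :: 'a gen. gr (tot n) (tot n x + e) (f x)" and s: "s = odd e"
  shows "gder n e (derivation n s f)"
proof (rule gderI)
  let ?D = "derivation n s f"
  show D: "clin ?D" by (rule clin_derivation)
  show grD: "gr (tot n) (k + e) (?D X)" if "gr (tot n) k X" for k X
    using that by (intro derivation_gr[where S = UNIV]) (auto simp: f)
  have mult: "?D (X * Y) = ?D X * Y + sg e k \<odot> (X * ?D Y)" if "gr (tot n) k X" for k X Y
    using derivation_mult[OF that, of s f Y] by (simp add: s sg_def)
  then show "ceq n (?D (X * Y)) (?D X * Y + sg e k \<odot> (X * ?D Y))" if "gr (tot n) k X" for k X Y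
    using that by auto
  show "?D X \<in> comm_ideal n" if X: "X \<in> comm_ideal n" for X
  proof (rule clin_ideal[OF D _ X])
    fix u v :: "'a gen list" and x y :: "'a gen"
    let ?z = "sg (tot n x) (tot n y)"
    let ?c = "gen x * gen y - ?z \<odot> (gen y * gen x) :: 'a alg"
    have c: "?c \<in> comm_ideal n"
      using comm_ideal.comm[of 1 x y n 1] by (simp add: smul_def sg_def odd_gen_tot)
    have grc: "gr (tot n) (tot n x + tot n y) ?c"
      by (intro gr_diff gr_smul) (auto intro: gr_mult[THEN back_subst[of "\<lambda>k. gr (tot n) k _"]] simp: mon_append[symmetric])
    have Dx: "?D (gen x) = f x" for x by (simp add: mon_Nil)
    \<comment> \<open>Regrouped so that the two terms with \<open>f x\<close> form one graded
      commutator and the two terms with \<open>f y\<close> another.\<close>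
    have "?D ?c = (f x * gen y - sg (tot n x + e) (tot n y) \<odot> (gen y * f x))
       - ?z \<odot> (f y * gen x - sg (tot n y + e) (tot n x) \<odot> (gen x * f y))"
    proof -
      have s1: "sg (tot n x + e) (tot n y) = ?z * sg e (tot n y)" by (simp add: sg_add)
      have s2: "?z * sg (tot n y + e) (tot n x) = sg e (tot n x)"
        by (simp add: sg_add sg_commute[of "tot n y" "tot n x"])
      have "?D ?c = (f x * gen y + sg e (tot n x) \<odot> (gen x * f y)) -
         ?z \<odot> (f y * gen x + sg e (tot n y) \<odot> (gen y * f x))"
        using mult[of "tot n x" "gen x" "gen y"] mult[of "tot n y" "gen y" "gen x"]
        by (simp add: module_hom.diff[OF D] module_hom.scale[OF D] mon_Nil)
      then show ?thesis
        by (simp add: s1 s2 alg.scale_right_diff_distrib alg.scale_right_distrib)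
    qed
    also have "\<dots> \<in> comm_ideal n"
      by (intro ideal_diff[OF _ ideal_smul] supercommute[unfolded ceq_def] f) auto
    finally have Dc: "?D ?c \<in> comm_ideal n" .
    have "?D (mon u * (?c * mon v)) = ?D (mon u) * (?c * mon v) + sg e (sum_list (map (tot n) u)) \<odot>
      (mon u * (?D ?c * mon v + sg e (tot n x + tot n y) \<odot> (?c * ?D (mon v))))"
      using mult[OF grc, of "mon v"] mult[of "sum_list (map (tot n) u)" "mon u" "?c * mon v"] by simp
    also have "\<dots> \<in> comm_ideal n"
      by (rule comm_ideal.add[OF ideal_mult_left[OF ideal_mult_right[OF c]] ideal_smul[OF
            ideal_mult_left[OF comm_ideal.add[OF ideal_mult_right[OF Dc] ideal_smul[OF ideal_mult_right[OF c]]]]]])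
    finally show "?D (mon u * (gen x * gen y - koszul (odd_gen n x) (odd_gen n y) \<odot> (gen y * gen x)) * mon v) \<in> comm_ideal n"
      by (simp add: sg_def odd_gen_tot mult.assoc)
  qed
qed

text \<open>Induction along words with the Leibniz rule. The set \<open>S\<close> admits relations
  that hold only on part of the generators, such as those with form indices in range.\<close>

lemma gder_cong:
  assumes F: "gder n e F" and G: "gder n e G"
    and gen: "\<And>x. x \<in> S \<Longrightarrow> ceq n (F (gen x)) (G (gen x))" and X: "supp S X"
  shows "ceq n (F X) (G X)"
proof -
  have *: "ceq n (F (mon w)) (G (mon w))" if "set w \<subseteq> S" for w
    using that
  proof (induction w)
    case Nil
    show ?case
      using gder_1[OF F] gder_1[OF G] ceq_sym ceq_trans by (metis mon_Nil)
  next
    case (Cons x w)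
    have "ceq n (F (gen x * mon w)) (F (gen x) * mon w + sg e (tot n x) \<odot> (gen x * F (mon w)))"
      by (rule gder_mult[OF F]) simp
    also have "ceq n \<dots> (G (gen x) * mon w + sg e (tot n x) \<odot> (gen x * G (mon w)))"
      using Cons by (intro ceq_add ceq_smul ceq_mult gen) auto
    also have "ceq n \<dots> (G (gen x * mon w))"
      by (rule ceq_sym, rule gder_mult[OF G]) simp
    finally show ?case by (simp add: mon_Cons[of x w])
  qed
  show ?thesis
    unfolding clin_expand[OF gder_clin[OF F], of X] clin_expand[OF gder_clin[OF G], of X]
    using X by (intro ceq_sum ceq_smul *) (auto simp: supp_def)
qed

lemma gder_plus:
  assumes F: "gder n e F" and G: "gder n e G"
  shows "gder n e (\<lambda>X. F X + G X)"
proof (rule gderI)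
  fix k :: int and X Y :: "'a alg" assume X: "gr (tot n) k X"
  show "ceq n (F (X * Y) + G (X * Y)) ((F X + G X) * Y + sg e k \<odot> (X * (F Y + G Y)))"
    using ceq_add[OF gder_mult[OF F X] gder_mult[OF G X], of Y Y]
    by (simp add: algebra_simps alg.scale_right_distrib)
qed (use F G in \<open>auto intro: comm_ideal.add gder_ideal gr_add gder_gr
    intro!: clinI simp: gder_add gder_smul alg.scale_right_distrib\<close>)

lemma gder_scale:
  assumes F: "gder n e F"
  shows "gder n e (\<lambda>X. z \<odot> F X)"
proof (rule gderI)
  fix k :: int and X Y :: "'a alg" assume X: "gr (tot n) k X"
  show "ceq n (z \<odot> F (X * Y)) (z \<odot> F X * Y + sg e k \<odot> (X * z \<odot> F Y))"
    using ceq_smul[OF gder_mult[OF F X], of z Y]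
    by (simp add: alg.scale_right_distrib mult.commute)
qed (use F in \<open>auto intro: clin_scale gder_clin ideal_smul gder_ideal gr_smul gder_gr\<close>)

lemma gder_zero: "gder n e (\<lambda>X. 0)"
  by (rule gderI) (auto intro: comm_ideal.intros clinI)

lemma gder_Sum: "(\<And>i. i \<in> A \<Longrightarrow> gder n e (F i)) \<Longrightarrow> gder n e (\<lambda>X. \<Sum>i\<in>A. F i X)"
  by (induction A rule: infinite_finite_induct) (auto intro: gder_plus gder_zero)

text \<open>\<open>g\<close> has to be moved past \<open>X\<close> before the Leibniz rule appears,
  which is the reason for the congruence in \<open>gder\<close>. This admits operators such as
  \<open>dx \<mu> * WS n \<mu> X\<close>.\<close>

lemma gder_lmult:
  assumes F: "gder n e F" and g: "gr (tot n) j g"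
  shows "gder n (j + e) (\<lambda>X. g * F X)"
proof (rule gderI)
  show "clin (\<lambda>X. g * F X)" by (intro clin_compose[OF clin_mult_left] gder_clin[OF F])
  fix k :: int and X Y :: "'a alg" assume X: "gr (tot n) k X"
  have "ceq n (g * F (X * Y)) (g * (F X * Y + sg e k \<odot> (X * F Y)))"
    by (intro ceq_mult ceq_refl gder_mult[OF F X])
  also have "\<dots> = g * F X * Y + sg e k \<odot> ((g * X) * F Y)"
    by (simp add: algebra_simps)
  also have "ceq n \<dots> (g * F X * Y + sg e k \<odot> ((sg j k \<odot> (X * g)) * F Y))"
    by (intro ceq_add ceq_smul ceq_mult ceq_refl supercommute[OF g X])
  finally show "ceq n (g * F (X * Y)) (g * F X * Y + sg (j + e) k \<odot> (X * (g * F Y)))"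
    by (simp add: sg_add mult_ac(2) mult.assoc)
next
  fix k and X :: "'a alg" assume "gr (tot n) k X"
  then show "gr (tot n) (k + (j + e)) (g * F X)"
    using gr_mult[OF g gder_gr[OF F, of k X]] by (simp add: add_ac)
qed (auto intro: ideal_mult_left gder_ideal[OF F])

text \<open>The cross terms, in which \<open>F\<close> and \<open>G\<close> act on different
  factors, cancel in the graded commutator.\<close>

lemma gder_commutator:
  fixes F G :: "'a alg \<Rightarrow> 'a alg"
  assumes F: "gder n e F" and G: "gder n e' G"
  shows "gder n (e + e') (\<lambda>X. F (G X) - sg e e' \<odot> G (F X))"
proof (rule gderI)
  note lin = gder_add[OF F] gder_add[OF G] gder_smul[OF F] gder_smul[OF G]
  show "clin (\<lambda>X. F (G X) - sg e e' \<odot> G (F X))"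
    by (rule clinI) (simp_all add: lin alg.scale_right_distrib alg.scale_right_diff_distrib mult.commute)
  show "F (G X) - sg e e' \<odot> G (F X) \<in> comm_ideal n" if "X \<in> comm_ideal n" for X :: "'a alg"
    by (intro ideal_diff ideal_smul gder_ideal[OF F] gder_ideal[OF G] that)
  show "gr (tot n) (k + (e + e')) (F (G X) - sg e e' \<odot> G (F X))" if "gr (tot n) k X" for k and X :: "'a alg"
    using gder_gr[OF F gder_gr[OF G that]] gder_gr[OF G gder_gr[OF F that]]
    by (intro gr_diff gr_smul) (simp_all add: algebra_simps)
  fix k :: int and X Y :: "'a alg" assume X: "gr (tot n) k X"
  have "ceq n (F (G (X * Y))) (F (G X * Y + sg e' k \<odot> (X * G Y)))"
    by (intro gder_ceq[OF F] gder_mult[OF G X])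
  also have "\<dots> = F (G X * Y) + sg e' k \<odot> F (X * G Y)" by (simp add: lin)
  also have "ceq n \<dots> ((F (G X) * Y + sg e (k + e') \<odot> (G X * F Y)) + sg e' k \<odot> (F X * G Y + sg e k \<odot> (X * F (G Y))))"
    by (intro ceq_add ceq_smul gder_mult[OF F] X gder_gr[OF G])
  finally have 1: "ceq n (F (G (X * Y))) ((F (G X) * Y + sg e (k + e') \<odot> (G X * F Y)) + sg e' k \<odot> (F X * G Y + sg e k \<odot> (X * F (G Y))))" .
  have "ceq n (G (F (X * Y))) (G (F X * Y + sg e k \<odot> (X * F Y)))"
    by (intro gder_ceq[OF G] gder_mult[OF F X])
  also have "\<dots> = G (F X * Y) + sg e k \<odot> G (X * F Y)" by (simp add: lin)
  also have "ceq n \<dots> ((G (F X) * Y + sg e' (k + e) \<odot> (F X * G Y)) + sg e k \<odot> (G X * F Y + sg e' k \<odot> (X * G (F Y))))"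
    by (intro ceq_add ceq_smul gder_mult[OF G] X gder_gr[OF F])
  finally have 2: "ceq n (G (F (X * Y))) ((G (F X) * Y + sg e' (k + e) \<odot> (F X * G Y)) + sg e k \<odot> (G X * F Y + sg e' k \<odot> (X * G (F Y))))" .
  have "sg e e' * (sg e' e * z) = z" for z by (simp add: sg_commute[of e'])
  then show "ceq n (F (G (X * Y)) - sg e e' \<odot> G (F (X * Y)))
     ((F (G X) - sg e e' \<odot> G (F X)) * Y + sg (e + e') k \<odot> (X * (F (G Y) - sg e e' \<odot> G (F Y))))"
    using ceq_diff[OF 1 ceq_smul[OF 2, of "sg e e'"]]
    by (simp add: sg_add alg.scale_right_distrib alg.scale_right_diff_distrib algebra_simps sg_commute[of e'] )
qed

text \<open>The main tool for operator identities: both sides of [F, G] = H are graded derivations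
  of the same degree, so generators decide.\<close>

lemma gder_commutator_eq:
  assumes F: "gder n e F" and G: "gder n e' G" and H: "gder n (e + e') H"
    and gen: "\<And>x. x \<in> S \<Longrightarrow> ceq n (F (G (gen x))) (sg e e' \<odot> G (F (gen x)) + H (gen x))"
    and X: "supp S X"
  shows "ceq n (F (G X)) (sg e e' \<odot> G (F X) + H X)"
proof -
  have "ceq n (F (G X) - sg e e' \<odot> G (F X)) (H X)"
  proof (rule gder_cong[OF gder_commutator[OF F G] H _ X])
    fix x assume "x \<in> S"
    from ceq_diff[OF gen[OF this], of "sg e e' \<odot> G (F (gen x))" "sg e e' \<odot> G (F (gen x))"]
    show "ceq n (F (G (gen x)) - sg e e' \<odot> G (F (gen x))) (H (gen x))" by simp
  qed
  from ceq_add[OF this ceq_refl, of "sg e e' \<odot> G (F X)"] show ?thesis by (simp add: algebra_simps)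
qed

lemma gder_commute:
  assumes F: "gder n e F" and G: "gder n e' G"
    and gen: "\<And>x. x \<in> S \<Longrightarrow> ceq n (F (G (gen x))) (sg e e' \<odot> G (F (gen x)))"
    and X: "supp S X"
  shows "ceq n (F (G X)) (sg e e' \<odot> G (F X))"
  using gder_commutator_eq[OF F G gder_zero _ X] gen by simp

lemma gder_mult_closed:
  assumes F: "gder n e F" and g: "gr (tot n) k g" and "ceq n (F g) 0"
  shows "ceq n (F (g * X)) (sg e k \<odot> (g * F X))"
proof -
  have "ceq n (F (g * X)) (F g * X + sg e k \<odot> (g * F X))" by (rule gder_mult[OF F g])
  also have "ceq n \<dots> (0 * X + sg e k \<odot> (g * F X))"
    by (intro ceq_add ceq_mult assms ceq_refl)
  finally show ?thesis by simp
qed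

section \<open>Total derivatives\<close>

text \<open>Ghost number plus form degree is constant along a ladder. A component stripped of its p
  differentials therefore has total degree \<open>ldeg n A - p\<close>.\<close>

definition ldeg :: "nat \<Rightarrow> ladder \<Rightarrow> int"
  where "ldeg n A = (case A of Phi1 \<Rightarrow> 1 | Phi2 \<Rightarrow> int n)"

lemma tot_simps [simp]:
  "tot n (Dx \<mu>) = 1" "tot n (Fld A a I J) = ldeg n A - int (card I)"
  "tot n (Xi \<mu>) = 2" "tot n (Eps \<mu>) = 1" "tot n (U a) = int n + 1" "tot n (V a) = int n"
  by (auto simp: tot_def ldeg_def) (cases A; simp)

lemma gder_partial: "gder n 0 (partial n \<mu>)"
  unfolding partial_def by (rule gder_derivation) (auto split: gen.split)

lemma gder_contract: "gder n (-1) (contract n \<mu>)"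
  unfolding contract_def by (rule gder_derivation) (auto split: gen.split)

lemma gder_ext_d: "gder n 1 (ext_d n)"
  unfolding ext_d_def
  by (rule gder_derivation) (auto split: gen.split intro!: gr_sum simp flip: mon_append)

lemma partial_gen: "partial n \<mu> (gen x) = (case x of Fld A a I J \<Rightarrow> gen (Fld A a I (add_mset \<mu> J)) | _ \<Rightarrow> 0)"
  by (simp add: partial_def mon_Nil)

lemma contract_gen: "contract n \<mu> (gen x) = (case x of Dx \<nu> \<Rightarrow> (if \<mu> = \<nu> then 1 else 0) | _ \<Rightarrow> 0)"
  by (simp add: contract_def mon_Nil)

lemma ext_d_gen: "ext_d n (gen x) = (case x of Fld A a I J \<Rightarrow> \<Sum>\<mu><n+2. dx \<mu> * gen (Fld A a I (add_mset \<mu> J)) | _ \<Rightarrow> 0)"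
  by (simp add: ext_d_def mon_Nil)

text \<open>An even derivation produces no signs, so the rule is an equation for arbitrary factors,
  homogeneous or not.\<close>

lemma partial_mult: "partial n \<mu> (X * Y) = partial n \<mu> X * Y + X * partial n \<mu> Y"
proof -
  have k: "koszul False b = 1" for b by (simp add: koszul_def)
  have *: "partial n \<mu> (mon u * Y) = partial n \<mu> (mon u) * Y + mon u * partial n \<mu> Y" for u
    unfolding partial_def by (subst derivation_mult[where k = "sum_list (map (tot n) u)"]) (simp_all add: k)
  note lin = gder_add[OF gder_partial] gder_smul[OF gder_partial]
  show ?thesis
    by (rule clin_eqI[where F = "\<lambda>X. partial n \<mu> (X * Y)" and G = "\<lambda>X. partial n \<mu> X * Y + X * partial n \<mu> Y"])
      (use * in \<open>auto intro!: clinI simp: lin distrib_left distrib_right alg.scale_right_distrib\<close>)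
qed

lemma partial_1: "partial n \<mu> 1 = 0"
  using derivation_mon[of n False _ "[]"] by (simp add: partial_def mon_Nil)

lemma partial_commute: "partial n \<mu> (partial n \<nu> X) = partial n \<nu> (partial n \<mu> X)"
proof (rule clin_eqI[where F = "\<lambda>X. partial n \<mu> (partial n \<nu> X)" and G = "\<lambda>X. partial n \<nu> (partial n \<mu> X)"])
  fix w :: "'a gen list"
  show "partial n \<mu> (partial n \<nu> (mon w)) = partial n \<nu> (partial n \<mu> (mon w))"
  proof (induction w)
    case Nil
    show ?case by (simp add: mon_Nil partial_1 gder_0[OF gder_partial])
  next
    case (Cons x w)
    have "partial n \<mu> (partial n \<nu> (gen x)) = partial n \<nu> (partial n \<mu> (gen x))"
      by (cases x) (simp_all add: partial_gen gder_0[OF gder_partial] add_mset_commute)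
    then show ?case
      by (simp add: mon_Cons[of x w] partial_mult gder_add[OF gder_partial] Cons add_ac)
  qed
qed (auto intro: clin_compose gder_clin gder_partial)

lemma fold_partial_mset:
  "mset xs = mset ys \<Longrightarrow> fold (partial n) xs X = fold (partial n) ys X"
  by (rule fold_multiset_equiv[THEN fun_cong]) (auto simp: fun_eq_iff partial_commute)

lemma fold_partial_Cons: "fold (partial n) (x # xs) X = partial n x (fold (partial n) xs X)"
proof (induction xs arbitrary: X)
  case (Cons y xs)
  then show ?case by (metis fold_simps(2) partial_commute)
qed simp

text \<open>\<open>ext_d\<close> inserts the differential directly before the differentiated field,
  the right-hand side puts it in front of the whole word; the difference consists of graded
  commutators.\<close>

lemma ext_d_partial: "ceq n (ext_d n (X :: 'a alg)) (\<Sum>\<mu><n+2. dx \<mu> * partial n \<mu> X)"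
proof (rule gder_cong[where S = UNIV and F = "ext_d n" and
      G = "\<lambda>X. \<Sum>\<mu><n+2. dx \<mu> * partial n \<mu> X"])
  show "gder n 1 (\<lambda>X :: 'a alg. \<Sum>\<mu><n+2. dx \<mu> * partial n \<mu> X)"
    by (intro gder_Sum) (use gder_lmult[OF gder_partial] in force)
  show "ceq n (ext_d n (gen x)) (\<Sum>\<mu><n+2. dx \<mu> * partial n \<mu> (gen x))" for x :: "'a gen"
    by (cases x) (simp_all add: ext_d_gen partial_gen)
qed (simp_all add: gder_ext_d)

text \<open>The criterion by which an operator acts on functionals: it kills the differentials and
  commutes with the partial derivatives.\<close>

lemma gder_ext_d_commute:
  assumes F: "gder n e F" and dx: "\<And>\<mu>. \<mu> < n + 2 \<Longrightarrow> ceq n (F (dx \<mu>)) 0"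
    and p: "\<And>\<mu> X. \<mu> < n + 2 \<Longrightarrow> ceq n (F (partial n \<mu> X)) (partial n \<mu> (F X))"
  shows "ceq n (F (ext_d n X)) (sg e 1 \<odot> ext_d n (F X))"
proof -
  have "ceq n (F (ext_d n X)) (F (\<Sum>\<mu><n+2. dx \<mu> * partial n \<mu> X))"
    by (rule gder_ceq[OF F ext_d_partial])
  also have "\<dots> = (\<Sum>\<mu><n+2. F (dx \<mu> * partial n \<mu> X))"
    by (rule gder_sum[OF F])
  also have "ceq n \<dots> (\<Sum>\<mu><n+2. sg e 1 \<odot> (dx \<mu> * F (partial n \<mu> X)))"
    by (intro ceq_sum gder_mult_closed[OF F]) (simp_all add: dx)
  also have "ceq n \<dots> (\<Sum>\<mu><n+2. sg e 1 \<odot> (dx \<mu> * partial n \<mu> (F X)))"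
    by (intro ceq_sum ceq_smul ceq_mult ceq_refl p) simp
  also have "\<dots> = sg e 1 \<odot> (\<Sum>\<mu><n+2. dx \<mu> * partial n \<mu> (F X))"
    by (simp add: alg.scale_sum_right)
  also have "ceq n \<dots> (sg e 1 \<odot> ext_d n (F X))"
    by (intro ceq_smul ceq_sym[OF ext_d_partial])
  finally show ?thesis .
qed

lemma feq_alt: "functional_eq n X Y \<longleftrightarrow> (\<exists>\<alpha>. ceq n X (Y + ext_d n \<alpha>))"
proof
  assume "functional_eq n X Y"
  then obtain R \<alpha> where "R \<in> comm_ideal n" "X - Y = R + ext_d n \<alpha>"
    by (auto simp: functional_eq_def)
  then have "ceq n X (Y + ext_d n \<alpha>)" unfolding ceq_def by (simp add: algebra_simps)
  then show "\<exists>\<alpha>. ceq n X (Y + ext_d n \<alpha>)" ..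
next
  assume "\<exists>\<alpha>. ceq n X (Y + ext_d n \<alpha>)"
  then obtain \<alpha> where "X - (Y + ext_d n \<alpha>) \<in> comm_ideal n" by (auto simp: ceq_def)
  moreover have "X - Y = (X - (Y + ext_d n \<alpha>)) + ext_d n \<alpha>" by simp
  ultimately show "functional_eq n X Y" unfolding functional_eq_def by blast
qed

lemma ceq_feq: "ceq n X Y \<Longrightarrow> functional_eq n X Y"
  unfolding feq_alt using gder_0[OF gder_ext_d] by (metis add.right_neutral)

lemma feq_refl [simp, intro]: "functional_eq n X X"
  by (rule ceq_feq) simp

lemma feq_ext_d: "functional_eq n (ext_d n X) 0"
  unfolding feq_alt by auto

lemma feq_add:
  assumes "functional_eq n X Y" "functional_eq n X' Y'"
  shows "functional_eq n (X + X') (Y + Y')"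
proof -
  from assms obtain \<alpha> \<beta> where "ceq n X (Y + ext_d n \<alpha>)" "ceq n X' (Y' + ext_d n \<beta>)"
    unfolding feq_alt by blast
  from ceq_add[OF this] have "ceq n (X + X') (Y + Y' + ext_d n (\<alpha> + \<beta>))"
    by (simp add: gder_add[OF gder_ext_d] algebra_simps)
  then show ?thesis unfolding feq_alt ..
qed

lemma feq_smul:
  assumes "functional_eq n X Y" shows "functional_eq n (z \<odot> X) (z \<odot> Y)"
proof -
  from assms obtain \<alpha> where "ceq n X (Y + ext_d n \<alpha>)" unfolding feq_alt by blast
  from ceq_smul[OF this, of z] have "ceq n (z \<odot> X) (z \<odot> Y + ext_d n (z \<odot> \<alpha>))"
    by (simp add: gder_smul[OF gder_ext_d] alg.scale_right_distrib)
  then show ?thesis unfolding feq_alt ..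
qed

lemma feq_minus: "functional_eq n X Y \<Longrightarrow> functional_eq n (- X) (- Y)"
  using feq_smul[of n X Y "-1"] by simp

lemma feq_diff: "functional_eq n X Y \<Longrightarrow> functional_eq n X' Y' \<Longrightarrow> functional_eq n (X - X') (Y - Y')"
  using feq_add[of n X Y "- X'" "- Y'"] feq_minus by auto

lemma feq_sum: "(\<And>i. i \<in> A \<Longrightarrow> functional_eq n (f i) (g i)) \<Longrightarrow>
    functional_eq n (\<Sum>i\<in>A. f i) (\<Sum>i\<in>A. g i)"
  by (induction A rule: infinite_finite_induct) (auto intro: feq_add)

lemma feq_sym: "functional_eq n X Y \<Longrightarrow> functional_eq n Y X"
  using feq_diff[OF feq_refl[of n "X + Y"], of X Y] by simp

lemma feq_trans [trans]: "functional_eq n X Y \<Longrightarrow> functional_eq n Y Z \<Longrightarrow> functional_eq n X Z"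
  using feq_diff[OF feq_add, of n X Y Y Z Y Y] by simp

lemma feq_ceq_trans [trans]:
  "functional_eq n X Y \<Longrightarrow> ceq n Y Z \<Longrightarrow> functional_eq n X Z"
  "ceq n X Y \<Longrightarrow> functional_eq n Y Z \<Longrightarrow> functional_eq n X Z"
  "functional_eq n X Y \<Longrightarrow> Y = Z \<Longrightarrow> functional_eq n X Z"
  "X = Y \<Longrightarrow> functional_eq n Y Z \<Longrightarrow> functional_eq n X Z"
  using ceq_feq feq_trans by blast+

lemma gder_feq:
  assumes F: "gder n e F" and d: "\<And>X. ceq n (F (ext_d n X)) (z \<odot> ext_d n (F X))"
    and XY: "functional_eq n X Y"
  shows "functional_eq n (F X) (F Y)"
proof -
  from XY obtain \<alpha> where "ceq n X (Y + ext_d n \<alpha>)" unfolding feq_alt by blast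
  then have "ceq n (F X) (F Y + F (ext_d n \<alpha>))"
    using gder_ceq[OF F] by (metis gder_add[OF F])
  also have "functional_eq n \<dots> (F Y + z \<odot> ext_d n (F \<alpha>))"
    by (intro ceq_feq ceq_add ceq_refl d)
  also have "functional_eq n \<dots> (F Y + z \<odot> 0)"
    by (intro feq_add feq_refl feq_smul feq_ext_d)
  finally show ?thesis by simp
qed

text \<open>Meant for constants \<open>g\<close>, such as a differential or a global ghost, which
  can be pulled under d.\<close>

lemma feq_lmult_0:
  assumes "\<And>X. ceq n (g * ext_d n X) (z \<odot> ext_d n (g * X))" "functional_eq n X 0"
  shows "functional_eq n (g * X) 0"
proof -
  from assms(2) obtain \<alpha> where "ceq n X (ext_d n \<alpha>)" unfolding feq_alt by auto
  then have "ceq n (g * X) (g * ext_d n \<alpha>)" by (intro ceq_mult ceq_refl)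
  also have "ceq n \<dots> (z \<odot> ext_d n (g * \<alpha>))" by (rule assms)
  also have "functional_eq n \<dots> (z \<odot> 0)" by (intro feq_smul feq_ext_d)
  finally show ?thesis by simp
qed

lemma ext_d_closed_mult:
  assumes "ext_d n (gen x) = 0"
  shows "ceq n (gen x * ext_d n X) (sg 1 (tot n x) \<odot> ext_d n (gen x * X))"
  using ceq_smul[OF gder_mult_closed[OF gder_ext_d, of n "tot n x" "gen x" X], of "sg 1 (tot n x)"] assms
  by (auto intro: ceq_sym)

lemma fold_partial_insort:
  "fold (partial n) (insort \<mu> xs) X = partial n \<mu> (fold (partial n) xs X)"
  by (subst fold_partial_Cons[symmetric], rule fold_partial_mset) simp

section \<open>Derivations given by their values on the ladder forms\<close>

lemma fold_gder:
  assumes "\<And>x. x \<in> set xs \<Longrightarrow> gder n (e x) (F x)"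
  shows "clin (fold F xs)"
    and "ceq n X Y \<Longrightarrow> ceq n (fold F xs X) (fold F xs Y)"
    and "gr (tot n) k X \<Longrightarrow> gr (tot n) (k + sum_list (map e xs)) (fold F xs X)"
proof -
  show "clin (fold F xs)"
    using assms
  proof (induction xs)
    case (Cons x xs)
    have "clin (fold F xs)" "gder n (e x) (F x)" using Cons by auto
    then have "clin (\<lambda>X. fold F xs (F x X))" by (rule clin_compose[OF _ gder_clin])
    then show ?case by (simp add: comp_def)
  qed (auto intro: clinI)
  show "ceq n X Y \<Longrightarrow> ceq n (fold F xs X) (fold F xs Y)"
    using assms
  proof (induction xs arbitrary: X Y)
    case (Cons x xs)
    then have "ceq n (F x X) (F x Y)" by (intro gder_ceq[of n "e x" "F x"]) auto
    with Cons show ?case by simp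
  qed simp
  show "gr (tot n) k X \<Longrightarrow> gr (tot n) (k + sum_list (map e xs)) (fold F xs X)"
    using assms
  proof (induction xs arbitrary: X k)
    case (Cons x xs)
    then have "gr (tot n) (k + e x) (F x X)" by (auto intro: gder_gr)
    from Cons.IH[OF this] Cons.prems show ?case by (simp add: add_ac)
  qed auto
qed

lemma clin_fold_partial: "clin (fold (partial n) xs)"
  by (rule fold_gder(1)[where e = "\<lambda>_. 0"]) (rule gder_partial)

lemma fold_partial_ceq: "ceq n X Y \<Longrightarrow> ceq n (fold (partial n) xs X) (fold (partial n) xs Y)"
  by (rule fold_gder(2)[where e = "\<lambda>_. 0"]) (rule gder_partial)

lemma clin_fold_contract: "clin (fold (contract n) xs)"
  by (rule fold_gder(1)[where e = "\<lambda>_. -1"]) (rule gder_contract)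

lemma fold_contract_ceq: "ceq n X Y \<Longrightarrow> ceq n (fold (contract n) xs X) (fold (contract n) xs Y)"
  by (rule fold_gder(2)[where e = "\<lambda>_. -1"]) (rule gder_contract)

lemma fold_partial_gr: "gr (tot n) k X \<Longrightarrow> gr (tot n) k (fold (partial n) xs X)"
  using fold_gder(3)[of xs n "\<lambda>_. 0" "partial n" k X] by (simp add: gder_partial)

lemma fold_contract_gr: "gr (tot n) k X \<Longrightarrow> gr (tot n) (k - int (length xs)) (fold (contract n) xs X)"
  using fold_gder(3)[of xs n "\<lambda>_. -1" "contract n" k X] by (simp add: gder_contract sum_list_triv)

lemma form_comp_ceq: "ceq n X Y \<Longrightarrow> ceq n (form_comp n I X) (form_comp n I Y)"
  unfolding form_comp_def by (rule fold_contract_ceq)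

lemma clin_form_comp: "clin (form_comp n I)"
  unfolding form_comp_def by (rule clin_fold_contract)

lemma form_comp_gr: "gr (tot n) k X \<Longrightarrow> gr (tot n) (k - int (card I)) (form_comp n I X)"
  using fold_contract_gr[of n k X "sorted_list_of_set I"]
  by (simp add: form_comp_def)

lemma field_derivation_gen: "field_derivation n s R (gen x) = (case x of Fld A a I J \<Rightarrow>
    koszul s (odd (card I)) \<odot> fold (partial n) (sorted_list_of_multiset J) (form_comp n I (R A a (card I)))
  | _ \<Rightarrow> 0)"
  by (cases x) (simp_all add: field_derivation_def mon_Nil smul_def)

lemma gder_field_derivation:
  assumes "\<And>A a p. gr (tot n) (ldeg n A + e) (R A a p)" "s = odd e"
  shows "gder n e (field_derivation n s R)"
  unfolding field_derivation_def
  by (rule gder_derivation)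
    (use assms in \<open>auto split: gen.split simp flip: smul_def intro!: gr_smul fold_partial_gr
       simp: diff_add_eq form_comp_gr\<close>)

text \<open>Built into the definition: the value on a jet is the iterated derivative of the value on
  the undifferentiated component.\<close>

lemma field_derivation_partial:
  assumes "\<And>A a p. gr (tot n) (ldeg n A + e) (R A a p)" "s = odd e"
  shows "ceq n (field_derivation n s R (partial n \<mu> X)) (partial n \<mu> (field_derivation n s R X))"
proof -
  have "ceq n (field_derivation n s R (partial n \<mu> X)) (sg e 0 \<odot> partial n \<mu> (field_derivation n s R X))"
  proof (rule gder_commute[where S = UNIV, OF gder_field_derivation[OF assms] gder_partial])
    fix x
    show "ceq n (field_derivation n s R (partial n \<mu> (gen x))) (sg e 0 \<odot> partial n \<mu> (field_derivation n s R (gen x)))"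
      by (cases x) (simp_all add: partial_gen field_derivation_gen fold_partial_insort
        gder_smul[OF gder_partial] gder_0[OF gder_partial] module_hom.zero[OF clin_derivation, folded field_derivation_def]
        module_hom.zero[OF gder_clin[OF gder_field_derivation[OF assms]]])
  qed simp
  then show ?thesis by simp
qed

lemma field_derivation_ext_d:
  assumes "\<And>A a p. gr (tot n) (ldeg n A + e) (R A a p)" "s = odd e"
  shows "ceq n (field_derivation n s R (ext_d n X)) (sg e 1 \<odot> ext_d n (field_derivation n s R X))"
  by (rule gder_ext_d_commute[OF gder_field_derivation[OF assms] _ field_derivation_partial[OF assms]])
     (simp add: field_derivation_gen)

lemma field_derivation_feq:
  assumes "\<And>A a p. gr (tot n) (ldeg n A + e) (R A a p)" "s = odd e" "functional_eq n X Y"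
  shows "functional_eq n (field_derivation n s R X) (field_derivation n s R Y)"
  by (rule gder_feq[OF gder_field_derivation[OF assms(1,2)] field_derivation_ext_d[OF assms(1,2)] assms(3)])

section \<open>Components of the ladder forms\<close>

lemma contract_dx_mult: "contract n \<mu> (dx \<nu> * X) = (if \<mu> = \<nu> then X else 0) - dx \<nu> * contract n \<mu> X"
  unfolding contract_def
  by (subst derivation_mult[where k = 1]) (simp_all add: koszul_def mon_Nil)

lemma contract_Dx_notin:
  assumes "contract n \<mu> Y = 0" "\<mu> \<notin> set xs"
  shows "contract n \<mu> (mon (map Dx xs) * Y) = 0"
  using assms(2) by (induction xs) (simp_all add: mon_Nil assms(1) mon_Cons[of "Dx _" "map Dx _"] mult.assoc contract_dx_mult)

lemma contract_Dx_in:
  assumes "contract n \<mu> Y = 0" "sorted_wrt (<) xs" "\<mu> \<in> set xs"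
  shows "contract n \<mu> (mon (map Dx xs) * Y) =
    (-1) ^ length (filter (\<lambda>x. x < \<mu>) xs) \<odot> (mon (map Dx (remove1 \<mu> xs)) * Y)"
  using assms(2,3)
proof (induction xs)
  case (Cons x xs)
  show ?case
  proof (cases "x = \<mu>")
    case True
    with Cons.prems have "\<mu> \<notin> set xs" "filter (\<lambda>x. x < \<mu>) xs = []" by (auto simp: filter_empty_conv)
    with True show ?thesis
      using contract_Dx_notin[OF assms(1), of xs]
      by (simp add: mon_Cons[of "Dx _" "map Dx _"] mult.assoc contract_dx_mult)
  next
    case False
    with Cons have "\<mu> \<in> set xs" "x < \<mu>" by auto
    with Cons False show ?thesis
      by (auto simp: mon_Cons[of "Dx _" "map Dx _"] mult.assoc contract_dx_mult)
  qed
qed simp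

text \<open>Contractions in increasing order are dual to ordered products of differentials: the
  index contracted first stands in front, so no sign appears when the lists agree. When they differ,
  some contraction meets no partner.\<close>

lemma fold_contract_Dx:
  assumes "\<And>\<mu>. contract n \<mu> Y = 0" "sorted_wrt (<) xs" "sorted_wrt (<) ys" "length xs = length ys"
  shows "fold (contract n) xs (mon (map Dx ys) * Y) = (if xs = ys then Y else 0)"
  using assms(2-)
proof (induction xs arbitrary: ys)
  case Nil
  then show ?case by (simp add: mon_Nil)
next
  case (Cons x xs)
  have zero: "fold (contract n) xs 0 = 0"
    by (rule module_hom.zero[OF clin_fold_contract])
  show ?case
  proof (cases "x \<in> set ys")
    case True
    have s: "sorted_wrt (<) (remove1 x ys)" "length xs = length (remove1 x ys)"
      using Cons.prems True strict_sorted_iff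
      by (auto simp: strict_sorted_iff length_remove1 sorted_remove1)
    have eq: "(xs = remove1 x ys) \<longleftrightarrow> x # xs = ys"
    proof
      assume *: "xs = remove1 x ys"
      have "set (x # xs) = set ys"
        using True * Cons.prems(2) by (auto simp: strict_sorted_iff)
      then show "x # xs = ys"
        using Cons.prems by (metis strict_sorted_equal)
    qed auto
    have f: "filter (\<lambda>y. y < x) ys = []" if "x # xs = ys"
      using that Cons.prems(1) by (fastforce simp: filter_empty_conv)
    show ?thesis
      using Cons.IH[of "remove1 x ys"] Cons.prems s
      by (simp add: contract_Dx_in[OF assms(1) Cons.prems(2) True] module_hom.scale[OF clin_fold_contract] eq f
          split: if_splits)
  next
    case False
    then have "x # xs \<noteq> ys" by auto
    with False show ?thesis by (simp add: contract_Dx_notin[OF assms(1)] zero)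
  qed
qed

lemma contract_Fld: "contract n \<mu> (gen (Fld A a I J)) = 0"
  by (simp add: contract_gen)

lemma form_comp_phi:
  assumes "I \<subseteq> {..<n+2}"
  shows "form_comp n I (phi n A a (card I)) = gen (Fld A a I {#})"
proof -
  have fin: "finite I" using assms finite_subset by blast
  have "form_comp n I (phi n A a (card I)) =
    (\<Sum>I' | I' \<subseteq> {..<n+2} \<and> card I' = card I. if I' = I then gen (Fld A a I' {#}) else 0)"
    unfolding phi_def module_hom.sum[OF clin_form_comp]
  proof (rule sum.cong[OF refl])
    fix I' assume I': "I' \<in> {I'. I' \<subseteq> {..<n+2} \<and> card I' = card I}"
    then have fin': "finite I'" using finite_subset by blast
    show "form_comp n I (mon (map Dx (sorted_list_of_set I')) * gen (Fld A a I' {#}))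
       = (if I' = I then gen (Fld A a I' {#}) else 0)"
      unfolding form_comp_def
      by (subst fold_contract_Dx)
         (use I' fin fin' sorted_list_of_set_inject[of I I'] in \<open>auto simp: contract_Fld\<close>)
  qed
  also have "\<dots> = gen (Fld A a I {#})"
    using assms by (simp add: sum.delta)
  finally show ?thesis .
qed

lemma fold_partial_Fld:
  "fold (partial n) (sorted_list_of_multiset J) (gen (Fld A a I {#})) = gen (Fld A a I J)"
  by (induction J) (simp_all add: fold_partial_insort partial_gen)

lemma phi_gr: "gr (tot n) (ldeg n A) (phi n A a p)"
  unfolding phi_def
proof (intro gr_sum)
  fix I assume I: "I \<in> {I. I \<subseteq> {..<n+2} \<and> card I = p}"
  show "gr (tot n) (ldeg n A) (mon (map Dx (sorted_list_of_set I)) * gen (Fld A a I {#}))"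
    using I by (simp flip: mon_append add: comp_def sum_list_triv)
qed

section \<open>Vector supersymmetry\<close>

lemma contract_anticommute: "ceq n (contract n \<mu> (contract n \<nu> (X :: 'a alg))) (- contract n \<nu> (contract n \<mu> X))"
proof -
  have "ceq n (contract n \<mu> (contract n \<nu> X)) (sg (-1) (-1) \<odot> contract n \<nu> (contract n \<mu> X))"
  proof (rule gder_commute[where S = UNIV, OF gder_contract gder_contract])
    fix x :: "'a gen" assume "x \<in> UNIV"
    have 1: "ceq n (contract n \<mu> 1) 0" for \<mu> by (rule gder_1[OF gder_contract])
    have "ceq n (contract n \<mu> (contract n \<nu> (gen x))) 0" for \<mu> \<nu>
      using 1 by (cases x) (auto simp: contract_gen gder_0[OF gder_contract])
    from this[of \<mu> \<nu>] ceq_sym[OF ceq_smul[OF this[of \<nu> \<mu>], of "sg (-1) (-1)"]]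
    show "ceq n (contract n \<mu> (contract n \<nu> (gen x))) (sg (-1) (-1) \<odot> contract n \<nu> (contract n \<mu> (gen x)))"
      using ceq_trans by fastforce
  qed simp
  then show ?thesis by (simp add: sg_def koszul_def)
qed

text \<open>Division by two. Squares of odd objects and traces of even powers of an odd matrix
  vanish through it.\<close>

lemma ceq_neg_self:
  assumes "ceq n X (- X)" shows "ceq n X 0"
proof -
  have "2 \<odot> X \<in> comm_ideal n" using assms alg.scale_left_distrib[of 1 1 X] by (simp add: ceq_def)
  then have "(1/2) \<odot> (2 \<odot> X) \<in> comm_ideal n" by (rule ideal_smul)
  then show ?thesis by (simp add: ceq_def)
qed

lemma contract_contract: "ceq n (contract n \<mu> (contract n \<mu> X)) 0"
  by (rule ceq_neg_self[OF contract_anticommute])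

lemma fold_contract_insort:
  assumes "sorted_wrt (<) xs" "\<mu> \<notin> set xs"
  shows "ceq n (fold (contract n) (insort \<mu> xs) X)
    ((-1) ^ length (filter (\<lambda>x. x < \<mu>) xs) \<odot> fold (contract n) xs (contract n \<mu> X))"
  using assms
proof (induction xs arbitrary: X)
  case (Cons x xs)
  show ?case
  proof (cases "\<mu> \<le> x")
    case True
    then have "filter (\<lambda>x. x < \<mu>) (x # xs) = []" using Cons.prems by (auto simp: filter_empty_conv)
    with True show ?thesis by simp
  next
    case False
    let ?k = "length (filter (\<lambda>x. x < \<mu>) xs)"
    have "ceq n (fold (contract n) (insort \<mu> xs) (contract n x X))
       ((-1) ^ ?k \<odot> fold (contract n) xs (contract n \<mu> (contract n x X)))"
      using Cons by auto
    also have "ceq n \<dots> ((-1) ^ ?k \<odot> fold (contract n) xs (- contract n x (contract n \<mu> X)))"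
      by (intro ceq_smul fold_contract_ceq contract_anticommute)
    finally show ?thesis using False by (simp add: module_hom.neg[OF clin_fold_contract])
  qed
qed simp

text \<open>The number of transpositions that bring the differential of \<mu> from the front of
  those of \<open>I\<close> into its increasing position.\<close>

definition below :: "nat \<Rightarrow> nat set \<Rightarrow> nat"
  where "below \<mu> I = card {i \<in> I. i < \<mu>}"

lemma length_filter_sorted_list:
  assumes "finite I"
  shows "length (filter (\<lambda>x. x < \<mu>) (sorted_list_of_set I)) = below \<mu> I"
  using assms distinct_card[of "filter (\<lambda>x. x < \<mu>) (sorted_list_of_set I)"]
  by (simp add: below_def)

lemma form_comp_insert:
  assumes "finite I" "\<mu> \<notin> I"
  shows "ceq n (form_comp n (insert \<mu> I) X) ((-1) ^ below \<mu> I \<odot> form_comp n I (contract n \<mu> X))"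
  using fold_contract_insort[of "sorted_list_of_set I" \<mu> n X] assms
  by (simp add: form_comp_def length_filter_sorted_list)

lemma form_comp_contract:
  assumes "finite I" "\<mu> \<notin> I"
  shows "ceq n (form_comp n I (contract n \<mu> X)) ((-1) ^ below \<mu> I \<odot> form_comp n (insert \<mu> I) X)"
  using ceq_sym[OF ceq_smul[OF form_comp_insert[OF assms], where z = "(-1) ^ below \<mu> I"]]
  by (simp flip: power_add mult_2)

text \<open>The direction \<mu> is contracted twice, and contractions anticommute.\<close>

lemma form_comp_contract_in:
  assumes "finite I" "\<mu> \<in> I"
  shows "ceq n (form_comp n I (contract n \<mu> X)) 0"
proof -
  let ?I = "I - {\<mu>}"
  have "ceq n (form_comp n (insert \<mu> ?I) (contract n \<mu> X)) ((-1) ^ below \<mu> ?I \<odot> form_comp n ?I (contract n \<mu> (contract n \<mu> X)))"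
    using assms by (intro form_comp_insert) auto
  also have "ceq n \<dots> ((-1) ^ below \<mu> ?I \<odot> form_comp n ?I 0)"
    by (intro ceq_smul form_comp_ceq contract_contract)
  finally show ?thesis using assms by (simp add: insert_absorb module_hom.zero[OF clin_form_comp])
qed

text \<open>The sign with which \<open>WS n \<mu>\<close> adds \<mu> to a form index: the minus is
  that in the definition of the operator, \<open>card I\<close> comes from moving it through the
  differentials, \<open>below \<mu> I\<close> from sorting the new index.\<close>

definition sigma :: "nat \<Rightarrow> nat set \<Rightarrow> complex"
  where "sigma \<mu> I = - ((-1) ^ (card I + below \<mu> I))"

lemma koszul_True: "koszul True (odd k) = (-1) ^ k"
  by (simp add: koszul_def)

lemma WS_value_gr: "gr (tot n) (ldeg n A + (-1)) (- contract n \<mu> (phi n A a (p + 1)))"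
  by (intro gr_minus gder_gr[OF gder_contract] phi_gr)

lemma gder_WS: "gder n (-1) (WS n \<mu>)"
  unfolding WS_def by (rule gder_field_derivation[OF WS_value_gr]) simp

lemma WS_ext_d: "ceq n (WS n \<mu> (ext_d n X)) (- ext_d n (WS n \<mu> X))"
  using field_derivation_ext_d[OF WS_value_gr, where s = True and n = n] by (simp add: WS_def sg_def koszul_def)

lemma WS_feq: "functional_eq n X Y \<Longrightarrow> functional_eq n (WS n \<mu> X) (WS n \<mu> Y)"
  unfolding WS_def by (rule field_derivation_feq[OF WS_value_gr]) simp_all

lemma WS_Dx [simp]: "WS n \<mu> (dx \<nu>) = 0"
  by (simp add: WS_def field_derivation_gen)

text \<open>Modulo the ideal vector supersymmetry is exterior multiplication on form indices and
  leaves the derivatives alone. It gives zero in two ways: \<mu> in \<open>I\<close> is contracted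
  twice, and a direction outside the range does not occur in \<open>phi\<close> at all.\<close>

lemma WS_Fld:
  assumes "I \<subseteq> {..<n+2}"
  shows "ceq n (WS n \<mu> (gen (Fld A a I J)))
    (if \<mu> \<in> I \<or> \<mu> \<ge> n + 2 then 0 else sigma \<mu> I \<odot> gen (Fld A a (insert \<mu> I) J))"
proof -
  let ?D = "fold (partial n) (sorted_list_of_multiset J)" and ?p = "card I"
  have fin: "finite I" using assms finite_subset by blast
  have *: "WS n \<mu> (gen (Fld A a I J)) = (- ((-1) ^ ?p)) \<odot> ?D (form_comp n I (contract n \<mu> (phi n A a (?p + 1))))"
    by (simp add: WS_def field_derivation_gen koszul_True module_hom.neg[OF clin_form_comp] module_hom.neg[OF clin_fold_partial])
  show ?thesis
  proof (cases "\<mu> \<in> I \<or> \<mu> \<ge> n + 2")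
    case True
    have "ceq n (form_comp n I (contract n \<mu> (phi n A a (?p + 1)))) 0"
    proof (cases "\<mu> \<in> I")
      case False
      with True have \<mu>: "\<not> \<mu> < n + 2" by simp
      have "contract n \<mu> (phi n A a (?p + 1)) = 0"
        unfolding phi_def module_hom.sum[OF gder_clin[OF gder_contract]]
        by (intro sum.neutral ballI contract_Dx_notin contract_Fld)
           (use \<mu> in \<open>auto dest: finite_subset simp: subset_iff set_sorted_list_of_set[OF finite_subset[of _ "{..<n+2}"]]\<close>)
      then show ?thesis by (simp add: module_hom.zero[OF clin_form_comp])
    qed (use fin form_comp_contract_in in blast)
    then have "ceq n (WS n \<mu> (gen (Fld A a I J))) ((- ((-1) ^ ?p)) \<odot> ?D 0)"
      unfolding * by (intro ceq_smul fold_partial_ceq)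
    then show ?thesis using True by (simp add: module_hom.zero[OF clin_fold_partial])
  next
    case False
    have "ceq n (form_comp n I (contract n \<mu> (phi n A a (?p + 1))))
       ((-1) ^ below \<mu> I \<odot> form_comp n (insert \<mu> I) (phi n A a (?p + 1)))"
      by (rule form_comp_contract) (use False fin in auto)
    also have "form_comp n (insert \<mu> I) (phi n A a (?p + 1)) = gen (Fld A a (insert \<mu> I) {#})"
      using form_comp_phi[of "insert \<mu> I" n A a] False assms fin by auto
    finally have "ceq n (WS n \<mu> (gen (Fld A a I J))) ((- ((-1) ^ ?p)) \<odot> ?D ((-1) ^ below \<mu> I \<odot> gen (Fld A a (insert \<mu> I) {#})))"
      unfolding * by (intro ceq_smul fold_partial_ceq)
    then show ?thesis
      using False by (simp add: module_hom.scale[OF clin_fold_partial] fold_partial_Fld sigma_def power_add)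
  qed
qed

declare add_2_eq_Suc [simp del] add_2_eq_Suc' [simp del]

section \<open>Weights\<close>

text \<open>
  \<open>wt \<nu> H\<close> multiplies the part of degree \<open>k\<close> by \<open>H k\<close>: projections onto components, but also
  the operators counting fields and their inverses.
\<close>

definition wt :: "('a gen \<Rightarrow> int) \<Rightarrow> (int \<Rightarrow> complex) \<Rightarrow> 'a alg \<Rightarrow> 'a alg"
  where "wt \<nu> H = word_ext (\<lambda>w. H (sum_list (map \<nu> w)) \<odot> mon w)"

lemma clin_wt: "clin (wt \<nu> H)"
  unfolding wt_def by (rule clin_word_ext)

lemmas wt_add = clin_wt[THEN module_hom.add]
  and wt_smul = clin_wt[THEN module_hom.scale]
  and wt_diff = clin_wt[THEN module_hom.diff]
  and wt_0 = clin_wt[THEN module_hom.zero]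

lemma wt_mon: "wt \<nu> H (mon w) = H (sum_list (map \<nu> w)) \<odot> mon w"
  by (simp add: wt_def)

lemma wt_expand: "wt \<nu> H X = (\<Sum>w\<in>Poly_Mapping.keys X.
    Poly_Mapping.lookup X w \<odot> H (sum_list (map \<nu> w)) \<odot> mon w)"
  by (simp add: wt_def word_ext_def)

lemma wt_cong:
  assumes "\<And>w. w \<in> Poly_Mapping.keys X \<Longrightarrow> H (sum_list (map \<nu> w)) = H' (sum_list (map \<nu>' w))"
  shows "wt \<nu> H X = wt \<nu>' H' X"
  unfolding wt_expand using assms by (intro sum.cong) auto

lemma wt_one:
  assumes "\<And>w. w \<in> Poly_Mapping.keys X \<Longrightarrow> H (sum_list (map \<nu> w)) = 1"
  shows "wt \<nu> H X = X"
  by (subst (2) alg_sum[of X], unfold wt_expand) (use assms in \<open>auto intro!: sum.cong\<close>)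

lemma wt_gr: "gr \<nu> k X \<Longrightarrow> wt \<nu> H X = H k \<odot> X"
  by (subst (2) alg_sum[of X], unfold wt_expand)
    (auto simp: gr_def alg.scale_sum_right mult.commute intro!: sum.cong)

lemma wt_wt_same: "wt \<nu> H (wt \<nu> H' X) = wt \<nu> (\<lambda>k. H k * H' k) X"
  by (rule clin_eqI[where F = "\<lambda>X. wt \<nu> H (wt \<nu> H' X)" and G = "wt \<nu> (\<lambda>k. H k * H' k)"])
     (simp_all add: clin_compose clin_wt wt_mon wt_smul mult.commute)

lemma lookup_wt: "Poly_Mapping.lookup (wt \<nu> H X) w = H (sum_list (map \<nu> w)) * Poly_Mapping.lookup X w"
proof -
  have "Poly_Mapping.lookup (wt \<nu> H X) w = (\<Sum>v\<in>Poly_Mapping.keys X.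
     if v = w then Poly_Mapping.lookup X v * H (sum_list (map \<nu> v)) else 0)"
    unfolding wt_expand lookup_sum
    by (intro sum.cong) (simp_all add: lookup_smul mon_def lookup_single when_def)
  then show ?thesis by (simp add: sum.delta in_keys_iff)
qed

lemma keys_wt: "Poly_Mapping.keys (wt \<nu> H X) \<subseteq> Poly_Mapping.keys X"
  by (auto simp: in_keys_iff lookup_wt)

lemma wt_gr': "gr \<nu>' k X \<Longrightarrow> gr \<nu>' k (wt \<nu> H X)"
  using keys_wt by (fastforce simp: gr_def)

lemma wt_supp: "supp S X \<Longrightarrow> supp S (wt \<nu> H X)"
  using keys_wt by (fastforce simp: supp_def)

lemma wt_zero:
  assumes "\<And>w. w \<in> Poly_Mapping.keys X \<Longrightarrow> H (sum_list (map \<nu> w)) = 0"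
  shows "wt \<nu> H X = 0"
  unfolding wt_expand using assms by (intro sum.neutral) auto

text \<open>x y and y x have the same weight in any additive grading, so the ideal is homogeneous
  and weights act on the quotient.\<close>

lemma wt_ideal:
  assumes "X \<in> comm_ideal n" shows "wt \<nu> H X \<in> comm_ideal n"
proof (rule clin_ideal[OF clin_wt _ assms])
  fix u v :: "'a gen list" and x y :: "'a gen"
  let ?c = "gen x * gen y - koszul (odd_gen n x) (odd_gen n y) \<odot> (gen y * gen x) :: 'a alg"
  let ?k = "sum_list (map \<nu> u) + (\<nu> x + \<nu> y) + sum_list (map \<nu> v)"
  have "gr \<nu> (\<nu> x + \<nu> y) ?c"
    by (intro gr_diff gr_smul) (simp_all flip: mon_append)
  then have "gr \<nu> ?k (mon u * ?c * mon v)" by (intro gr_mult) auto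
  moreover have "mon u * ?c * mon v \<in> comm_ideal n"
    using comm_ideal.comm[of "mon u" x y n "mon v"] by (simp add: smul_def)
  ultimately show "wt \<nu> H (mon u * ?c * mon v) \<in> comm_ideal n"
    by (simp add: wt_gr ideal_smul)
qed

lemma wt_ceq: "ceq n X Y \<Longrightarrow> ceq n (wt \<nu> H X) (wt \<nu> H Y)"
  unfolding ceq_def using wt_ideal[of "X - Y" n \<nu> H] by (simp add: wt_diff)

lemma wt_derivation:
  assumes "\<And>x. x \<in> S \<Longrightarrow> gr \<nu> (\<nu> x + e) (derivation n s f (gen x))" "supp S X"
  shows "wt \<nu> H (derivation n s f X) = derivation n s f (wt \<nu> (\<lambda>k. H (k + e)) X)"
proof (rule clin_eqI[where F = "\<lambda>X. wt \<nu> H (derivation n s f X)" and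
      G = "\<lambda>X. derivation n s f (wt \<nu> (\<lambda>k. H (k + e)) X)"])
  fix w assume w: "w \<in> Poly_Mapping.keys X"
  have "gr \<nu> (sum_list (map \<nu> w) + e) (der_word n s f w)"
    by (rule der_word_gr[where S = S]) (use w assms in \<open>auto simp: supp_def mon_Nil\<close>)
  then show "wt \<nu> H (derivation n s f (mon w)) = derivation n s f (wt \<nu> (\<lambda>k. H (k + e)) (mon w))"
    by (simp add: wt_gr wt_mon module_hom.scale[OF clin_derivation])
qed (intro clin_compose[OF clin_wt clin_derivation] clin_compose[OF clin_derivation clin_wt])+

text \<open>Being a derivation, the counting operator can stand on the right-hand side of a
  commutator relation verified on generators.\<close>

lemma count_derivation:
  "derivation n False (\<lambda>x. if P x then gen x else 0) X = wt (\<lambda>x. if P x then 1 else 0) of_int X"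
proof (rule clin_eqI[OF clin_derivation clin_wt])
  fix w :: "'a gen list"
  show "derivation n False (\<lambda>x. if P x then gen x else 0) (mon w) = wt (\<lambda>x. if P x then 1 else 0) of_int (mon w)"
    unfolding wt_mon derivation_mon
  proof (induction w)
    case (Cons x w)
    show ?case
      unfolding der_word_Cons Cons by (simp add: koszul_def mon_Cons[of x w] alg.scale_left_distrib)
  qed simp
qed

lemma wt_feq:
  assumes "\<And>x. gr \<nu> (\<nu> x + e) (ext_d n (gen x))" "functional_eq n X Y"
  shows "functional_eq n (wt \<nu> H X) (wt \<nu> H Y)"
proof -
  from assms(2) obtain \<alpha> where "ceq n X (Y + ext_d n \<alpha>)" unfolding feq_alt by blast
  from wt_ceq[OF this, of \<nu> H] have "ceq n (wt \<nu> H X) (wt \<nu> H Y + wt \<nu> H (ext_d n \<alpha>))"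
    by (simp add: wt_add)
  also have "wt \<nu> H (ext_d n \<alpha>) = ext_d n (wt \<nu> (\<lambda>k. H (k + e)) \<alpha>)"
    using assms(1) unfolding ext_d_def by (intro wt_derivation[where S = UNIV]) auto
  finally show ?thesis unfolding feq_alt by blast
qed

definition nfld :: "'a gen \<Rightarrow> int"
  where "nfld x = (if is_field x then 1 else 0)"

definition njet :: "'a gen \<Rightarrow> int"
  where "njet x = (case x of Fld A a I J \<Rightarrow> int (size J) | _ \<Rightarrow> 0)"

lemma nfld_simps [simp]: "nfld (Dx \<mu>) = 0" "nfld (Fld A a I J) = 1"
  by (simp_all add: nfld_def)

lemma njet_simps [simp]: "njet (Dx \<mu>) = 0" "njet (Fld A a I J) = int (size J)"
  by (simp_all add: njet_def)

lemma ext_d_gr: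
  assumes "\<And>A a I J \<mu>. \<nu> (Fld A a I (add_mset \<mu> J)) + \<nu> (Dx \<mu>) = \<nu> (Fld A a I J) + e"
  shows "gr \<nu> (\<nu> x + e) (ext_d n (gen x))"
  using assms by (cases x) (auto simp: ext_d_gen add.commute intro!: gr_sum simp flip: mon_append)

lemma wt_nfld_feq: "functional_eq n X Y \<Longrightarrow> functional_eq n (wt nfld H X) (wt nfld H Y)"
  by (rule wt_feq[where e = 0]) (rule ext_d_gr, auto)

text \<open>Projection on words without derivatives fixes \<open>X\<close> and kills exact forms,
  because \<open>ext_d\<close> adds exactly one derivative and no word contains minus one of
  them.\<close>

lemma total_derivative_free:
  assumes "functional_eq n X 0" "gr njet 0 X"
  shows "ceq n X 0"
proof -
  let ?H = "\<lambda>k. if k = 0 then 1 else 0"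
  from assms(1) obtain \<alpha> where "ceq n X (ext_d n \<alpha>)" unfolding feq_alt by auto
  from wt_ceq[OF this, of njet ?H] have "ceq n X (wt njet ?H (ext_d n \<alpha>))"
    using wt_gr[OF assms(2), of ?H] by simp
  also have "wt njet ?H (ext_d n \<alpha>) = ext_d n (wt njet (\<lambda>k. ?H (k + 1)) \<alpha>)"
    using ext_d_gr[of njet 1] unfolding ext_d_def by (intro wt_derivation[where S = UNIV]) auto
  also have "wt njet (\<lambda>k. ?H (k + 1)) \<alpha> = 0"
  proof (rule wt_zero)
    fix w :: "'a gen list"
    have "sum_list (map njet w) \<ge> 0" by (intro sum_list_nonneg) (auto simp: njet_def split: gen.split)
    then show "?H (sum_list (map njet w) + 1) = 0" by simp
  qed
  finally show ?thesis by (simp add: gder_0[OF gder_ext_d])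
qed

section \<open>The contracting homotopy of vector supersymmetry\<close>

definition jets :: "nat \<Rightarrow> ladder set \<Rightarrow> bool \<Rightarrow> 'a gen set"
  where "jets n As b = {x. case x of Dx \<mu> \<Rightarrow> \<mu> < n + 2
    | Fld A a I J \<Rightarrow> A \<in> As \<and> I \<subseteq> {..<n+2} \<and> set_mset J \<subseteq> {..<n+2} \<and> (b \<longrightarrow> J = {#})
    | _ \<Rightarrow> False}"

lemma jets_simps [simp]:
  "Dx \<mu> \<in> jets n As b \<longleftrightarrow> \<mu> < n + 2"
  "Fld A a I J \<in> jets n As b \<longleftrightarrow> A \<in> As \<and> I \<subseteq> {..<n+2} \<and> set_mset J \<subseteq> {..<n+2} \<and> (b \<longrightarrow> J = {#})"
  "Xi \<mu> \<notin> jets n As b" "Eps \<mu> \<notin> jets n As b" "U a \<notin> jets n As b" "V a \<notin> jets n As b"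
  by (simp_all add: jets_def)

lemma ghost_free_jets: "ghost_free n X \<longleftrightarrow> supp (jets n UNIV False) X"
proof -
  have "ghost_free_gen n x \<longleftrightarrow> x \<in> jets n UNIV False" for x :: "'a gen"
    by (cases x) auto
  then show ?thesis by (auto simp: ghost_free_def supp_def)
qed

lemma contract_supp: "supp S X \<Longrightarrow> supp S (contract n \<mu> X)"
  unfolding contract_def by (rule derivation_supp) (auto split: gen.split)

lemma partial_supp: "\<mu> < n + 2 \<Longrightarrow> supp (jets n As False) X \<Longrightarrow> supp (jets n As False) (partial n \<mu> X)"
  unfolding partial_def by (rule derivation_supp) (auto split: gen.split)

lemma form_comp_supp: "supp S X \<Longrightarrow> supp S (form_comp n I X)"
proof -
  have "supp S X \<Longrightarrow> supp S (fold (contract n) xs X)" for xs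
    by (induction xs arbitrary: X) (auto intro: contract_supp)
  then show "supp S X \<Longrightarrow> supp S (form_comp n I X)" by (simp add: form_comp_def)
qed

lemma fold_partial_supp:
  assumes "supp (jets n As b) X" "set_mset J \<subseteq> {..<n+2}" "b \<Longrightarrow> J = {#}"
  shows "supp (jets n As b) (fold (partial n) (sorted_list_of_multiset J) X)"
proof (cases b)
  case False
  have "supp (jets n As False) X \<Longrightarrow> set xs \<subseteq> {..<n+2} \<Longrightarrow> supp (jets n As False) (fold (partial n) xs X)" for xs
  proof (induction xs arbitrary: X)
    case (Cons x xs)
    then have "supp (jets n As False) (partial n x X)" by (intro partial_supp) auto
    with Cons show ?case by simp
  qed simp
  with False assms show ?thesis by auto
qed (use assms in auto)

lemma phi_supp: "A \<in> As \<Longrightarrow> supp (jets n As b) (phi n A a p)"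
  unfolding phi_def
proof (intro supp_sum)
  fix I assume "A \<in> As" "I \<in> {I. I \<subseteq> {..<n+2} \<and> card I = p}"
  moreover from this have "finite I" using finite_subset by blast
  ultimately show "supp (jets n As b) (mon (map Dx (sorted_list_of_set I)) * gen (Fld A a I {#}))"
    by (auto simp flip: mon_append)
qed

lemma field_derivation_supp:
  assumes R: "\<And>A a p. A \<in> As \<Longrightarrow> supp (jets n As b) (R A a p :: 'a alg)" and X: "supp (jets n As b) X"
  shows "supp (jets n As b) (field_derivation n s R X)"
  unfolding field_derivation_def
proof (rule derivation_supp[OF _ X])
  fix x :: "'a gen" assume "x \<in> jets n As b"
  then show "supp (jets n As b) (case x of Fld A a I J \<Rightarrow> cst (koszul s (odd (card I))) *
          fold (partial n) (sorted_list_of_multiset J) (form_comp n I (R A a (card I))) | _ \<Rightarrow> 0)"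
    by (cases x) (auto simp flip: smul_def intro!: supp_smul fold_partial_supp form_comp_supp R)
qed

lemma WS_supp: "supp (jets n As b) X \<Longrightarrow> supp (jets n As b) (WS n \<mu> X)"
  unfolding WS_def by (rule field_derivation_supp) (auto intro!: supp_minus contract_supp phi_supp)

lemma derivation_gr_UNIV:
  "(\<And>x. gr \<nu> (\<nu> x + e) (f x)) \<Longrightarrow> gr \<nu> k X \<Longrightarrow> gr \<nu> (k + e) (derivation n s f X)"
  by (rule derivation_gr[where S = UNIV]) auto

lemma WS_nfld: "gr nfld (nfld x + 0) (WS n \<mu> (gen x))"
proof -
  have c: "gr nfld k (contract n \<mu> X)" if "gr nfld k X" for \<mu> k and X :: "'a alg"
    unfolding contract_def
    by (rule derivation_gr_UNIV[where e = 0, simplified]) (use that in \<open>auto split: gen.split\<close>)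
  have p: "gr nfld k (partial n \<mu> X)" if "gr nfld k X" for \<mu> k and X :: "'a alg"
    unfolding partial_def
    by (rule derivation_gr_UNIV[where e = 0, simplified]) (use that in \<open>auto split: gen.split\<close>)
  have c': "gr nfld k (fold (contract n) xs X)" if "gr nfld k X" for k xs and X :: "'a alg"
    using that by (induction xs arbitrary: X) (auto intro: c)
  have p': "gr nfld k (fold (partial n) xs X)" if "gr nfld k X" for k xs and X :: "'a alg"
    using that by (induction xs arbitrary: X) (auto intro: p)
  have "gr nfld 1 (phi n A a q)" for A a q
    unfolding phi_def by (intro gr_sum) (simp flip: mon_append add: comp_def sum_list_triv)
  then show ?thesis
    by (cases x) (auto simp: WS_def field_derivation_gen form_comp_def intro!: gr_smul p' c' gr_minus c)
qed

lemma wt_WS: "wt nfld H (WS n \<mu> X) = WS n \<mu> (wt nfld H X)"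
  using WS_nfld[of _ n \<mu>] unfolding WS_def field_derivation_def
  by (subst wt_derivation[where S = UNIV and e = 0 and \<nu> = nfld]) simp_all

text \<open>
  The contracting homotopy for \<open>WS n \<mu>\<close>; \<open>sigma\<close> is the sign in \<open>WS_Fld\<close>.
\<close>

definition desc :: "nat \<Rightarrow> nat \<Rightarrow> 'a alg \<Rightarrow> 'a alg"
  where "desc n \<mu> = derivation n True (\<lambda>x. case x of
      Fld A a I J \<Rightarrow> if \<mu> \<in> I \<and> I \<subseteq> {..<n+2} then sigma \<mu> (I - {\<mu>}) \<odot> gen (Fld A a (I - {\<mu>}) J) else 0
    | _ \<Rightarrow> 0)"

lemma desc_gen: "desc n \<mu> (gen x) = (case x of
      Fld A a I J \<Rightarrow> if \<mu> \<in> I \<and> I \<subseteq> {..<n+2} then sigma \<mu> (I - {\<mu>}) \<odot> gen (Fld A a (I - {\<mu>}) J) else 0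
    | _ \<Rightarrow> 0)"
  by (simp add: desc_def mon_Nil)

lemma card_Diff_int:
  fixes I :: "nat set"
  assumes "\<mu> \<in> I" "I \<subseteq> {..<n+2}" shows "int (card (I - {\<mu>})) = int (card I) - 1"
proof -
  have "finite I" by (rule finite_subset[OF assms(2)]) simp
  from card_Suc_Diff1[OF this assms(1)] show ?thesis by linarith
qed

text \<open>Stated for an arbitrary weight, so as to cover total degree, ghost number, dimension,
  form degree and field number together.\<close>

lemma desc_homogeneous:
  assumes "\<And>A a I J. \<mu> \<in> I \<Longrightarrow> I \<subseteq> {..<n+2} \<Longrightarrow> \<nu> (Fld A a (I - {\<mu>}) J) = \<nu> (Fld A a I J) + e"
  shows "gr \<nu> (\<nu> x + e) (case x of
      Fld A a I J \<Rightarrow> if \<mu> \<in> I \<and> I \<subseteq> {..<n+2} then sigma \<mu> (I - {\<mu>}) \<odot> gen (Fld A a (I - {\<mu>}) J) else 0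
    | _ \<Rightarrow> 0)"
  using assms by (auto split: gen.split intro!: gr_smul)

lemma desc_gr:
  assumes "\<And>A a I J. \<mu> \<in> I \<Longrightarrow> I \<subseteq> {..<n+2} \<Longrightarrow> \<nu> (Fld A a (I - {\<mu>}) J) = \<nu> (Fld A a I J) + e"
    and "gr \<nu> k X"
  shows "gr \<nu> (k + e) (desc n \<mu> X)"
  unfolding desc_def by (rule derivation_gr_UNIV[OF _ assms(2)], rule desc_homogeneous, rule assms(1))

lemma gder_desc: "gder n 1 (desc n \<mu>)"
  unfolding desc_def by (rule gder_derivation, rule desc_homogeneous, unfold tot_simps, subst card_Diff_int) auto

lemma desc_partial: "ceq n (desc n \<mu> (partial n \<nu> X)) (partial n \<nu> (desc n \<mu> X))"
proof -
  have "ceq n (desc n \<mu> (partial n \<nu> X)) (sg 1 0 \<odot> partial n \<nu> (desc n \<mu> X))"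
  proof (rule gder_commute[where S = UNIV, OF gder_desc gder_partial])
    fix x
    show "ceq n (desc n \<mu> (partial n \<nu> (gen x))) (sg 1 0 \<odot> partial n \<nu> (desc n \<mu> (gen x)))"
      by (cases x) (simp_all add: partial_gen desc_gen gder_0[OF gder_desc] gder_0[OF gder_partial] gder_smul[OF gder_partial])
  qed simp
  then show ?thesis by simp
qed

lemma desc_feq: "functional_eq n X Y \<Longrightarrow> functional_eq n (desc n \<mu> X) (desc n \<mu> Y)"
  by (rule gder_feq[OF gder_desc gder_ext_d_commute[OF gder_desc _ desc_partial]]) (simp_all add: desc_gen)

lemma desc_supp: "supp (jets n As b) X \<Longrightarrow> supp (jets n As b) (desc n \<mu> X)"
  unfolding desc_def
proof (rule derivation_supp)
  fix x :: "'a gen" assume "x \<in> jets n As b"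
  then show "supp (jets n As b) (case x of
      Fld A a I J \<Rightarrow> if \<mu> \<in> I \<and> I \<subseteq> {..<n+2} then sigma \<mu> (I - {\<mu>}) \<odot> gen (Fld A a (I - {\<mu>}) J) else 0
    | _ \<Rightarrow> 0)"
    by (cases x) (auto intro!: supp_smul)
qed

lemma wt_desc: "wt nfld H (desc n \<mu> X) = desc n \<mu> (wt nfld H X)"
  unfolding desc_def using desc_homogeneous[of \<mu> n nfld 0]
  by (subst wt_derivation[where S = UNIV and e = 0 and \<nu> = nfld]) (simp_all add: mon_Nil)

lemma sigma_square [simp]: "sigma \<mu> I * sigma \<mu> I = 1"
  by (simp add: sigma_def flip: power_add mult_2)

lemma below_insert: "finite I \<Longrightarrow> \<nu> \<notin> I \<Longrightarrow> below \<mu> (insert \<nu> I) = (if \<nu> < \<mu> then Suc (below \<mu> I) else below \<mu> I)"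
proof -
  assume *: "finite I" "\<nu> \<notin> I"
  have "{i \<in> insert \<nu> I. i < \<mu>} = (if \<nu> < \<mu> then insert \<nu> {i \<in> I. i < \<mu>} else {i \<in> I. i < \<mu>})" by auto
  with * show ?thesis by (simp add: below_def)
qed

text \<open>Cardinalities contribute equally on both sides; the relative minus arises because
  exactly one of the two indices lies below the other.\<close>

lemma sigma_anticommute:
  assumes "finite I" "\<mu> \<notin> I" "\<nu> \<notin> I" "\<mu> \<noteq> \<nu>"
  shows "sigma \<mu> I * sigma \<nu> (insert \<mu> I) = - (sigma \<nu> I * sigma \<mu> (insert \<nu> I))"
  using assms by (cases "\<mu> < \<nu>") (auto simp: sigma_def below_insert power_add)

text \<open>On components both orders insert the same two indices, with signs related by
  \<open>sigma_anticommute\<close>.\<close>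

lemma WS_anticommute:
  assumes "supp (jets n UNIV False) X"
  shows "ceq n (WS n \<mu> (WS n \<nu> X)) (- WS n \<nu> (WS n \<mu> X))"
proof -
  have WS2: "ceq n (WS n \<mu> (WS n \<nu> (gen (Fld A a I J))))
      (if \<mu> \<in> I \<or> \<nu> \<in> I \<or> \<mu> = \<nu> \<or> \<mu> \<ge> n + 2 \<or> \<nu> \<ge> n + 2 then 0
       else (sigma \<nu> I * sigma \<mu> (insert \<nu> I)) \<odot> gen (Fld A a (insert \<mu> (insert \<nu> I)) J))"
    if I: "I \<subseteq> {..<n+2}" for \<mu> \<nu> A J I and a :: 'a
  proof (cases "\<nu> \<in> I \<or> \<nu> \<ge> n + 2")
    case True
    have "ceq n (WS n \<mu> (WS n \<nu> (gen (Fld A a I J)))) (WS n \<mu> 0)"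
      using gder_ceq[OF gder_WS WS_Fld[OF I, of \<nu> A a J]] True by auto
    then show ?thesis using True by (auto simp: gder_0[OF gder_WS])
  next
    case False
    have "ceq n (WS n \<mu> (WS n \<nu> (gen (Fld A a I J)))) (WS n \<mu> (sigma \<nu> I \<odot> gen (Fld A a (insert \<nu> I) J)))"
      using gder_ceq[OF gder_WS WS_Fld[OF I, of \<nu> A a J]] False by auto
    also have "\<dots> = sigma \<nu> I \<odot> WS n \<mu> (gen (Fld A a (insert \<nu> I) J))" by (rule gder_smul[OF gder_WS])
    also have "ceq n \<dots> (sigma \<nu> I \<odot> (if \<mu> \<in> insert \<nu> I \<or> \<mu> \<ge> n + 2 then 0 else sigma \<mu> (insert \<nu> I) \<odot> gen (Fld A a (insert \<mu> (insert \<nu> I)) J)))"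
      by (intro ceq_smul WS_Fld) (use I False in auto)
    finally show ?thesis using False by (auto split: if_splits)
  qed
  have "ceq n (WS n \<mu> (WS n \<nu> X)) (sg (-1) (-1) \<odot> WS n \<nu> (WS n \<mu> X))"
  proof (rule gder_commute[OF gder_WS gder_WS _ assms])
    fix x :: "'a gen" assume x: "x \<in> jets n UNIV False"
    show "ceq n (WS n \<mu> (WS n \<nu> (gen x))) (sg (-1) (-1) \<odot> WS n \<nu> (WS n \<mu> (gen x)))"
    proof (cases x)
      case (Fld A a I J)
      with x have I: "I \<subseteq> {..<n+2}" and fin: "finite I" using finite_subset by auto
      show ?thesis
        unfolding Fld
        by (rule ceq_trans[OF WS2[OF I] ceq_sym[OF ceq_trans[OF ceq_smul[OF WS2[OF I]]]]])
           (use sigma_anticommute[OF fin, of \<mu> \<nu>] in \<open>auto simp: sg_def koszul_def insert_commute\<close>)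
    qed (use x in \<open>simp_all add: gder_0[OF gder_WS]\<close>)
  qed
  then show ?thesis by (simp add: sg_def koszul_def)
qed

lemma gder_count: "gder n 0 (wt nfld of_int)"
proof -
  have "wt nfld of_int = derivation n False (\<lambda>x. if is_field x then gen x else (0 :: 'a alg))"
    unfolding nfld_def by (rule ext) (rule count_derivation[symmetric])
  moreover have "gder n 0 (derivation n False (\<lambda>x. if is_field x then gen x else (0 :: 'a alg)))"
    by (rule gder_derivation) auto
  ultimately show ?thesis by simp
qed

text \<open>The Clifford-type relation behind the homotopy. For equal indices exactly one order of
  inserting and removing is nonzero on a given component and returns it with a squared sign; for
  different indices the two orders cancel.\<close>

lemma WS_desc:
  assumes "supp (jets n UNIV False) X" "\<mu> < n + 2"
  shows "ceq n (WS n \<mu> (desc n \<nu> X)) (- desc n \<nu> (WS n \<mu> X) + (if \<mu> = \<nu> then wt nfld of_int X else 0))"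
proof -
  have H: "gder n (-1 + 1) (\<lambda>X. if \<mu> = \<nu> then wt nfld of_int X else 0 :: 'a alg)"
    by (cases "\<mu> = \<nu>") (simp_all add: gder_count gder_zero)
  have "ceq n (WS n \<mu> (desc n \<nu> X)) (sg (-1) 1 \<odot> desc n \<nu> (WS n \<mu> X) + (if \<mu> = \<nu> then wt nfld of_int X else 0))"
  proof (rule gder_commutator_eq[OF gder_WS gder_desc H _ assms(1)])
    fix x :: "'a gen" assume x: "x \<in> jets n UNIV False"
    show "ceq n (WS n \<mu> (desc n \<nu> (gen x))) (sg (-1) 1 \<odot> desc n \<nu> (WS n \<mu> (gen x)) + (if \<mu> = \<nu> then wt nfld of_int (gen x) else 0))"
    proof (cases x)
      case (Fld A a I J)
      with x have I: "I \<subseteq> {..<n+2}" and fin: "finite I" using finite_subset by auto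
      have I': "I - {\<nu>} \<subseteq> {..<n+2}" using I by auto
      have sg: "sg (-1) 1 = -1" by (simp add: sg_def koszul_def)
      let ?F = "\<lambda>I. gen (Fld A a I J)"
      have L: "ceq n (WS n \<mu> (desc n \<nu> (?F I))) (if \<nu> \<in> I then
          sigma \<nu> (I - {\<nu>}) \<odot> (if \<mu> \<in> I - {\<nu>} then 0 else sigma \<mu> (I - {\<nu>}) \<odot> ?F (insert \<mu> (I - {\<nu>}))) else 0)"
        using ceq_smul[OF WS_Fld[OF I', of \<mu> A a J], of "sigma \<nu> (I - {\<nu>})"] assms(2) I
        by (auto simp: desc_gen gder_smul[OF gder_WS] gder_0[OF gder_WS])
      have "ceq n (desc n \<nu> (WS n \<mu> (?F I))) (desc n \<nu> (if \<mu> \<in> I then 0 else sigma \<mu> I \<odot> ?F (insert \<mu> I)))"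
        using gder_ceq[OF gder_desc WS_Fld[OF I, of \<mu> A a J]] assms(2) by auto
      also have "\<dots> = (if \<mu> \<in> I \<or> \<nu> \<notin> insert \<mu> I then 0 else (sigma \<mu> I * sigma \<nu> (insert \<mu> I - {\<nu>})) \<odot> ?F (insert \<mu> I - {\<nu>}))"
        using I assms(2) by (auto simp: gder_0[OF gder_desc] gder_smul[OF gder_desc] desc_gen)
      finally have R: "ceq n (- desc n \<nu> (WS n \<mu> (?F I))) (- (if \<mu> \<in> I \<or> \<nu> \<notin> insert \<mu> I then 0 else (sigma \<mu> I * sigma \<nu> (insert \<mu> I - {\<nu>})) \<odot> ?F (insert \<mu> I - {\<nu>})))"
        by (rule ceq_minus)
      \<comment> \<open>The case of different indices: \<open>sigma_anticommute\<close> on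
        \<open>I - {\<nu>}\<close>, rearranged by multiplying with signs whose squares are
        one.\<close>
      have anti: "sigma \<mu> I * sigma \<nu> (insert \<mu> I - {\<nu>}) = - (sigma \<nu> (I - {\<nu>}) * sigma \<mu> (I - {\<nu>}))"
        if "\<nu> \<in> I" "\<mu> \<notin> I"
      proof -
        have ne: "\<mu> \<noteq> \<nu>" using that by auto
        have ins: "insert \<nu> (I - {\<nu>}) = I" "insert \<mu> I - {\<nu>} = insert \<mu> (I - {\<nu>})" using that by auto
        have "sigma \<mu> (I - {\<nu>}) * sigma \<nu> (insert \<mu> (I - {\<nu>})) = - (sigma \<nu> (I - {\<nu>}) * sigma \<mu> I)"
          using sigma_anticommute[of "I - {\<nu>}" \<mu> \<nu>] fin that ne ins by auto
        then have "sigma \<mu> I * sigma \<nu> (insert \<mu> (I - {\<nu>})) = - (sigma \<nu> (I - {\<nu>}) * sigma \<mu> (I - {\<nu>}))"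
          using sigma_square[of \<mu> I] sigma_square[of \<mu> "I - {\<nu>}"] by algebra
        then show ?thesis by (simp add: ins mult.commute)
      qed
      have e: "(if \<nu> \<in> I then
          sigma \<nu> (I - {\<nu>}) \<odot> (if \<mu> \<in> I - {\<nu>} then 0 else sigma \<mu> (I - {\<nu>}) \<odot> ?F (insert \<mu> (I - {\<nu>}))) else 0)
        = - (if \<mu> \<in> I \<or> \<nu> \<notin> insert \<mu> I then 0 else (sigma \<mu> I * sigma \<nu> (insert \<mu> I - {\<nu>})) \<odot> ?F (insert \<mu> I - {\<nu>}))
        + (if \<mu> = \<nu> then ?F I else 0)"
        using anti by (auto simp: insert_absorb insert_Diff_if)
      show ?thesis
        unfolding Fld sg alg.scale_minus_left alg.scale_one
        using ceq_trans[OF L[unfolded e] ceq_add[OF ceq_sym[OF R] ceq_refl]]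
        by (cases "\<mu> = \<nu>") (simp_all add: wt_mon)
    qed (use x in \<open>simp_all add: gder_0[OF gder_WS] gder_0[OF gder_desc] desc_gen wt_mon\<close>)
  qed
  then show ?thesis by (simp add: sg_def koszul_def)
qed

lemma gder_ceq_0: "gder n e F \<Longrightarrow> ceq n X 0 \<Longrightarrow> ceq n (F X) 0"
  by (metis gder_ceq gder_0)

lemma desc_feq_0: "functional_eq n X 0 \<Longrightarrow> functional_eq n (desc n \<mu> X) 0"
  by (metis desc_feq gder_0 gder_desc)

lemma foldr_supp:
  assumes "\<And>\<mu> X. supp S X \<Longrightarrow> supp S (F \<mu> X)"
  shows "supp S X \<Longrightarrow> supp S (foldr F xs X)"
  by (induction xs) (auto intro: assms)

lemma wt_foldr:
  assumes "\<And>\<mu> X. wt \<nu> H (F \<mu> X) = F \<mu> (wt \<nu> H X)"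
  shows "wt \<nu> H (foldr F xs X) = foldr F xs (wt \<nu> H X)"
  by (induction xs) (simp_all add: assms)

text \<open>As \<mu> is not in \<open>xs\<close>, each factor passed contributes a minus sign and no
  counting term.\<close>

lemma desc_foldr_WS:
  assumes X: "supp (jets n UNIV False) X" and "\<mu> \<notin> set xs" "set xs \<subseteq> {..<n+2}"
  shows "ceq n (desc n \<mu> (foldr (WS n) xs X)) ((-1) ^ length xs \<odot> foldr (WS n) xs (desc n \<mu> X))"
  using assms(2,3)
proof (induction xs)
  case (Cons x xs)
  let ?Y = "foldr (WS n) xs X"
  have Y: "supp (jets n UNIV False) ?Y" by (rule foldr_supp[OF WS_supp X])
  have "ceq n (WS n x (desc n \<mu> ?Y)) (- desc n \<mu> (WS n x ?Y))"
    using WS_desc[OF Y, of x \<mu>] Cons.prems by auto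
  from ceq_minus[OF ceq_sym[OF this]] have "ceq n (desc n \<mu> (WS n x ?Y)) (- WS n x (desc n \<mu> ?Y))" by simp
  also have "ceq n \<dots> (- WS n x ((-1) ^ length xs \<odot> foldr (WS n) xs (desc n \<mu> X)))"
    using Cons by (intro ceq_minus gder_ceq[OF gder_WS]) auto
  finally show ?case by (simp add: gder_smul[OF gder_WS])
qed simp

text \<open>Each \<open>desc n x\<close> moves past the \<open>WS\<close> of the other directions.
  Only the nonvanishing of the total sign matters later, hence the existential form.\<close>

lemma foldr_WS_desc_reorder:
  assumes X: "supp (jets n UNIV False) X" and "distinct xs" "set xs \<subseteq> {..<n+2}"
  shows "\<exists>s. s \<noteq> 0 \<and> ceq n (foldr (\<lambda>\<mu> X. WS n \<mu> (desc n \<mu> X)) xs X)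
    (s \<odot> foldr (WS n) xs (foldr (desc n) xs X))"
  using assms(2,3)
proof (induction xs)
  case (Cons x xs)
  let ?Y = "foldr (desc n) xs X"
  have Y: "supp (jets n UNIV False) ?Y" by (rule foldr_supp[OF desc_supp X])
  from Cons obtain s where s0: "s \<noteq> 0" and s: "ceq n (foldr (\<lambda>\<mu> X. WS n \<mu> (desc n \<mu> X)) xs X) (s \<odot> foldr (WS n) xs ?Y)"
    by auto
  have "ceq n (foldr (\<lambda>\<mu> X. WS n \<mu> (desc n \<mu> X)) (x # xs) X) (WS n x (desc n x (s \<odot> foldr (WS n) xs ?Y)))"
    using s by (auto intro: gder_ceq[OF gder_WS] gder_ceq[OF gder_desc])
  also have "\<dots> = s \<odot> WS n x (desc n x (foldr (WS n) xs ?Y))"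
    by (simp add: gder_smul[OF gder_WS] gder_smul[OF gder_desc])
  also have "ceq n \<dots> (s \<odot> WS n x ((-1) ^ length xs \<odot> foldr (WS n) xs (desc n x ?Y)))"
    using Cons by (intro ceq_smul gder_ceq[OF gder_WS] desc_foldr_WS Y) auto
  finally have "ceq n (foldr (\<lambda>\<mu> X. WS n \<mu> (desc n \<mu> X)) (x # xs) X)
      ((s * (-1) ^ length xs) \<odot> foldr (WS n) (x # xs) (foldr (desc n) (x # xs) X))"
    by (simp add: gder_smul[OF gder_WS])
  with s0 show ?case by (intro exI[of _ "s * (-1) ^ length xs"]) simp
qed (auto intro: exI[of _ 1])

text \<open>On an invariant functional \<open>WS n x (desc n x X)\<close> reduces to the field
  count, since \<open>desc\<close> respects equality of functionals. Weights commute with both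
  operators, so in each step the relation is applied to \<open>X\<close> itself.\<close>

lemma foldr_WS_desc_count:
  assumes X: "supp (jets n UNIV False) X" and inv: "\<And>\<mu>. \<mu> < n + 2 \<Longrightarrow> functional_eq n (WS n \<mu> X) 0"
    and xs: "set xs \<subseteq> {..<n+2}"
  shows "functional_eq n (foldr (\<lambda>\<mu> X. WS n \<mu> (desc n \<mu> X)) xs X)
    (wt nfld (\<lambda>k. of_int k ^ length xs) X)"
  using xs
proof (induction xs)
  case Nil
  then show ?case by (simp add: wt_one)
next
  case (Cons x xs)
  let ?H = "\<lambda>k. of_int k ^ length xs :: complex"
  have "functional_eq n (WS n x (desc n x X)) (- desc n x (WS n x X) + wt nfld of_int X)"
    using ceq_feq[OF WS_desc[OF X, of x x]] Cons.prems by auto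
  also have "functional_eq n \<dots> (- desc n x 0 + wt nfld of_int X)"
    using Cons.prems by (intro feq_add feq_minus feq_refl desc_feq inv) auto
  finally have "functional_eq n (wt nfld ?H (WS n x (desc n x X))) (wt nfld ?H (wt nfld of_int X))"
    by (intro wt_nfld_feq) (simp add: gder_0[OF gder_desc])
  moreover have "functional_eq n (foldr (\<lambda>\<mu> X. WS n \<mu> (desc n \<mu> X)) (x # xs) X) (WS n x (desc n x (wt nfld ?H X)))"
    using Cons by (auto intro: WS_feq desc_feq)
  ultimately show ?case
    by (simp add: wt_WS wt_desc wt_wt_same mult.commute) (rule feq_trans)
qed

text \<open>The value at 0 is a default: inversion is claimed only if every word contains a field,
  see \<open>ninv_wt\<close>.\<close>

definition ninv :: "nat \<Rightarrow> int \<Rightarrow> complex"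
  where "ninv d k = (if k = 0 then 0 else inverse (of_int k ^ d))"

lemma nfld_pos:
  assumes "x \<in> set w" "is_field x" shows "sum_list (map nfld w) > 0"
proof -
  have "nfld y \<ge> 0" for y :: "'a gen" by (simp add: nfld_def)
  then have "sum_list (map nfld w) \<ge> nfld x"
    using member_le_sum_list[of "nfld x" "map nfld w"] assms
    by (metis (no_types, lifting) add_increasing2 imageE list.set_map in_set_conv_decomp map_append
        sum_list.append sum_list_nonneg list.simps(9) sum_list_simps(2) add_increasing)
  then show ?thesis using assms(2) by (simp add: nfld_def)
qed

lemma ninv_wt:
  assumes "\<And>w. w \<in> Poly_Mapping.keys X \<Longrightarrow> \<exists>x\<in>set w. is_field x"
  shows "wt nfld (ninv d) (wt nfld (\<lambda>k. of_int k ^ d) X) = X"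
  unfolding wt_wt_same
proof (rule wt_one)
  fix w assume "w \<in> Poly_Mapping.keys X"
  then show "ninv d (sum_list (map nfld w)) * of_int (sum_list (map nfld w)) ^ d = 1"
    using assms nfld_pos by (fastforce simp: ninv_def)
qed

section \<open>Consequences of the homotopy: representatives and injectivity\<close>

text \<open>The field count commutes with all \<open>WS n \<mu>\<close>, so its inverse can be
  placed on the innermost expression; \<open>fld\<close> is what makes the count invertible.\<close>

lemma WS_invariant_representative:
  fixes X :: "'a alg"
  assumes X: "supp (jets n UNIV False) X" and inv: "\<And>\<mu>. \<mu> < n + 2 \<Longrightarrow> functional_eq n (WS n \<mu> X) 0"
    and fld: "\<And>w. w \<in> Poly_Mapping.keys X \<Longrightarrow> \<exists>x\<in>set w. is_field x"
  shows "\<exists>s. s \<noteq> 0 \<and> functional_eq n X (s \<odot> foldr (WS n) [0..<n+2] (wt nfld (ninv (n+2)) (foldr (desc n) [0..<n+2] X)))"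
proof -
  let ?xs = "[0..<n+2]"
  obtain s where s0: "s \<noteq> 0" and s: "ceq n (foldr (\<lambda>\<mu> X. WS n \<mu> (desc n \<mu> X)) ?xs X)
    (s \<odot> foldr (WS n) ?xs (foldr (desc n) ?xs X))"
    using foldr_WS_desc_reorder[OF X, of ?xs] by (auto simp: lessThan_atLeast0)
  have "functional_eq n (wt nfld (\<lambda>k. of_int k ^ (n+2)) X) (foldr (\<lambda>\<mu> X. WS n \<mu> (desc n \<mu> X)) ?xs X)"
    using feq_sym[OF foldr_WS_desc_count[OF X inv, of ?xs]] by (auto simp: lessThan_atLeast0)
  from feq_ceq_trans(1)[OF this s]
  have "functional_eq n (wt nfld (ninv (n+2)) (wt nfld (\<lambda>k. of_int k ^ (n+2)) X))
    (wt nfld (ninv (n+2)) (s \<odot> foldr (WS n) ?xs (foldr (desc n) ?xs X)))"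
    by (rule wt_nfld_feq)
  moreover have "wt nfld (ninv (n+2)) (wt nfld (\<lambda>k. of_int k ^ (n+2)) X) = X"
    by (rule ninv_wt) (rule fld)
  moreover have "wt nfld (ninv (n+2)) (foldr (WS n) ?xs Y) = foldr (WS n) ?xs (wt nfld (ninv (n+2)) Y)" for Y :: "'a alg"
    by (rule wt_foldr) (rule wt_WS)
  ultimately show ?thesis using s0 by (auto simp: wt_smul)
qed

text \<open>The homotopy in the opposite direction, for elements annihilated by all
  \<open>desc n \<mu>\<close>. \<open>fold\<close> replaces \<open>foldr\<close> so that
  \<open>desc n x\<close> is applied first to the outermost factor \<open>WS n x\<close>.\<close>

lemma desc_foldr_WS_inverse:
  assumes "supp (jets n UNIV False) X" and "\<And>\<mu>. ceq n (desc n \<mu> X) 0"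
    and "distinct xs" "set xs \<subseteq> {..<n+2}"
  shows "ceq n (fold (desc n) xs (foldr (WS n) xs X)) (wt nfld (\<lambda>k. of_int k ^ length xs) X)"
  using assms
proof (induction xs arbitrary: X)
  case Nil
  then show ?case by (simp add: wt_one)
next
  case (Cons x xs)
  let ?Y = "foldr (WS n) xs X"
  have Y: "supp (jets n UNIV False) ?Y" by (rule foldr_supp[OF WS_supp Cons.prems(1)])
  have "ceq n (WS n x (desc n x ?Y)) (- desc n x (WS n x ?Y) + wt nfld of_int ?Y)"
    using WS_desc[OF Y, of x x] Cons.prems by auto
  from ceq_diff[OF ceq_refl[of n "wt nfld of_int ?Y"] this]
  have "ceq n (wt nfld of_int ?Y - WS n x (desc n x ?Y)) (desc n x (WS n x ?Y))" by simp
  \<comment> \<open>\<open>desc n x\<close> passes through the remaining factors, whose directions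
    differ from \<open>x\<close>, and annihilates \<open>X\<close>.\<close>
  moreover have "ceq n (WS n x (desc n x ?Y)) 0"
  proof -
    have "ceq n (WS n x (desc n x ?Y)) (WS n x ((-1) ^ length xs \<odot> foldr (WS n) xs (desc n x X)))"
      using Cons.prems by (intro gder_ceq[OF gder_WS] desc_foldr_WS) auto
    also have "ceq n (foldr (WS n) xs Z) 0" if "ceq n Z 0" for Z
      using that by (induction xs) (auto intro: gder_ceq_0[OF gder_WS])
    from this[OF Cons.prems(2)]
    have "ceq n (WS n x ((-1) ^ length xs \<odot> foldr (WS n) xs (desc n x X))) (WS n x ((-1) ^ length xs \<odot> 0))"
      by (intro gder_ceq[OF gder_WS] ceq_smul)
    finally show ?thesis by (simp add: gder_0[OF gder_WS])
  qed
  ultimately have "ceq n (desc n x (WS n x ?Y)) (wt nfld of_int ?Y - 0)"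
    by (meson ceq_diff ceq_refl ceq_sym ceq_trans)
  then have "ceq n (fold (desc n) xs (desc n x (WS n x ?Y))) (fold (desc n) xs (wt nfld of_int ?Y))"
    using fold_gder(2)[of xs n "\<lambda>_. 1" "desc n"] gder_desc by auto
  also have "wt nfld of_int ?Y = foldr (WS n) xs (wt nfld of_int X)"
    by (rule wt_foldr) (rule wt_WS)
  also have "ceq n (fold (desc n) xs \<dots>) (wt nfld (\<lambda>k. of_int k ^ length xs) (wt nfld of_int X))"
  proof (rule Cons.IH)
    show "ceq n (desc n \<mu> (wt nfld of_int X)) 0" for \<mu>
      using wt_ceq[OF Cons.prems(2), of nfld of_int \<mu>] by (simp add: wt_desc wt_0)
  qed (use Cons.prems in \<open>auto intro: wt_supp\<close>)
  finally show ?case by (simp add: wt_wt_same mult.commute)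
qed

text \<open>Applying the homotopy transports the total derivative back to \<open>X\<close>, where
  the absence of derivatives excludes it.\<close>

lemma foldr_WS_injective:
  assumes X: "supp (jets n UNIV False) X" and "\<And>\<mu>. ceq n (desc n \<mu> X) 0"
    and fld: "\<And>w. w \<in> Poly_Mapping.keys X \<Longrightarrow> \<exists>x\<in>set w. is_field x"
    and "functional_eq n (foldr (WS n) [0..<n+2] X) 0" and "gr njet 0 X"
  shows "ceq n X 0"
proof -
  let ?xs = "[0..<n+2]"
  have "functional_eq n (fold (desc n) xs Y) 0" if "functional_eq n Y 0" for xs Y
    using that
    by (induction xs arbitrary: Y) (auto intro: desc_feq_0)
  from this[OF assms(4)] have "functional_eq n (fold (desc n) ?xs (foldr (WS n) ?xs X)) 0" .
  with desc_foldr_WS_inverse[OF assms(1,2), of ?xs] have "functional_eq n (wt nfld (\<lambda>k. of_int k ^ (n+2)) X) 0"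
    using feq_ceq_trans(2)[OF ceq_sym] by (auto simp: lessThan_atLeast0)
  moreover have "wt nfld (ninv (n+2)) (wt nfld (\<lambda>k. of_int k ^ (n+2)) X) = X"
    by (rule ninv_wt) (rule fld)
  ultimately have "functional_eq n X 0" using wt_nfld_feq[of n _ 0 "ninv (n+2)"] wt_0 by metis
  then show ?thesis by (rule total_derivative_free) fact
qed

section \<open>Top forms and the ladder climbing operator\<close>

abbreviation fdeg :: "'a gen \<Rightarrow> int"
  where "fdeg x \<equiv> int (form_deg x)"

lemma dx_dx: "ceq n (dx \<mu> * dx \<mu>) 0"
proof (rule ceq_neg_self)
  show "ceq n (dx \<mu> * dx \<mu> :: 'a alg) (- (dx \<mu> * dx \<mu>))"
    using supercommute[of n 1 "dx \<mu> :: 'a alg" 1 "dx \<mu>"] by (simp add: sg_def koszul_def)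
qed

lemma form_deg_1: "form_deg x = 1 \<Longrightarrow> \<exists>\<mu>. x = Dx \<mu>"
  by (cases x) auto

text \<open>Two equal differentials are brought together at the cost of a sign, and their product
  vanishes.\<close>

lemma repeated_Dx: "\<not> distinct (filter (\<lambda>x. form_deg x = 1) w) \<Longrightarrow> ceq n (mon w) 0"
proof (induction w)
  case (Cons x w)
  show ?case
  proof (cases "distinct (filter (\<lambda>x. form_deg x = 1) w)")
    case True
    with Cons.prems have "x \<in> set w" and "form_deg x = 1" by (auto split: if_splits)
    then obtain \<mu> where x: "x = Dx \<mu>" using form_deg_1 by blast
    with \<open>x \<in> set w\<close> obtain u v where w: "w = u @ Dx \<mu> # v" by (meson split_list)
    let ?k = "sum_list (map (tot n) u)"
    have "mon (x # w) = (dx \<mu> * mon u) * (dx \<mu> * mon v)"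
      by (simp flip: mon_append add: x w)
    also have "ceq n \<dots> ((sg (tot n (Dx \<mu> :: 'a gen)) ?k \<odot> (mon u * dx \<mu>)) * (dx \<mu> * mon v))"
      by (intro ceq_mult ceq_gen_mon ceq_refl)
    also have "\<dots> = sg 1 ?k \<odot> (mon u * (dx \<mu> * dx \<mu>) * mon v)" by (simp add: mult.assoc)
    also have "ceq n \<dots> (sg 1 ?k \<odot> (mon u * 0 * mon v))"
      by (intro ceq_smul ceq_mult ceq_refl dx_dx)
    finally show ?thesis by simp
  next
    case False
    then have "ceq n (gen x * mon w) (gen x * 0)" by (intro ceq_mult ceq_refl Cons.IH)
    then show ?thesis by (simp add: mon_Cons[of x w])
  qed
qed simp

lemma ceq_0_words:
  assumes "\<And>w. w \<in> Poly_Mapping.keys X \<Longrightarrow> ceq n (mon w) 0" shows "ceq n X 0"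
proof -
  have "ceq n (\<Sum>w\<in>Poly_Mapping.keys X. Poly_Mapping.lookup X w \<odot> mon w)
    (\<Sum>w\<in>Poly_Mapping.keys X. Poly_Mapping.lookup X w \<odot> 0)"
    by (intro ceq_sum ceq_smul assms)
  then show ?thesis by (simp flip: alg_sum)
qed

text \<open>Pigeonhole: more than n + 2 differentials out of n + 2 force a repetition.\<close>

lemma form_degree_bound:
  fixes X :: "'a alg"
  assumes X: "supp S X" "gr fdeg k X" and S: "\<And>\<mu>. Dx \<mu> \<in> S \<Longrightarrow> \<mu> < n + 2" and k: "k > int n + 2"
  shows "ceq n X 0"
proof (rule ceq_0_words, rule repeated_Dx)
  fix w assume w: "w \<in> Poly_Mapping.keys X"
  let ?l = "filter (\<lambda>x. form_deg x = 1) w"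
  have fd: "form_deg x = 0 \<or> form_deg x = 1" for x :: "'a gen" by (cases x) auto
  have "sum_list (map fdeg v) = int (length (filter (\<lambda>x. form_deg x = 1) v))" for v :: "'a gen list"
    by (induction v) (use fd in auto)
  with w X k have len: "length ?l > n + 2" by (auto simp: gr_def)
  have "set ?l \<subseteq> Dx ` {..<n+2}"
  proof
    fix x assume "x \<in> set ?l"
    moreover have "set w \<subseteq> S" using w X by (auto simp: supp_def)
    ultimately show "x \<in> Dx ` {..<n+2}" using S form_deg_1[of x] by auto
  qed
  then have "card (set ?l) \<le> card (Dx ` {..<n+2} :: 'a gen set)" by (intro card_mono) auto
  also have "\<dots> \<le> n + 2" using card_image_le[of "{..<n+2}" "Dx :: nat \<Rightarrow> 'a gen"] by simp
  finally show "\<not> distinct ?l" using len distinct_card by fastforce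
qed

lemma fdeg_dx: "gr fdeg k X \<Longrightarrow> gr fdeg (k + 1) (dx \<mu> * X)"
  using gr_mult[of fdeg 1 "dx \<mu>" k X] by (simp add: add.commute)

text \<open>Contracting the vanishing (n+3)-form \<open>dx \<mu> * X\<close> leaves X minus dx
  contracted with X.\<close>

lemma dx_contract_top:
  assumes X: "supp (jets n As b) X" "gr fdeg (int n + 2) X" and \<mu>: "\<mu> < n + 2"
  shows "ceq n (dx \<mu> * contract n \<mu> X) X"
proof -
  have "ceq n (dx \<mu> * X) 0"
    by (rule form_degree_bound[where S = "jets n As b" and k = "int n + 2 + 1"])
       (use X \<mu> fdeg_dx[OF X(2)] in \<open>auto intro!: supp_mult\<close>)
  from gder_ceq_0[OF gder_contract this, of \<mu>] have "ceq n (X - dx \<mu> * contract n \<mu> X) 0"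
    by (simp add: contract_dx_mult)
  from ceq_diff[OF ceq_refl[of n X] this] show ?thesis by simp
qed

lemma contract_foldr_dx:
  "\<mu> \<notin> set xs \<Longrightarrow> contract n \<mu> (foldr (\<lambda>\<nu> Y. dx \<nu> * Y) xs X) =
    (-1) ^ length xs \<odot> foldr (\<lambda>\<nu> Y. dx \<nu> * Y) xs (contract n \<mu> X)"
  by (induction xs) (auto simp: contract_dx_mult)

text \<open>Iterates \<open>dx_contract_top\<close>; for the full list of directions this splits off
  the volume form. The scalar may stay unspecified because the coefficients of the final
  superposition are free.\<close>

lemma strip_dx:
  assumes X: "supp (jets n As b) X" "gr fdeg (int n + 2) X" and "distinct xs" "set xs \<subseteq> {..<n+2}"
  shows "\<exists>s. ceq n X (s \<odot> foldr (\<lambda>\<nu> Y. dx \<nu> * Y) xs (foldr (contract n) xs X))"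
  using assms(3,4)
proof (induction xs)
  case (Cons x xs)
  let ?Y = "foldr (contract n) xs X"
  from Cons obtain s where s: "ceq n X (s \<odot> foldr (\<lambda>\<nu> Y. dx \<nu> * Y) xs ?Y)" by auto
  have "ceq n X (dx x * contract n x X)"
    using Cons.prems by (intro ceq_sym[OF dx_contract_top[OF X]]) auto
  also have "ceq n \<dots> (dx x * contract n x (s \<odot> foldr (\<lambda>\<nu> Y. dx \<nu> * Y) xs ?Y))"
    by (intro ceq_mult ceq_refl gder_ceq[OF gder_contract] s)
  finally show ?case
    using Cons.prems by (auto simp: gder_smul[OF gder_contract] contract_foldr_dx intro!: exI)
qed (auto intro: exI[of _ 1])

lemma WS_dx: "ceq n (WS n \<mu> (dx \<nu> * X)) (- (dx \<nu> * WS n \<mu> X))"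
  using gder_mult_closed[OF gder_WS, of n 1 "dx \<nu>" \<mu> X] by (simp add: sg_def koszul_def)

lemma foldr_WS_dx: "ceq n (foldr (WS n) xs (dx \<nu> * X)) ((-1) ^ length xs \<odot> (dx \<nu> * foldr (WS n) xs X))"
proof (induction xs)
  case (Cons x xs)
  have "ceq n (WS n x (foldr (WS n) xs (dx \<nu> * X))) (WS n x ((-1) ^ length xs \<odot> (dx \<nu> * foldr (WS n) xs X)))"
    by (intro gder_ceq[OF gder_WS] Cons)
  also have "\<dots> = (-1) ^ length xs \<odot> WS n x (dx \<nu> * foldr (WS n) xs X)" by (rule gder_smul[OF gder_WS])
  also have "ceq n \<dots> ((-1) ^ length xs \<odot> (- (dx \<nu> * WS n x (foldr (WS n) xs X))))"
    by (intro ceq_smul WS_dx)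
  finally show ?case by simp
qed simp

text \<open>One summand of the climbing operator, up to sign. It is even, so that ordinary binomial
  calculus applies.\<close>

definition climb1 :: "nat \<Rightarrow> nat \<Rightarrow> 'a alg \<Rightarrow> 'a alg"
  where "climb1 n \<mu> X = dx \<mu> * WS n \<mu> X"

lemma gder_climb1: "gder n 0 (climb1 n \<mu>)"
  unfolding climb1_def using gder_lmult[OF gder_WS, of n 1 "dx \<mu>"] by simp

lemma climb1_supp: "\<mu> < n + 2 \<Longrightarrow> supp (jets n As b) X \<Longrightarrow> supp (jets n As b) (climb1 n \<mu> X)"
  unfolding climb1_def by (intro supp_mult WS_supp) simp_all

lemma foldr_WS_foldr_dx:
  "\<exists>s. ceq n (foldr (WS n) xs (foldr (\<lambda>\<nu> Y. dx \<nu> * Y) xs X)) (s \<odot> foldr (climb1 n) xs X)"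
proof (induction xs)
  case (Cons x xs)
  let ?Y = "foldr (\<lambda>\<nu> Y. dx \<nu> * Y) xs X"
  from Cons obtain s where s: "ceq n (foldr (WS n) xs ?Y) (s \<odot> foldr (climb1 n) xs X)" by auto
  have "ceq n (WS n x (foldr (WS n) xs (dx x * ?Y))) (WS n x ((-1) ^ length xs \<odot> (dx x * foldr (WS n) xs ?Y)))"
    by (intro gder_ceq[OF gder_WS] foldr_WS_dx)
  also have "ceq n \<dots> (WS n x ((-1) ^ length xs \<odot> (dx x * (s \<odot> foldr (climb1 n) xs X))))"
    by (intro gder_ceq[OF gder_WS] ceq_smul ceq_mult ceq_refl s)
  also have "\<dots> = ((-1) ^ length xs * s) \<odot> WS n x (dx x * foldr (climb1 n) xs X)"
    by (simp add: gder_smul[OF gder_WS])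
  also have "ceq n \<dots> (((-1) ^ length xs * s) \<odot> - (dx x * WS n x (foldr (climb1 n) xs X)))"
    by (intro ceq_smul WS_dx)
  finally have "ceq n (foldr (WS n) (x # xs) (foldr (\<lambda>\<nu> Y. dx \<nu> * Y) (x # xs) X))
     ((- ((-1) ^ length xs * s)) \<odot> foldr (climb1 n) (x # xs) X)"
    by (simp add: climb1_def)
  then show ?case ..
qed (auto intro: exI[of _ 1])

lemma climb1_climb1:
  assumes X: "supp (jets n UNIV False) X"
  shows "ceq n (climb1 n \<mu> (climb1 n \<nu> X)) (- (dx \<mu> * dx \<nu> * WS n \<mu> (WS n \<nu> X)))"
  using ceq_mult[OF ceq_refl[of n "dx \<mu>"] WS_dx[of n \<mu> \<nu> "WS n \<nu> X"]]
  by (simp add: climb1_def mult.assoc)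

lemma climb1_square:
  assumes X: "supp (jets n UNIV False) X"
  shows "ceq n (climb1 n \<mu> (climb1 n \<mu> X)) 0"
proof -
  have "ceq n (climb1 n \<mu> (climb1 n \<mu> X)) (- (dx \<mu> * dx \<mu> * WS n \<mu> (WS n \<mu> X)))"
    by (rule climb1_climb1[OF X])
  also have "ceq n \<dots> (- (0 * WS n \<mu> (WS n \<mu> X)))" by (intro ceq_minus ceq_mult dx_dx ceq_refl)
  finally show ?thesis by simp
qed

text \<open>Two signs cancel: the differentials anticommute, and so do the supersymmetry
  operators.\<close>

lemma climb1_commute:
  fixes X :: "'a alg"
  assumes X: "supp (jets n UNIV False) X"
  shows "ceq n (climb1 n \<mu> (climb1 n \<nu> X)) (climb1 n \<nu> (climb1 n \<mu> X))"
proof -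
  have "ceq n (climb1 n \<mu> (climb1 n \<nu> X)) (- (dx \<mu> * dx \<nu> * WS n \<mu> (WS n \<nu> X)))"
    by (rule climb1_climb1[OF X])
  also have "ceq n \<dots> (- ((sg 1 1 \<odot> (dx \<nu> * dx \<mu>)) * (- WS n \<nu> (WS n \<mu> X))))"
    by (intro ceq_minus ceq_mult supercommute WS_anticommute X) auto
  also have "\<dots> = - (dx \<nu> * dx \<mu> * WS n \<nu> (WS n \<mu> X))" by (simp add: sg_def koszul_def)
  also have "ceq n \<dots> (climb1 n \<nu> (climb1 n \<mu> X))"
    by (rule ceq_sym[OF climb1_climb1[OF X]])
  finally show ?thesis .
qed

text \<open>Partial sums over directions, for an induction on their number.\<close>

definition climb_upto :: "nat \<Rightarrow> nat \<Rightarrow> 'a alg \<Rightarrow> 'a alg"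
  where "climb_upto n k X = (\<Sum>\<mu><k. climb1 n \<mu> X)"

lemma gder_climb_upto: "gder n 0 (climb_upto n k)"
  unfolding climb_upto_def by (intro gder_Sum gder_climb1)

lemma climb_upto_supp: "k \<le> n + 2 \<Longrightarrow> supp (jets n As b) X \<Longrightarrow> supp (jets n As b) (climb_upto n k X)"
  unfolding climb_upto_def by (intro supp_sum climb1_supp) auto

lemma funpow_supp: "(\<And>X. supp S X \<Longrightarrow> supp S (F X)) \<Longrightarrow> supp S X \<Longrightarrow> supp S ((F ^^ m) X)"
  by (induction m) auto

lemma funpow_gder:
  assumes "gder n e F"
  shows "ceq n X Y \<Longrightarrow> ceq n ((F ^^ m) X) ((F ^^ m) Y)"
    and "(F ^^ m) (X + Y) = (F ^^ m) X + (F ^^ m) Y"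
    and "(F ^^ m) (z \<odot> X) = z \<odot> (F ^^ m) X"
    and "(F ^^ m) 0 = 0"
  by (induction m) (auto intro: gder_ceq[OF assms] simp: gder_add[OF assms] gder_smul[OF assms] gder_0[OF assms])

lemma climb1_climb_upto_funpow:
  assumes X: "supp (jets n UNIV False) X" and k: "k \<le> n + 2"
  shows "ceq n (climb1 n \<mu> ((climb_upto n k ^^ m) X)) ((climb_upto n k ^^ m) (climb1 n \<mu> X))"
proof (induction m)
  case (Suc m)
  let ?Y = "(climb_upto n k ^^ m) X"
  have Y: "supp (jets n UNIV False) ?Y" by (intro funpow_supp climb_upto_supp k X)
  have "climb1 n \<mu> (climb_upto n k ?Y) = (\<Sum>\<nu><k. climb1 n \<mu> (climb1 n \<nu> ?Y))"
    unfolding climb_upto_def by (rule gder_sum[OF gder_climb1])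
  also have "ceq n \<dots> (\<Sum>\<nu><k. climb1 n \<nu> (climb1 n \<mu> ?Y))"
    by (intro ceq_sum climb1_commute Y)
  also have "\<dots> = climb_upto n k (climb1 n \<mu> ?Y)" by (simp add: climb_upto_def)
  also have "ceq n \<dots> (climb_upto n k ((climb_upto n k ^^ m) (climb1 n \<mu> X)))"
    by (intro gder_ceq[OF gder_climb_upto] Suc)
  finally show ?case by simp
qed simp

text \<open>Binomial expansion of (S + e)^m for commuting S and e with e^2 = 0. At m = 0 the
  truncated exponent m - 1 is harmless, its coefficient being 0.\<close>

lemma climb_upto_Suc_funpow:
  fixes X :: "'a alg"
  assumes X: "supp (jets n UNIV False) X" and k: "k < n + 2"
  shows "ceq n ((climb_upto n (Suc k) ^^ m) X)
    ((climb_upto n k ^^ m) X + of_nat m \<odot> (climb_upto n k ^^ (m - 1)) (climb1 n k X))"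
proof (induction m)
  case (Suc m)
  let ?S = "climb_upto n k" and ?e = "climb1 n k"
  let ?Z = "(?S ^^ m) X + of_nat m \<odot> (?S ^^ (m - 1)) (?e X)"
  have two: "2 \<odot> Y = Y + Y" for Y :: "'a alg" using alg.scale_left_distrib[of 1 1 Y] by simp
  have e: "supp (jets n UNIV False) (?e X)" using climb1_supp[OF k X] .
  have S: "climb_upto n (Suc k) Y = ?S Y + ?e Y" for Y :: "'a alg"
    by (simp add: climb_upto_def sum.lessThan_Suc)
  have "ceq n (climb_upto n (Suc k) ((climb_upto n (Suc k) ^^ m) X)) (climb_upto n (Suc k) ?Z)"
    by (intro gder_ceq[OF gder_climb_upto] Suc)
  also have "\<dots> = ?S ((?S ^^ m) X) + of_nat m \<odot> ?S ((?S ^^ (m - 1)) (?e X)) + (?e ((?S ^^ m) X)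
     + of_nat m \<odot> ?e ((?S ^^ (m - 1)) (?e X)))"
    by (simp add: S gder_add[OF gder_climb_upto] gder_smul[OF gder_climb_upto]
        gder_add[OF gder_climb1] gder_smul[OF gder_climb1] alg.scale_right_distrib)
  also have "ceq n \<dots> (?S ((?S ^^ m) X) + of_nat m \<odot> ?S ((?S ^^ (m - 1)) (?e X)) + ((?S ^^ m) (?e X)
     + of_nat m \<odot> (?S ^^ (m - 1)) (?e (?e X))))"
    using k by (intro ceq_add ceq_smul ceq_refl climb1_climb_upto_funpow X e) auto
  also have "ceq n \<dots> (?S ((?S ^^ m) X) + of_nat m \<odot> ?S ((?S ^^ (m - 1)) (?e X)) + ((?S ^^ m) (?e X)
     + of_nat m \<odot> (?S ^^ (m - 1)) 0))"
    by (intro ceq_add ceq_smul ceq_refl funpow_gder(1)[OF gder_climb_upto] climb1_square X)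
  also have "\<dots> = (?S ^^ Suc m) X + of_nat (Suc m) \<odot> (?S ^^ (Suc m - 1)) (?e X)"
    using two by (cases m) (simp_all add: funpow_gder(4)[OF gder_climb_upto] alg.scale_left_distrib add_ac)
  finally show ?case by simp
qed simp

text \<open>A sum of k commuting summands of square zero has k-th power k! times their product. The
  vanishing of higher powers belongs to the induction, since it removes the pure S^m term of the
  binomial expansion.\<close>

lemma climb_upto_power:
  assumes "supp (jets n UNIV False) X" "k \<le> n + 2"
  shows "(\<forall>m>k. ceq n ((climb_upto n k ^^ m) X) 0) \<and>
    ceq n ((climb_upto n k ^^ k) X) (fact k \<odot> foldr (climb1 n) [0..<k] X)"
  using assms
proof (induction k arbitrary: X)
  case 0
  have "(climb_upto n 0 ^^ m) X = 0" if "m > 0" for m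
    using that by (cases m) (auto simp: climb_upto_def)
  then show ?case by simp
next
  case (Suc k)
  have k: "k < n + 2" using Suc.prems(2) by simp
  have e: "supp (jets n UNIV False) (climb1 n k X)" using climb1_supp[OF k Suc.prems(1)] .
  have z: "ceq n ((climb_upto n k ^^ m) X) 0" if "m > k" for m
    using Suc.IH[OF Suc.prems(1)] k that by simp
  have ze: "ceq n ((climb_upto n k ^^ m) (climb1 n k X)) 0" if "m > k" for m
    using Suc.IH[OF e] k that by simp
  have "ceq n ((climb_upto n (Suc k) ^^ m) X) 0" if m: "m > Suc k" for m
  proof -
    have "ceq n ((climb_upto n (Suc k) ^^ m) X)
      ((climb_upto n k ^^ m) X + of_nat m \<odot> (climb_upto n k ^^ (m - 1)) (climb1 n k X))"
      by (rule climb_upto_Suc_funpow[OF Suc.prems(1) k])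
    also have "ceq n \<dots> (0 + of_nat m \<odot> 0)"
      using m by (intro ceq_add ceq_smul z ze) auto
    finally show ?thesis by simp
  qed
  moreover have "ceq n ((climb_upto n (Suc k) ^^ Suc k) X) (fact (Suc k) \<odot> foldr (climb1 n) [0..<Suc k] X)"
  proof -
    have "ceq n ((climb_upto n (Suc k) ^^ Suc k) X)
      ((climb_upto n k ^^ Suc k) X + of_nat (Suc k) \<odot> (climb_upto n k ^^ (Suc k - 1)) (climb1 n k X))"
      by (rule climb_upto_Suc_funpow[OF Suc.prems(1) k])
    also have "ceq n \<dots> (0 + of_nat (Suc k) \<odot> fact k \<odot> foldr (climb1 n) [0..<k] (climb1 n k X))"
      using Suc.IH[OF e] k by (intro ceq_add ceq_smul z) auto
    finally show ?thesis by (simp add: algebra_simps)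
  qed
  ultimately show ?case by blast
qed

lemma climb_climb_upto: "climb n X = (-1) \<odot> climb_upto n (n + 2) X"
  by (simp add: climb_def climb_upto_def climb1_def)

lemma gder_climb: "gder n 0 (climb n)"
  unfolding climb_climb_upto by (intro gder_scale gder_climb_upto)

lemma climb_funpow: "(climb n ^^ m) X = (-1) ^ m \<odot> (climb_upto n (n + 2) ^^ m) X"
  by (induction m) (simp_all add: climb_climb_upto gder_smul[OF gder_climb_upto])

text \<open>After the differentials are split off, each supersymmetry operator is paired with its
  own dx, and the product of these pairs is a power of the climbing operator divided by (n+2)!, up
  to sign.\<close>

lemma foldr_WS_top:
  assumes X: "supp (jets n UNIV False) X" "gr fdeg (int n + 2) X"
  shows "\<exists>s. ceq n (foldr (WS n) [0..<n+2] X) (s \<odot> (climb n ^^ (n+2)) (foldr (contract n) [0..<n+2] X))"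
proof -
  let ?xs = "[0..<n+2]" and ?Y = "foldr (contract n) [0..<n+2] X"
  have Y: "supp (jets n UNIV False) ?Y" by (rule foldr_supp[OF contract_supp X(1)])
  obtain r where r: "ceq n X (r \<odot> foldr (\<lambda>\<nu> Y. dx \<nu> * Y) ?xs ?Y)"
    using strip_dx[OF X, of ?xs] by (auto simp: lessThan_atLeast0)
  obtain s where s: "ceq n (foldr (WS n) ?xs (foldr (\<lambda>\<nu> Y. dx \<nu> * Y) ?xs ?Y)) (s \<odot> foldr (climb1 n) ?xs ?Y)"
    using foldr_WS_foldr_dx by blast
  have lin: "foldr (WS n) xs (z \<odot> Z) = z \<odot> foldr (WS n) xs Z" for xs z and Z :: "'a alg"
    by (induction xs) (simp_all add: gder_smul[OF gder_WS])
  have cq: "ceq n W Z \<Longrightarrow> ceq n (foldr (WS n) xs W) (foldr (WS n) xs Z)" for xs and W Z :: "'a alg"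
    by (induction xs) (auto intro: gder_ceq[OF gder_WS])
  have "ceq n (foldr (WS n) ?xs X) (foldr (WS n) ?xs (r \<odot> foldr (\<lambda>\<nu> Y. dx \<nu> * Y) ?xs ?Y))"
    by (rule cq[OF r])
  also have "ceq n \<dots> (r \<odot> s \<odot> foldr (climb1 n) ?xs ?Y)"
    unfolding lin by (rule ceq_smul[OF s])
  also have "ceq n \<dots> (r \<odot> s \<odot> inverse (fact (n+2)) \<odot> (climb_upto n (n+2) ^^ (n+2)) ?Y)"
    using ceq_sym[OF ceq_smul[OF climb_upto_power[OF Y order_refl, THEN conjunct2], of "inverse (fact (n+2))"]]
    by (intro ceq_smul) simp
  also have "\<dots> = (r * s * inverse (fact (n+2)) * (-1) ^ (n+2)) \<odot> (climb n ^^ (n+2)) ?Y"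
    by (simp add: climb_funpow flip: power_add mult_2)
  finally show ?thesis by blast
qed

section \<open>Constant shifts of the second ladder\<close>

lemma opG_value_gr:
  "gr (tot n) (ldeg n A + (- int n)) (if A = Phi2 \<and> p = 0 \<and> b = a then 1 else 0 :: 'a alg)"
  by (simp add: ldeg_def)

lemma gder_opG: "gder n (- int n) (opG n a)"
  unfolding opG_def by (rule gder_field_derivation[OF opG_value_gr]) simp

lemma opG_feq: "functional_eq n X Y \<Longrightarrow> functional_eq n (opG n a X) (opG n a Y)"
  unfolding opG_def by (rule field_derivation_feq[OF opG_value_gr]) simp_all

lemma opG_supp: "supp (jets n As b) X \<Longrightarrow> supp (jets n As b) (opG n a X)"
  unfolding opG_def by (rule field_derivation_supp) auto

lemma fold_partial_1: "fold (partial n) (sorted_list_of_multiset J) 1 = (if J = {#} then 1 else 0)"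
  by (induction J) (simp_all add: fold_partial_insort partial_1 gder_0[OF gder_partial])

lemma opG_Fld:
  assumes "finite I"
  shows "opG n a (gen (Fld A b I J)) = (if A = Phi2 \<and> b = a \<and> I = {} \<and> J = {#} then 1 else 0)"
  using assms
  by (auto simp: opG_def field_derivation_gen form_comp_def fold_partial_1 koszul_def
      module_hom.zero[OF clin_fold_partial] module_hom.zero[OF clin_fold_contract])

lemma opG_Dx: "opG n a (dx \<mu>) = 0"
  by (simp add: opG_def field_derivation_gen)

text \<open>Both orders vanish on generators: the shift sees only components with empty form index,
  which \<open>WS\<close> never produces, and \<open>WS\<close> annihilates the constants that the
  shift produces.\<close>

lemma opG_WS:
  assumes X: "supp (jets n UNIV False) X"
  shows "ceq n (opG n a (WS n \<mu> X)) ((-1) ^ n \<odot> WS n \<mu> (opG n a X))"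
proof -
  have "ceq n (opG n a (WS n \<mu> X)) (sg (- int n) (-1) \<odot> WS n \<mu> (opG n a X))"
  proof (rule gder_commute[OF gder_opG gder_WS _ X])
    fix x :: "'a gen" assume x: "x \<in> jets n UNIV False"
    show "ceq n (opG n a (WS n \<mu> (gen x))) (sg (- int n) (-1) \<odot> WS n \<mu> (opG n a (gen x)))"
    proof (cases x)
      case (Fld A b I J)
      with x have I: "I \<subseteq> {..<n+2}" by simp
      then have fin: "finite I" "finite (insert \<mu> I)" using finite_subset[of I "{..<n+2}"] by auto
      have "ceq n (opG n a (WS n \<mu> (gen x))) 0"
        using gder_ceq[OF gder_opG WS_Fld[OF I, of \<mu> A b J], of a]
        by (auto simp: Fld gder_smul[OF gder_opG] gder_0[OF gder_opG] opG_Fld[OF fin(2)] split: if_splits)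
      moreover have "ceq n (WS n \<mu> (opG n a (gen x))) 0"
        using gder_1[OF gder_WS] by (auto simp: Fld opG_Fld[OF fin(1)] gder_0[OF gder_WS])
      from ceq_smul[OF this, of "sg (- int n) (-1)"]
      have "ceq n 0 (sg (- int n) (-1) \<odot> WS n \<mu> (opG n a (gen x)))" by (simp add: ceq_sym)
      ultimately show ?thesis by (rule ceq_trans)
    qed (use x in \<open>simp_all add: opG_Dx gder_0[OF gder_opG] gder_0[OF gder_WS]\<close>)
  qed
  then show ?thesis by (simp add: sg_def koszul_def split: if_splits)
qed

lemma opG_foldr_WS:
  assumes X: "supp (jets n UNIV False) X"
  shows "\<exists>s. s \<noteq> 0 \<and> ceq n (opG n a (foldr (WS n) xs X)) (s \<odot> foldr (WS n) xs (opG n a X))"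
proof (induction xs)
  case (Cons x xs)
  then obtain s where s: "s \<noteq> 0" "ceq n (opG n a (foldr (WS n) xs X)) (s \<odot> foldr (WS n) xs (opG n a X))"
    by blast
  have "ceq n (opG n a (WS n x (foldr (WS n) xs X))) ((-1) ^ n \<odot> WS n x (opG n a (foldr (WS n) xs X)))"
    by (intro opG_WS foldr_supp[OF WS_supp] X)
  also have "ceq n \<dots> ((-1) ^ n \<odot> WS n x (s \<odot> foldr (WS n) xs (opG n a X)))"
    by (intro ceq_smul gder_ceq[OF gder_WS] s(2))
  finally show ?case using s(1)
    by (intro exI[of _ "(-1) ^ n * s"]) (simp add: gder_smul[OF gder_WS])
qed (auto intro: exI[of _ 1])

text \<open>The generators of dimension zero in a density: differentials and the 0-forms c and B
  without derivatives.\<close>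

definition zjets :: "nat \<Rightarrow> 'a gen set"
  where "zjets n = {x. case x of Dx \<mu> \<Rightarrow> \<mu> < n + 2 | Fld A a I J \<Rightarrow> I = {} \<and> J = {#} | _ \<Rightarrow> False}"

lemma zjets_simps [simp]:
  "Dx \<mu> \<in> zjets n \<longleftrightarrow> \<mu> < n + 2" "Fld A a I J \<in> zjets n \<longleftrightarrow> I = {} \<and> J = {#}"
  "Xi \<mu> \<notin> zjets n" "Eps \<mu> \<notin> zjets n" "U a \<notin> zjets n" "V a \<notin> zjets n"
  by (simp_all add: zjets_def)

lemma zjets_jets: "zjets n \<subseteq> jets n UNIV False"
proof
  fix x :: "'a gen" assume "x \<in> zjets n" then show "x \<in> jets n UNIV False" by (cases x) auto
qed

lemma derivation_zero:
  assumes "\<And>x. x \<in> S \<Longrightarrow> f x = 0" "supp S X"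
  shows "derivation n s f X = 0"
proof -
  have "set w \<subseteq> S \<Longrightarrow> der_word n s f w = 0" for w
    using assms(1) by (induction w) auto
  with assms(2) show ?thesis
    unfolding derivation_word_ext word_ext_def by (intro sum.neutral) (auto simp: supp_def)
qed

lemma desc_zjets: "supp (zjets n) X \<Longrightarrow> desc n \<mu> X = 0"
  unfolding desc_def by (rule derivation_zero[where S = "zjets n"]) (auto split: gen.split)

lemma gr_zero_supp:
  assumes "\<And>x. x \<in> S \<Longrightarrow> \<nu> x = 0" "supp S X" shows "gr \<nu> 0 X"
proof -
  have "set w \<subseteq> S \<Longrightarrow> sum_list (map \<nu> w) = 0" for w
    using assms(1) by (induction w) auto
  with assms(2) show ?thesis by (auto simp: gr_def supp_def)
qed

lemma field_derivation_derivation_gen: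
  "field_derivation n s R = derivation n s (\<lambda>x. field_derivation n s R (gen x))"
  by (simp only: field_derivation_gen, simp only: field_derivation_def smul_def)

lemma opG_derivation: "opG n a = derivation n (odd n) (\<lambda>x. opG n a (gen x))"
  unfolding opG_def by (rule field_derivation_derivation_gen)

lemma opG_zjets:
  assumes "x \<in> zjets n"
  shows "opG n a (gen x) = (if x = Fld Phi2 a {} {#} then 1 else 0)"
  using assms by (cases x) (auto simp: opG_Dx opG_Fld)

definition nB :: "'a gen \<Rightarrow> int"
  where "nB x = (if \<exists>a. x = Fld Phi2 a {} {#} then 1 else 0)"

text \<open>The Euler operator of B: multiplying the derivative by the variable counts its
  occurrences.\<close>

lemma opG_Euler:
  fixes X :: "'a::finite alg"
  assumes X: "supp (zjets n) X"
  shows "ceq n (\<Sum>a\<in>UNIV. gen (Fld Phi2 a {} {#}) * opG n a X) (wt nB of_int X)"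
proof -
  let ?D = "derivation n False (\<lambda>x. if \<exists>a. x = Fld Phi2 a {} {#} then gen x else (0 :: 'a alg))"
  have "gder n (int n + - int n) (\<lambda>X. \<Sum>a\<in>UNIV. gen (Fld Phi2 a {} {#}) * opG n a X)"
    by (intro gder_Sum gder_lmult gder_opG) (simp add: ldeg_def)
  moreover have "gder n (int n + - int n) ?D" by (intro gder_derivation) auto
  ultimately have "ceq n (\<Sum>a\<in>UNIV. gen (Fld Phi2 a {} {#}) * opG n a X) (?D X)"
  proof (rule gder_cong[OF _ _ _ X])
    fix x :: "'a gen" assume x: "x \<in> zjets n"
    have "(\<Sum>a\<in>UNIV. gen (Fld Phi2 a {} {#}) * opG n a (gen x)) =
      (\<Sum>a\<in>UNIV. if x = Fld Phi2 a {} {#} then gen x else 0)"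
      by (intro sum.cong) (auto simp: opG_zjets[OF x])
    also have "\<dots> = ?D (gen x)"
    proof (cases "\<exists>a. x = Fld Phi2 a {} {#}")
      case True
      then obtain b where "x = Fld Phi2 b {} {#}" by blast
      then show ?thesis by (simp add: mon_Nil)
    qed auto
    finally show "ceq n (\<Sum>a\<in>UNIV. gen (Fld Phi2 a {} {#}) * opG n a (gen x)) (?D (gen x))" by simp
  qed
  then show ?thesis unfolding count_derivation nB_def .
qed

text \<open>The shift is pushed inside the product of \<open>WS\<close>, and
  \<open>foldr_WS_injective\<close> turns invariance up to total derivatives into
  \<open>opG n a Q\<close> being congruent to zero. The Euler operator then leaves only the part
  without B.\<close>

lemma opG_invariant_reduction:
  fixes Q :: "'a::finite alg"
  assumes Q: "supp (zjets n) Q" and ghost: "gr (ghost n) m Q" "m > int n"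
    and inv: "\<And>a. functional_eq n (opG n a (foldr (WS n) [0..<n+2] Q)) 0"
  shows "ceq n Q (wt nB (\<lambda>k. if k = 0 then 1 else 0) Q)"
proof -
  have Q': "supp (jets n UNIV False) Q" using Q zjets_jets by (rule supp_mono)
  have "ceq n (opG n a Q) 0" for a
  proof (rule foldr_WS_injective)
    have z: "supp (zjets n) (opG n a Q)"
      by (subst opG_derivation, rule derivation_supp[OF _ Q]) (simp add: opG_zjets)
    show "ceq n (desc n \<mu> (opG n a Q)) 0" for \<mu> by (simp add: desc_zjets[OF z])
    show "supp (jets n UNIV False) (opG n a Q)" using z zjets_jets by (rule supp_mono)
    show "gr njet 0 (opG n a Q)"
    proof (rule gr_zero_supp[OF _ z])
      fix x :: "'a gen" assume "x \<in> zjets n" then show "njet x = 0" by (cases x) auto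
    qed
    obtain s where "s \<noteq> 0" and s: "ceq n (opG n a (foldr (WS n) [0..<n+2] Q)) (s \<odot> foldr (WS n) [0..<n+2] (opG n a Q))"
      using opG_foldr_WS[OF Q'] by blast
    from s inv have "functional_eq n (s \<odot> foldr (WS n) [0..<n+2] (opG n a Q)) 0"
      using feq_ceq_trans(2) ceq_sym by blast
    from feq_smul[OF this, of "inverse s"] \<open>s \<noteq> 0\<close>
    show "functional_eq n (foldr (WS n) [0..<n+2] (opG n a Q)) 0" by simp
    have "gr (ghost n) (m + (- int n)) (opG n a Q)"
      by (subst opG_derivation, rule derivation_gr[OF _ Q ghost(1)]) (auto simp: opG_zjets)
    then have gh: "gr (ghost n) (m - int n) (opG n a Q)" by simp
    \<comment> \<open>Without fields only differentials would remain, of ghost number 0, whereas the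
      shifted polynomial has ghost number m - n > 0.\<close>
    fix w assume w: "w \<in> Poly_Mapping.keys (opG n a Q)"
    show "\<exists>x\<in>set w. is_field x"
    proof (rule ccontr)
      assume *: "\<not> ?thesis"
      have "ghost n x = 0" if "x \<in> set w" for x
      proof -
        have "x \<in> zjets n" "\<not> is_field x" using that * w z by (auto simp: supp_def)
        then show ?thesis by (cases x) auto
      qed
      then have "sum_list (map (ghost n) w) = 0" by (induction w) auto
      with gh w ghost(2) show False by (auto simp: gr_def)
    qed
  qed
  then have "ceq n (\<Sum>a\<in>UNIV. gen (Fld Phi2 a {} {#}) * opG n a Q) (\<Sum>a\<in>UNIV. gen (Fld Phi2 a {} {#}) * 0)"
    by (intro ceq_sum ceq_mult ceq_refl)
  with opG_Euler[OF Q] have "ceq n (wt nB of_int Q) 0" by (auto intro: ceq_trans ceq_sym)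
  \<comment> \<open>Dividing by the number of B wherever it is nonzero turns the count into the
    projection on words that contain B.\<close>
  from wt_ceq[OF this, of nB "\<lambda>k. if k = 0 then 0 else inverse (of_int k)"]
  have *: "ceq n (wt nB (\<lambda>k. if k = 0 then 0 else 1) Q) 0"
    unfolding wt_wt_same wt_0 by (rule back_subst[of "\<lambda>X. ceq n X 0"]) (auto intro: wt_cong)
  have "Q = wt nB (\<lambda>k. if k = 0 then 0 else 1) Q + wt nB (\<lambda>k. if k = 0 then 1 else 0) Q"
  proof (rule clin_eqI[where F = "\<lambda>X. X"])
    show "clin (\<lambda>X :: 'a alg. X)" by (rule clinI) auto
    show "clin (\<lambda>X :: 'a alg. wt nB (\<lambda>k. if k = 0 then 0 else 1) X + wt nB (\<lambda>k. if k = 0 then 1 else 0) X)"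
      by (rule clinI) (simp_all add: wt_add wt_smul alg.scale_right_distrib)
  qed (simp add: wt_mon)
  with ceq_add[OF * ceq_refl[of n "wt nB (\<lambda>k. if k = 0 then 1 else 0) Q"]] show ?thesis by simp
qed

section \<open>Trace polynomials\<close>

type_synonym jet_index = "ladder \<times> nat set \<times> nat multiset"

definition tprod :: "('a::finite \<Rightarrow> complex^'m^'m) \<Rightarrow> jet_index list \<Rightarrow> 'a alg^'m^'m"
  where "tprod T xs = foldr (\<lambda>x M. jet_mat T x ** M) xs (mat 1)"

definition trace_atom :: "('a::finite \<Rightarrow> complex^'m^'m) \<Rightarrow> nat + jet_index list \<Rightarrow> 'a alg"
  where "trace_atom T t = (case t of Inl \<mu> \<Rightarrow> dx \<mu> | Inr xs \<Rightarrow> trace (tprod T xs))"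

definition trace_mon :: "('a::finite \<Rightarrow> complex^'m^'m) \<Rightarrow> (nat + jet_index list) list \<Rightarrow> 'a alg"
  where "trace_mon T ts = prod_list (map (trace_atom T) ts)"

text \<open>A linear description of trace polynomials, so that projections and derivations can be
  checked on monomials.\<close>

abbreviation trace_span :: "('a::finite \<Rightarrow> complex^'m^'m) \<Rightarrow> 'a alg set"
  where "trace_span T \<equiv> alg.span (range (trace_mon T))"

lemma tprod_Nil: "tprod T [] $ i $ j = (if i = j then 1 else 0)"
  by (simp add: tprod_def mat_def)

lemma tprod_Cons: "tprod T (x # xs) $ i $ j = (\<Sum>k\<in>UNIV. jet_mat T x $ i $ k * tprod T xs $ k $ j)"
  by (simp add: tprod_def matrix_matrix_mult_def)

lemma jet_mat_entry: "jet_mat T (A, I, J) $ i $ j = (\<Sum>a\<in>UNIV. T a $ i $ j \<odot> gen (Fld A a I J))"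
  by (simp add: jet_mat_def smul_def)

lemma trace_span_mult:
  assumes "X \<in> trace_span T" "Y \<in> trace_span T" shows "X * Y \<in> trace_span T"
  using assms(1)
proof (induction rule: alg.span_induct)
  case base
  show ?case
    by (rule alg.subspaceI) (auto simp: distrib_right alg.span_zero alg.span_add alg.span_scale)
next
  case (step X)
  then obtain xs where X: "X = trace_mon T xs" by auto
  show ?case
    using assms(2)
  proof (induction rule: alg.span_induct)
    case base
    show ?case
      by (rule alg.subspaceI) (auto simp: distrib_left alg.span_zero alg.span_add alg.span_scale)
  next
    case (step Y)
    then obtain ys where Y: "Y = trace_mon T ys" by auto
    have "X * Y = trace_mon T (xs @ ys)" by (simp add: X Y trace_mon_def)
    then show ?case by (auto intro: alg.span_base)
  qed
qed

lemma trace_atom_span: "trace_atom T t \<in> trace_span T"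
  by (rule alg.span_base) (auto intro!: image_eqI[of _ _ "[t]"] simp: trace_mon_def)

lemma trace_span_1: "1 \<in> trace_span T"
  by (rule alg.span_base) (auto intro!: image_eqI[of _ _ "[]"] simp: trace_mon_def)

lemma trace_poly_span: "X \<in> trace_poly T \<Longrightarrow> X \<in> trace_span T"
proof (induction rule: trace_poly.induct)
  case (const z)
  show ?case unfolding smul_1 by (intro alg.span_scale trace_span_1)
next
  case (form \<mu>)
  show ?case using trace_atom_span[of T "Inl \<mu>"] by (simp add: trace_atom_def)
next
  case (trace xs)
  show ?case using trace_atom_span[of T "Inr xs"] by (simp add: trace_atom_def tprod_def)
qed (auto intro: alg.span_add trace_span_mult)

definition atom_weight :: "(nat \<Rightarrow> int) \<Rightarrow> (jet_index \<Rightarrow> int) \<Rightarrow> nat + jet_index list \<Rightarrow> int"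
  where "atom_weight d f t = (case t of Inl \<mu> \<Rightarrow> d \<mu> | Inr xs \<Rightarrow> sum_list (map f xs))"

context
  fixes \<nu> :: "'a::finite gen \<Rightarrow> int" and f :: "jet_index \<Rightarrow> int" and d :: "nat \<Rightarrow> int"
  assumes \<nu>: "\<And>A a I J. \<nu> (Fld A a I J) = f (A, I, J)" "\<And>\<mu>. \<nu> (Dx \<mu>) = d \<mu>"
begin

lemma jet_mat_gr: "gr \<nu> (f x) (jet_mat T x $ i $ j)"
  by (cases x) (auto simp: jet_mat_entry \<nu> intro!: gr_sum gr_smul)

lemma tprod_gr: "gr \<nu> (sum_list (map f xs)) (tprod T xs $ i $ j)"
  by (induction xs arbitrary: i) (auto simp: tprod_Nil tprod_Cons intro!: gr_sum gr_mult jet_mat_gr)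

lemma trace_atom_gr: "gr \<nu> (atom_weight d f t) (trace_atom T t)"
  by (auto simp: trace_atom_def atom_weight_def \<nu> trace_def split: sum.split intro!: gr_sum tprod_gr)

lemma trace_mon_gr: "gr \<nu> (sum_list (map (atom_weight d f) ts)) (trace_mon T ts)"
  by (induction ts) (auto simp: trace_mon_def intro!: gr_mult trace_atom_gr)

text \<open>A weight that does not see the Lie algebra index is constant on each trace monomial and
  therefore only rescales it.\<close>

lemma trace_span_wt:
  assumes "X \<in> trace_span T" shows "wt \<nu> H X \<in> trace_span T"
  using assms
proof (induction rule: alg.span_induct)
  case base
  show ?case
    by (rule alg.subspaceI) (auto simp: wt_add wt_smul wt_0 alg.span_zero alg.span_add alg.span_scale)
next
  case (step X)
  then obtain ts where X: "X = trace_mon T ts" by auto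
  have "wt \<nu> H X = H (sum_list (map (atom_weight d f) ts)) \<odot> X"
    unfolding X by (rule wt_gr[OF trace_mon_gr])
  then show ?case by (simp add: X alg.span_scale alg.span_base)
qed

end

text \<open>A derivation that changes form and derivative indices uniformly in the Lie algebra index
  maps matrices of jets to multiples of such matrices, and so traces of products to sums of traces
  of products.\<close>

lemma trace_span_derivation:
  fixes T :: "'a::finite \<Rightarrow> complex^'m^'m"
  assumes D: "gder n e (derivation n s F)"
    and Dx: "\<And>\<mu>. F (Dx \<mu>) = cst (\<kappa> \<mu>)"
    and Fld: "\<And>A a I J. F (Fld A a I J) = z (A, I, J) \<odot> gen (case \<tau> (A, I, J) of (A', I', J') \<Rightarrow> Fld A' a I' J')"
    and X: "X \<in> trace_span T"
  shows "derivation n s F X \<in> trace_span T"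
proof -
  let ?D = "derivation n s F"
  define tw where "tw = (\<lambda>(A, I :: nat set, J :: nat multiset). ldeg n A - int (card I))"
  define dw where "dw = (\<lambda>\<mu> :: nat. 1 :: int)"
  have tot: "tot n (Fld A a I J) = tw (A, I, J)" "tot n (Dx \<mu> :: 'a gen) = dw \<mu>" for A and a :: 'a and I J \<mu>
    by (simp_all add: tw_def dw_def)
  have D1: "?D 1 = 0" using derivation_mon[of n s F "[]"] by (simp add: mon_Nil)
  have jet: "?D (jet_mat T x $ i $ j) = z x \<odot> jet_mat T (\<tau> x) $ i $ j" for x i j
    by (cases x; cases "\<tau> x")
      (simp add: jet_mat_entry module_hom.sum[OF clin_derivation] module_hom.scale[OF clin_derivation] mon_Nil
        Fld alg.scale_sum_right mult.commute)
  \<comment> \<open>\<open>L\<close> does not depend on the matrix entry, so that the trace can be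
    taken afterwards.\<close>
  have prod: "\<exists>L. \<forall>i j. ?D (tprod T xs $ i $ j) = (\<Sum>(w, ys)\<leftarrow>L. w \<odot> tprod T ys $ i $ j)" for xs
  proof (induction xs)
    case Nil
    show ?case by (intro exI[of _ "[]"]) (simp add: tprod_Nil D1 module_hom.zero[OF clin_derivation])
  next
    case (Cons x xs)
    then obtain L where L: "\<And>i j. ?D (tprod T xs $ i $ j) = (\<Sum>(w, ys)\<leftarrow>L. w \<odot> tprod T ys $ i $ j)" by blast
    let ?s = "koszul s (odd (tw x))"
    let ?L = "(z x, \<tau> x # xs) # map (\<lambda>(w, ys). (?s * w, x # ys)) L"
    have sum: "(\<Sum>k\<in>UNIV. jet_mat T x $ i $ k * (\<Sum>(w, ys)\<leftarrow>L. w \<odot> tprod T ys $ k $ j))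
      = (\<Sum>(w, ys)\<leftarrow>L. w \<odot> tprod T (x # ys) $ i $ j)" for i j
      by (induction L) (auto simp: distrib_left sum.distrib tprod_Cons alg.scale_sum_right)
    have sc: "?s \<odot> (\<Sum>(w, ys)\<leftarrow>L. w \<odot> G ys) = (\<Sum>(w, ys)\<leftarrow>map (\<lambda>(w, ys). (?s * w, x # ys)) L. w \<odot> G (tl ys))"
      for G :: "jet_index list \<Rightarrow> 'a alg"
      by (induction L) (auto simp: alg.scale_right_distrib)
    have "?D (tprod T (x # xs) $ i $ j) = (\<Sum>(w, ys)\<leftarrow>?L. w \<odot> tprod T ys $ i $ j)" for i j
    proof -
      have "?D (tprod T (x # xs) $ i $ j) =
         (\<Sum>k\<in>UNIV. z x \<odot> jet_mat T (\<tau> x) $ i $ k * tprod T xs $ k $ j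
           + ?s \<odot> (jet_mat T x $ i $ k * ?D (tprod T xs $ k $ j)))"
        unfolding tprod_Cons module_hom.sum[OF clin_derivation]
        by (subst derivation_mult[OF jet_mat_gr[OF tot]]) (simp add: jet)
      also have "\<dots> = z x \<odot> tprod T (\<tau> x # xs) $ i $ j + ?s \<odot> (\<Sum>(w, ys)\<leftarrow>L. w \<odot> tprod T (x # ys) $ i $ j)"
        unfolding sum.distrib L sum[symmetric] alg.scale_sum_right[symmetric] by (simp add: tprod_Cons alg.scale_sum_right)
      also have "\<dots> = (\<Sum>(w, ys)\<leftarrow>?L. w \<odot> tprod T ys $ i $ j)"
        unfolding sc by (simp add: comp_def case_prod_unfold)
      finally show ?thesis .
    qed
    then show ?case by blast
  qed
  have atom: "?D (trace_atom T t) \<in> trace_span T" for t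
  proof (cases t)
    case (Inl \<mu>)
    then show ?thesis by (simp add: trace_atom_def mon_Nil Dx smul_1 alg.span_scale trace_span_1)
  next
    case (Inr xs)
    from prod obtain L where L: "\<And>i j. ?D (tprod T xs $ i $ j) = (\<Sum>(w, ys)\<leftarrow>L. w \<odot> tprod T ys $ i $ j)" by blast
    have "?D (trace_atom T t) = (\<Sum>i\<in>UNIV. \<Sum>(w, ys)\<leftarrow>L. w \<odot> tprod T ys $ i $ i)"
      by (simp add: Inr trace_atom_def trace_def module_hom.sum[OF clin_derivation] L)
    also have "\<dots> = (\<Sum>(w, ys)\<leftarrow>L. w \<odot> trace_atom T (Inr ys))"
      by (induction L) (auto simp: sum.distrib trace_atom_def trace_def alg.scale_sum_right)
    also have "\<dots> \<in> trace_span T"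
      by (induction L) (auto intro!: alg.span_add alg.span_scale trace_atom_span alg.span_zero)
    finally show ?thesis .
  qed
  have mon: "?D (trace_mon T ts) \<in> trace_span T" for ts
  proof (induction ts)
    case Nil
    show ?case by (simp add: trace_mon_def D1 alg.span_zero)
  next
    case (Cons t ts)
    have "?D (trace_mon T (t # ts)) = ?D (trace_atom T t) * trace_mon T ts +
       koszul s (odd (atom_weight dw tw t)) \<odot> (trace_atom T t * ?D (trace_mon T ts))"
      using derivation_mult[OF trace_atom_gr[OF tot]] by (simp add: trace_mon_def)
    also have "\<dots> \<in> trace_span T"
      by (intro alg.span_add alg.span_scale trace_span_mult atom trace_atom_span Cons)
        (auto intro: alg.span_base)
    finally show ?case .
  qed
  show ?thesis
    using X
  proof (induction rule: alg.span_induct)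
    case base
    show ?case
      by (rule alg.subspaceI)
        (auto simp: module_hom.add[OF clin_derivation] module_hom.scale[OF clin_derivation]
          module_hom.zero[OF clin_derivation] alg.span_zero alg.span_add alg.span_scale)
  qed (auto simp: mon)
qed

lemma trace_span_desc: "X \<in> trace_span T \<Longrightarrow> desc n \<mu> X \<in> trace_span T"
  unfolding desc_def
  by (rule trace_span_derivation[where e = 1 and \<kappa> = "\<lambda>_. 0"
        and z = "\<lambda>(A, I, J). if \<mu> \<in> I \<and> I \<subseteq> {..<n+2} then sigma \<mu> (I - {\<mu>}) else 0"
        and \<tau> = "\<lambda>(A, I, J). (A, I - {\<mu>}, J)"])
     (auto simp: gder_desc[unfolded desc_def])

lemma trace_span_contract: "X \<in> trace_span T \<Longrightarrow> contract n \<mu> X \<in> trace_span T"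
  unfolding contract_def
  by (rule trace_span_derivation[where e = "-1" and \<kappa> = "\<lambda>\<nu>. if \<mu> = \<nu> then 1 else 0"
        and z = "\<lambda>_. 0" and \<tau> = "\<lambda>x. x"])
     (auto simp: gder_contract[unfolded contract_def])

section \<open>Powers of the ghost matrix\<close>

abbreviation c_index :: jet_index
  where "c_index \<equiv> (Phi1, {}, {#})"

abbreviation c_mat :: "('a::finite \<Rightarrow> complex^'m^'m) \<Rightarrow> 'a alg^'m^'m"
  where "c_mat T \<equiv> jet_mat T c_index"

lemma phi_mat_0: "phi_mat T n Phi1 0 = c_mat T"
proof -
  have "{I. I \<subseteq> {..<n+2} \<and> card I = 0} = {{}}"
    using finite_subset[of _ "{..<n+2}"] by auto
  then have "phi n Phi1 a 0 = gen (Fld Phi1 a {} {#})" for a :: 'a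
    by (simp add: phi_def mon_Nil)
  then show ?thesis by (simp add: phi_mat_def jet_mat_def)
qed

abbreviation mat_power :: "'a alg^'m^'m \<Rightarrow> nat \<Rightarrow> 'a alg^'m^'m"
  where "mat_power M k \<equiv> ((\<lambda>N. M ** N) ^^ k) (mat 1)"

lemma mat_power_tprod: "mat_power (jet_mat T x) k = tprod T (replicate k x)"
  by (induction k) (simp_all add: tprod_def)

lemma mat_power_Suc_right: "mat_power M (Suc k) = mat_power M k ** M"
proof (induction k)
  case (Suc k)
  have "mat_power M (Suc (Suc k)) = M ** (mat_power M k ** M)" using Suc by simp
  then show ?case by (simp add: matrix_mul_assoc)
qed simp

lemma mat_power_gr:
  assumes "\<And>i j. gr (tot n) 1 (M $ i $ j)" shows "gr (tot n) (int k) (mat_power M k $ i $ j)"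
proof (induction k arbitrary: i)
  case (Suc k)
  have "gr (tot n) (1 + int k) (\<Sum>l\<in>UNIV. M $ i $ l * mat_power M k $ l $ j)"
    by (intro gr_sum gr_mult assms Suc)
  then show ?case by (simp add: matrix_matrix_mult_def add.commute)
qed (simp add: mat_def)

text \<open>Cyclicity of the trace: one odd matrix is moved past the other k - 1, an odd number,
  which gives a minus sign.\<close>

lemma tr_power_even:
  assumes M: "\<And>i j. gr (tot n) 1 (M $ i $ j)" and k: "even k" "k > 0"
  shows "ceq n (tr_power M k) 0"
proof (rule ceq_neg_self)
  from k obtain l where l: "k = Suc l" "odd l" by (cases k) auto
  define P where "P = mat_power M l"
  have P: "gr (tot n) (int l) (P $ i $ j)" for i j unfolding P_def by (rule mat_power_gr[OF M])
  have t1: "tr_power M k = trace (M ** P)" by (simp add: tr_power_def l P_def)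
  have t2: "tr_power M k = trace (P ** M)"
    unfolding tr_power_def l(1) mat_power_Suc_right P_def ..
  have "tr_power M k = (\<Sum>i\<in>UNIV. \<Sum>j\<in>UNIV. M $ i $ j * P $ j $ i)"
    by (simp add: t1 trace_def matrix_matrix_mult_def)
  also have "ceq n \<dots> (\<Sum>i\<in>UNIV. \<Sum>j\<in>UNIV. sg 1 (int l) \<odot> (P $ j $ i * M $ i $ j))"
    by (intro ceq_sum supercommute M P)
  also have "\<dots> = - (\<Sum>j\<in>UNIV. \<Sum>i\<in>UNIV. P $ j $ i * M $ i $ j)"
    using l by (subst sum.swap) (simp add: sg_def koszul_def sum_negf)
  also have "\<dots> = - tr_power M k"
    unfolding t2 by (simp add: trace_def matrix_matrix_mult_def)
  finally show "ceq n (tr_power M k) (- tr_power M k)" .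
qed

lemma c_mat_gr: "gr (tot n) 1 (c_mat T $ i $ j)"
  by (auto simp: jet_mat_entry ldeg_def intro!: gr_sum gr_smul)

definition odd_parts :: "nat \<Rightarrow> nat list set"
  where "odd_parts m = {ks. sum_list ks = m \<and> (\<forall>k\<in>set ks. odd k)}"

text \<open>Odd parts are at least 1, so the length of a list is bounded by its sum.\<close>

lemma finite_odd_parts: "finite (odd_parts m)"
proof (rule finite_subset)
  have len: "length ks \<le> sum_list ks" if "\<forall>k\<in>set ks. odd k" for ks :: "nat list"
    using that by (induction ks) (auto elim: oddE)
  have "k \<le> sum_list ks" if "k \<in> set ks" for k and ks :: "nat list"
    using that by (rule member_le_sum_list) simp
  then show "odd_parts m \<subseteq> {ks. set ks \<subseteq> {..m} \<and> length ks \<le> m}"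
    using len by (auto simp: odd_parts_def)
qed (simp add: finite_lists_length_le)

definition c_power :: "('a::finite \<Rightarrow> complex^'m^'m) \<Rightarrow> nat list \<Rightarrow> 'a alg"
  where "c_power T ks = prod_list (map (tr_power (c_mat T)) ks)"

lemma of_nat_smul: "(of_nat k :: 'a alg) = of_nat k \<odot> 1"
  by (induction k) (simp_all add: alg.scale_left_distrib)

text \<open>Even positive powers have vanishing trace; a zeroth power contributes the scalar
  \<open>CARD('m)\<close> and is dropped without changing the sum.\<close>

lemma c_power_normal_form:
  fixes T :: "'a::finite \<Rightarrow> complex^'m::finite^'m"
  shows
  "\<exists>z. ceq n (c_power T ks) (\<Sum>ls\<in>odd_parts (sum_list ks). z ls \<odot> c_power T ls)"
proof (cases "\<exists>k\<in>set ks. even k \<and> k > 0")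
  case True
  then have "ceq n (c_power T ks) 0"
  proof (induction ks)
    case (Cons k ks)
    show ?case
    proof (cases "even k \<and> k > 0")
      case True
      then have "ceq n (tr_power (c_mat T) k * c_power T ks) (0 * c_power T ks)"
        by (intro ceq_mult ceq_refl tr_power_even c_mat_gr) auto
      then show ?thesis by (simp add: c_power_def)
    next
      case False
      then have "ceq n (tr_power (c_mat T) k * c_power T ks) (tr_power (c_mat T) k * 0)"
        using Cons by (intro ceq_mult ceq_refl) auto
      then show ?thesis by (simp add: c_power_def)
    qed
  qed simp
  then show ?thesis by (intro exI[of _ "\<lambda>_. 0"]) simp
next
  case False
  let ?ls = "filter odd ks"
  have tr0: "tr_power (c_mat T) 0 = of_nat CARD('m) \<odot> 1"
    by (simp add: tr_power_def trace_I of_nat_smul)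
  have "\<exists>r. c_power T ks = r \<odot> c_power T ?ls \<and> sum_list ?ls = sum_list ks"
    using False
  proof (induction ks)
    case (Cons k ks)
    then obtain r where r: "c_power T ks = r \<odot> c_power T (filter odd ks)" "sum_list (filter odd ks) = sum_list ks"
      by auto
    show ?case
    proof (cases "odd k")
      case True
      then show ?thesis using r by (intro exI[of _ r]) (simp add: c_power_def)
    next
      case False
      with Cons.prems have "k = 0" by auto
      then show ?thesis using r tr0
        by (intro exI[of _ "of_nat CARD('m) * r"]) (simp add: c_power_def)
    qed
  qed (auto simp: c_power_def intro!: exI[of _ 1])
  then obtain r where r: "c_power T ks = r \<odot> c_power T ?ls" and sum: "sum_list ?ls = sum_list ks" by blast
  have "?ls \<in> odd_parts (sum_list ks)" using sum by (auto simp: odd_parts_def)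
  then have "(\<Sum>ls\<in>odd_parts (sum_list ks). (if ls = ?ls then r else 0) \<odot> c_power T ls) = r \<odot> c_power T ?ls"
    by (subst sum.remove[OF finite_odd_parts]) auto
  then show ?thesis
    by (intro exI[of _ "\<lambda>ls. if ls = ?ls then r else 0"]) (simp only: r ceq_refl)
qed

definition c_gens :: "'a gen set"
  where "c_gens = {Fld Phi1 a {} {#} | a. True}"

text \<open>A polynomial in c alone might be presented by trace monomials with other fields that
  cancel in the sum. The projection \<open>P\<close> fixes \<open>Q\<close> and discards these
  monomials, leaving products of traces of powers of c.\<close>

lemma trace_normal_form:
  fixes T :: "'a::finite \<Rightarrow> complex^'m^'m"
  assumes Q: "Q \<in> trace_span T" "supp c_gens Q" "gr nfld (int m) Q"
  shows "\<exists>z. ceq n Q (\<Sum>ks\<in>odd_parts m. z ks \<odot> c_power T ks)"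
proof -
  define \<nu> :: "'a gen \<Rightarrow> int" where "\<nu> = (\<lambda>x. if x \<in> c_gens then 0 else 1)"
  define f where "f = (\<lambda>x :: jet_index. if x = c_index then 0 else 1 :: int)"
  have \<nu>: "\<nu> (Fld A a I J) = f (A, I, J)" "\<nu> (Dx \<mu>) = (\<lambda>_. 1) \<mu>" for A a I J \<mu>
    by (auto simp: \<nu>_def f_def c_gens_def)
  have nf: "nfld (Fld A a I J) = (\<lambda>_ :: jet_index. 1) (A, I, J)" "nfld (Dx \<mu> :: 'a gen) = (\<lambda>_. 0) \<mu>"
    for A I J \<mu> and a :: 'a by auto
  define P where "P = (\<lambda>X :: 'a alg. wt \<nu> (\<lambda>k. if k = 0 then 1 else 0) (wt nfld (\<lambda>k. if k = int m then 1 else 0) X))"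
  have Plin: "P (X + Y) = P X + P Y" "P (z \<odot> X) = z \<odot> P X" for X Y z
    by (simp_all add: P_def wt_add wt_smul)
  have "\<exists>z. ceq n (P Q) (\<Sum>ks\<in>odd_parts m. z ks \<odot> c_power T ks)"
    using Q(1)
  proof (induction rule: alg.span_induct)
    case base
    show ?case
    proof (rule alg.subspaceI; clarsimp)
      show "\<exists>z. ceq n (P 0) (\<Sum>ks\<in>odd_parts m. z ks \<odot> c_power T ks)"
        by (rule exI[of _ "\<lambda>_. 0"]) (simp add: P_def wt_0)
    next
      fix X Y y z
      assume "ceq n (P X) (\<Sum>ks\<in>odd_parts m. y ks \<odot> c_power T ks)"
        "ceq n (P Y) (\<Sum>ks\<in>odd_parts m. z ks \<odot> c_power T ks)"
      from ceq_add[OF this] show "\<exists>z. ceq n (P (X + Y)) (\<Sum>ks\<in>odd_parts m. z ks \<odot> c_power T ks)"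
        by (intro exI[of _ "\<lambda>ks. y ks + z ks"]) (simp add: Plin alg.scale_left_distrib sum.distrib)
    next
      fix X y z
      assume "ceq n (P X) (\<Sum>ks\<in>odd_parts m. z ks \<odot> c_power T ks)"
      from ceq_smul[OF this, of y] show "\<exists>z. ceq n (P (y \<odot> X)) (\<Sum>ks\<in>odd_parts m. z ks \<odot> c_power T ks)"
        by (intro exI[of _ "\<lambda>ks. y * z ks"]) (simp add: Plin alg.scale_sum_right)
    qed
  next
    case (step X)
    then obtain ts where X: "X = trace_mon T ts" by auto
    let ?w = "sum_list (map (atom_weight (\<lambda>_. 1) f) ts)" and ?l = "sum_list (map (atom_weight (\<lambda>_. 0) (\<lambda>_. 1)) ts)"
    have PX: "P X = (if ?w = 0 then 1 else 0) \<odot> (if ?l = int m then 1 else 0) \<odot> X"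
      unfolding P_def X wt_gr[OF trace_mon_gr[of nfld, OF nf]] wt_smul wt_gr[OF trace_mon_gr[of \<nu>, OF \<nu>]]
      by (simp add: mult.commute)
    show ?case
    proof (cases "?w = 0 \<and> ?l = int m")
      case False
      then have "P X = 0" unfolding PX by auto
      then show ?thesis by (intro exI[of _ "\<lambda>_. 0"]) simp
    next
      case True
      have nonneg: "atom_weight (\<lambda>_. 1) f t \<ge> 0" for t
        by (auto simp: atom_weight_def f_def split: sum.split intro!: sum_list_nonneg)
      have t0: "atom_weight (\<lambda>_. 1) f t = 0" if "t \<in> set ts" for t
        using True that nonneg by (subst (asm) sum_list_nonneg_eq_0_iff) auto
      have rep: "\<exists>k. t = Inr (replicate k c_index)" if "t \<in> set ts" for t
      proof (cases t)
        case (Inl \<mu>)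
        with t0[OF that] show ?thesis by (simp add: atom_weight_def)
      next
        case (Inr xs)
        with t0[OF that] have "sum_list (map f xs) = 0" by (simp add: atom_weight_def)
        then have "\<forall>x\<in>set xs. f x = 0" by (subst (asm) sum_list_nonneg_eq_0_iff) (auto simp: f_def)
        then have "\<forall>x\<in>set xs. x = c_index" by (auto simp: f_def split: if_splits)
        then have "xs = replicate (length xs) c_index" by (metis replicate_length_same)
        with Inr show ?thesis by blast
      qed
      define len where "len = (\<lambda>t :: nat + jet_index list. length (projr t))"
      have "trace_mon T ts = c_power T (map len ts) \<and> ?l = int (sum_list (map len ts))"
        using rep
      proof (induction ts)
        case (Cons t ts)
        then obtain k where t: "t = Inr (replicate k c_index)" by auto
        with Cons show ?case
          by (auto simp: trace_mon_def c_power_def trace_atom_def tr_power_def mat_power_tprod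
              len_def atom_weight_def sum_list_replicate)
      qed (simp add: trace_mon_def c_power_def)
      then have "P X = c_power T (map len ts)" "sum_list (map len ts) = m"
        using True unfolding PX by (auto simp: X)
      with c_power_normal_form[of n T "map len ts"] show ?thesis by simp
    qed
  qed
  moreover have "P Q = Q"
  proof -
    have "gr \<nu> 0 Q" using Q(2) by (intro gr_zero_supp) (auto simp: \<nu>_def)
    then show ?thesis unfolding P_def wt_gr[OF Q(3)] by (simp add: wt_gr)
  qed
  ultimately show ?thesis by simp
qed

section \<open>Invariant functionals\<close>

lemma foldr_gr:
  assumes "\<And>\<mu> k X. \<mu> \<in> set xs \<Longrightarrow> gr \<nu> k X \<Longrightarrow> gr \<nu> (k + e) (F \<mu> X)" "gr \<nu> k X"
  shows "gr \<nu> (k + e * int (length xs)) (foldr F xs X)"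
  using assms(1)
proof (induction xs)
  case (Cons x xs)
  then have "gr \<nu> ((k + e * int (length xs)) + e) (F x (foldr F xs X))" by (intro Cons.prems) auto
  then show ?case by (simp add: algebra_simps)
qed (simp add: assms(2))

lemma gr_0_supp:
  assumes "\<And>x. x \<in> S \<Longrightarrow> \<nu> x \<ge> 0" "supp S X" "gr \<nu> 0 X"
  shows "supp {x \<in> S. \<nu> x = 0} X"
  unfolding supp_def
proof (intro ballI subsetI)
  fix w x assume w: "w \<in> Poly_Mapping.keys X" and x: "x \<in> set w"
  then have S: "set w \<subseteq> S" and s: "sum_list (map \<nu> w) = 0" using assms by (auto simp: supp_def gr_def)
  then have "\<forall>y\<in>set (map \<nu> w). y = 0"
    using assms(1) by (subst (asm) sum_list_nonneg_eq_0_iff) auto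
  with x S show "x \<in> {x \<in> S. \<nu> x = 0}" by auto
qed

text \<open>Stated for general \<open>g\<close>, for counterterms (g = 0) and for the functionals
  whose coboundary is taken (g = -1). Each \<open>desc n \<mu>\<close> raises the ghost number by
  one, which explains m; positivity of g + 2 is what \<open>opG_invariant_reduction\<close>
  requires.\<close>

lemma invariant_functional:
  fixes T :: "'a::finite \<Rightarrow> complex^'m::finite^'m"
  assumes \<Delta>: "local_functional T n \<eta> g \<Delta>" and g: "g + 2 > 0" "int n + 2 + g = int m"
    and WS: "\<And>\<mu>. \<mu> < n + 2 \<Longrightarrow> functional_eq n (WS n \<mu> \<Delta>) 0"
    and G: "\<And>a. functional_eq n (opG n a \<Delta>) 0"
  shows "\<exists>z. functional_eq n \<Delta> (\<Sum>ks\<in>odd_parts m. z ks \<odot> counterterm T n ks)"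
proof -
  let ?xs = "[0..<n+2]"
  have sp: "supp (jets n UNIV False) \<Delta>"
    using \<Delta> by (simp add: local_functional_def ghost_free_jets)
  have fld: "\<And>w. w \<in> Poly_Mapping.keys \<Delta> \<Longrightarrow> \<exists>x\<in>set w. is_field x"
    using \<Delta> by (simp add: local_functional_def)
  have int_sum: "sum_list (map (\<lambda>x. int (h x)) w) = int (sum_list (map h w))" for h and w :: "'a gen list"
    by (induction w) auto
  have gr\<Delta>: "gr fdeg (int n + 2) \<Delta>" "gr (ghost n) g \<Delta>" "gr (\<lambda>x. int (dimension x)) (int n + 2) \<Delta>"
    using \<Delta> by (auto simp: gr_def local_functional_def int_sum)
  obtain s where s0: "s \<noteq> 0" and s: "functional_eq n \<Delta> (s \<odot> foldr (WS n) ?xs (wt nfld (ninv (n+2)) (foldr (desc n) ?xs \<Delta>)))"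
    using WS_invariant_representative[OF sp WS fld] by blast
  define Q0 where "Q0 = wt nfld (ninv (n+2)) (foldr (desc n) ?xs \<Delta>)"
  have g1: "gr fdeg (int n + 2 + 0 * int (length ?xs)) Q0"
    unfolding Q0_def by (intro wt_gr' foldr_gr desc_gr gr\<Delta>) auto
  have g2: "gr (ghost n) (g + 1 * int (length ?xs)) Q0"
    unfolding Q0_def
  proof (intro wt_gr' foldr_gr desc_gr gr\<Delta>)
    show "ghost n (Fld A a (I - {\<mu>}) J) = ghost n (Fld A a I J) + 1"
      if "\<mu> \<in> I" "I \<subseteq> {..<n+2}" for \<mu> A I J and a :: 'a
      using card_Diff_int[OF that] by (cases A) simp_all
  qed
  have g3: "gr (\<lambda>x. int (dimension x)) (int n + 2 + (-1) * int (length ?xs)) Q0"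
    unfolding Q0_def
  proof (intro wt_gr' foldr_gr desc_gr gr\<Delta>)
    show "int (dimension (Fld A a (I - {\<mu>}) J)) = int (dimension (Fld A a I J)) + (-1)"
      if "\<mu> \<in> I" "I \<subseteq> {..<n+2}" for \<mu> A I J and a :: 'a
      using card_Diff_int[OF that] by simp
  qed
  have "supp (jets n UNIV False) Q0"
    unfolding Q0_def by (intro wt_supp foldr_supp[OF desc_supp] sp)
  \<comment> \<open>Dimensions of generators are nonnegative, so total dimension 0 forces each
    letter to have dimension 0.\<close>
  from gr_0_supp[OF _ this, of "\<lambda>x. int (dimension x)"] g3
  have "supp {x \<in> jets n UNIV False. int (dimension x) = 0} Q0" by simp
  moreover have "{x :: 'a gen. x \<in> jets n UNIV False \<and> int (dimension x) = 0} \<subseteq> zjets n"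
  proof clarify
    fix x :: "'a gen" assume "x \<in> jets n UNIV False" "int (dimension x) = 0"
    then show "x \<in> zjets n"
    proof (cases x)
      case (Fld A a I J)
      with \<open>x \<in> jets n UNIV False\<close> have "finite I" using finite_subset[of I "{..<n+2}"] by simp
      moreover have "card I + size J = 0"
        using Fld \<open>int (dimension x) = 0\<close> of_nat_eq_0_iff[of "card I + size J", where 'a = int]
        by (simp del: of_nat_eq_0_iff of_nat_add)
      ultimately show ?thesis by (simp add: Fld)
    qed auto
  qed
  ultimately have Q0: "supp (zjets n) Q0" by (rule supp_mono)
  have Q0': "supp (jets n UNIV False) Q0" using Q0 zjets_jets by (rule supp_mono)
  have "\<Delta> \<in> trace_span T" using \<Delta> by (intro trace_poly_span) (simp add: local_functional_def)
  then have "foldr (desc n) xs \<Delta> \<in> trace_span T" for xs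
    by (induction xs) (auto intro: trace_span_desc)
  then have tr0: "Q0 \<in> trace_span T"
    unfolding Q0_def by (rule trace_span_wt[where f = "\<lambda>_. 1" and d = "\<lambda>_. 0", rotated 2]) simp_all
  have inv: "functional_eq n (opG n a (foldr (WS n) ?xs Q0)) 0" for a
  proof -
    have "functional_eq n (opG n a (s \<odot> foldr (WS n) ?xs Q0)) 0"
      using feq_trans[OF feq_sym[OF opG_feq[OF s]] G] by (simp add: Q0_def)
    from feq_smul[OF this, of "inverse s"] s0 show ?thesis by (simp add: gder_smul[OF gder_opG])
  qed
  define Q1 where "Q1 = wt nB (\<lambda>k. if k = 0 then 1 else 0) Q0"
  have Q01: "ceq n Q0 Q1"
    unfolding Q1_def by (rule opG_invariant_reduction[OF Q0 g2 _ inv]) (use g in simp)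
  have Q1: "supp (zjets n) Q1" and g1': "gr fdeg (int n + 2) Q1" and g2': "gr (ghost n) (int m) Q1"
    using g1 g2 Q0 g unfolding Q1_def by (auto intro!: wt_supp wt_gr' simp: algebra_simps)
  have Q1': "supp (jets n UNIV False) Q1" using Q1 zjets_jets by (rule supp_mono)
  have "gr nB 0 Q1"
    unfolding gr_def Q1_def by (auto simp: in_keys_iff lookup_wt split: if_splits)
  then have Q1B: "supp {x \<in> zjets n. nB x = 0} Q1"
    by (intro gr_0_supp[OF _ Q1]) (simp add: nB_def)
  have tr1: "Q1 \<in> trace_span T"
    unfolding Q1_def by (rule trace_span_wt[where f = "\<lambda>x. if x = (Phi2, {}, {#}) then 1 else 0" and d = "\<lambda>_. 0", OF _ _ tr0])
      (auto simp: nB_def)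
  \<comment> \<open>Up to sign the coefficient of the volume form in \<open>Q1\<close>.\<close>
  define Q where "Q = foldr (contract n) ?xs Q1"
  obtain r where r: "ceq n (foldr (WS n) ?xs Q1) (r \<odot> (climb n ^^ (n+2)) Q)"
    using foldr_WS_top[OF Q1' g1'] unfolding Q_def by blast
  have c: "gr \<nu> (k + e) (contract n \<mu> X)" if "\<And>\<mu>. \<nu> (Dx \<mu>) = - e" "gr \<nu> k X" for \<nu> k e \<mu> and X :: "'a alg"
    unfolding contract_def by (rule derivation_gr_UNIV) (use that in \<open>auto split: gen.split\<close>)
  have "gr fdeg (int n + 2 + (-1) * int (length ?xs)) Q" "gr (ghost n) (int m + 0 * int (length ?xs)) Q"
    unfolding Q_def by (intro foldr_gr c g1' g2'; simp)+
  then have gQ: "gr fdeg 0 Q" "gr (ghost n) (int m) Q" by simp_all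
  have "supp {x \<in> zjets n. nB x = 0} Q"
    unfolding Q_def by (intro foldr_supp[OF contract_supp] Q1B)
  from gr_0_supp[OF _ this gQ(1)] have "supp {x \<in> {x \<in> zjets n. nB x = 0}. fdeg x = 0} Q" by simp
  moreover have "{x \<in> {x \<in> zjets n. nB x = 0}. fdeg x = 0} \<subseteq> (c_gens :: 'a gen set)"
  proof clarify
    fix x :: "'a gen" assume x: "x \<in> zjets n" "nB x = 0" "fdeg x = 0"
    then show "x \<in> c_gens"
    proof (cases x)
      case (Fld A a I J)
      with x show ?thesis by (cases A) (auto simp: nB_def c_gens_def)
    qed auto
  qed
  ultimately have cQ: "supp c_gens Q" by (rule supp_mono)
  \<comment> \<open>With B and the differentials gone every letter is a c of ghost number 1, so
    ghost number counts fields.\<close>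
  have "gr nfld (int m) Q"
    unfolding gr_def
  proof
    fix w assume w: "w \<in> Poly_Mapping.keys Q"
    have "nfld x = ghost n x" if "x \<in> set w" for x
    proof -
      have "x \<in> c_gens" using that w cQ by (auto simp: supp_def)
      then show ?thesis by (auto simp: c_gens_def)
    qed
    then have "map nfld w = map (ghost n) w" by simp
    moreover have "sum_list (map (ghost n) w) = int m" using w gQ(2) by (simp add: gr_def)
    ultimately show "sum_list (map nfld w) = int m" by metis
  qed
  moreover have "foldr (contract n) xs Q1 \<in> trace_span T" for xs
    using tr1 by (induction xs) (auto intro: trace_span_contract)
  ultimately obtain z where z: "ceq n Q (\<Sum>ks\<in>odd_parts m. z ks \<odot> c_power T ks)"
    using trace_normal_form[OF _ cQ] unfolding Q_def by blast
  have ct: "(climb n ^^ (n+2)) (c_power T ks) = fact (n+2) \<odot> counterterm T n ks" for ks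
    by (simp add: counterterm_def phi_mat_0 c_power_def smul_def[symmetric])
  have lin: "(climb n ^^ k) (\<Sum>ks\<in>K. f ks) = (\<Sum>ks\<in>K. (climb n ^^ k) (f ks))" for k K and f :: "nat list \<Rightarrow> 'a alg"
    by (induction k) (simp_all add: gder_sum[OF gder_climb])
  have WScq: "ceq n W Z \<Longrightarrow> ceq n (foldr (WS n) xs W) (foldr (WS n) xs Z)" for xs and W Z :: "'a alg"
    by (induction xs) (auto intro: gder_ceq[OF gder_WS])
  have "functional_eq n \<Delta> (s \<odot> foldr (WS n) ?xs Q0)" using s by (simp add: Q0_def)
  also have "ceq n \<dots> (s \<odot> foldr (WS n) ?xs Q1)" by (intro ceq_smul WScq Q01)
  also have "ceq n (s \<odot> foldr (WS n) ?xs Q1) (s \<odot> r \<odot> (climb n ^^ (n+2)) Q)" by (intro ceq_smul r)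
  also have "ceq n (s \<odot> r \<odot> (climb n ^^ (n+2)) Q) (s \<odot> r \<odot> (climb n ^^ (n+2)) (\<Sum>ks\<in>odd_parts m. z ks \<odot> c_power T ks))"
    by (intro ceq_smul funpow_gder(1)[OF gder_climb] z)
  also have "s \<odot> r \<odot> (climb n ^^ (n+2)) (\<Sum>ks\<in>odd_parts m. z ks \<odot> c_power T ks)
     = (\<Sum>ks\<in>odd_parts m. (s * r * z ks * fact (n+2)) \<odot> counterterm T n ks)"
    unfolding lin funpow_gder(3)[OF gder_climb] ct by (simp add: alg.scale_sum_right mult.assoc)
  finally show ?thesis by (intro exI)
qed

section \<open>The BRS operator\<close>

lemma lie_comp_expand: "lie_comp T a M = (\<Sum>i\<in>UNIV. \<Sum>k\<in>UNIV. T a $ i $ k \<odot> M $ k $ i)"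
  by (simp add: lie_comp_def trace_def matrix_matrix_mult_def smul_def)

lemma lie_comp_gr: "(\<And>i j. gr \<nu> k (M $ i $ j)) \<Longrightarrow> gr \<nu> k (lie_comp T a M)"
  unfolding lie_comp_expand by (intro gr_sum gr_smul)

lemma lie_comp_supp: "(\<And>i j. supp S (M $ i $ j)) \<Longrightarrow> supp S (lie_comp T a M)"
  unfolding lie_comp_expand by (intro supp_sum supp_smul)

lemma lie_comp_clin: "clin F \<Longrightarrow> F (lie_comp T a M) = lie_comp T a (\<chi> i j. F (M $ i $ j))"
  by (simp add: lie_comp_expand module_hom.sum module_hom.scale)

lemma lie_comp_ceq: "(\<And>i j. ceq n (M $ i $ j) (N $ i $ j)) \<Longrightarrow> ceq n (lie_comp T a M) (lie_comp T a N)"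
  unfolding lie_comp_expand by (intro ceq_sum ceq_smul)

lemma lie_comp_add: "lie_comp T a (M + N) = lie_comp T a M + lie_comp T a N"
  by (simp add: lie_comp_expand alg.scale_right_distrib sum.distrib)

lemma phi_mat_expand: "phi_mat T n A p $ i $ j = (\<Sum>a\<in>UNIV. T a $ i $ j \<odot> phi n A a p)"
  by (simp add: phi_mat_def smul_def)

lemma phi_mat_gr: "gr (tot n) (ldeg n A) (phi_mat T n A p $ i $ j)"
  unfolding phi_mat_expand by (intro gr_sum gr_smul phi_gr)

lemma phi_mat_supp: "A \<in> As \<Longrightarrow> supp (jets n As b) (phi_mat T n A p $ i $ j)"
  unfolding phi_mat_expand by (intro supp_sum supp_smul phi_supp)

lemma d_prev_gr: "gr (tot n) (ldeg n A + 1) (d_prev T n A p $ i $ j)"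
  by (auto simp: d_prev_def intro!: gder_gr[OF gder_ext_d] phi_mat_gr)

lemma ext_d_supp: "supp (jets n As False) X \<Longrightarrow> supp (jets n As False) (ext_d n X)"
  unfolding ext_d_def
  by (rule derivation_supp) (auto split: gen.split intro!: supp_sum simp flip: mon_append)

lemma d_prev_supp: "A \<in> As \<Longrightarrow> supp (jets n As False) (d_prev T n A p $ i $ j)"
  by (auto simp: d_prev_def intro!: ext_d_supp phi_mat_supp)

lemma graded_comm_expand: "graded_comm s t X Y $ i $ j =
    (\<Sum>k\<in>UNIV. X $ i $ k * Y $ k $ j) - koszul s t \<odot> (\<Sum>k\<in>UNIV. Y $ i $ k * X $ k $ j)"
  by (simp add: graded_comm_def matrix_matrix_mult_def smul_def)

lemma graded_comm_gr:
  assumes X: "\<And>i j. gr \<nu> k (X $ i $ j)" and Y: "\<And>i j. gr \<nu> l (Y $ i $ j)"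
  shows "gr \<nu> (k + l) (graded_comm s t X Y $ i $ j)"
  unfolding graded_comm_expand
proof (intro gr_diff gr_smul gr_sum)
  show "gr \<nu> (k + l) (X $ i $ m * Y $ m $ j)" for m by (intro gr_mult X Y)
  show "gr \<nu> (k + l) (Y $ i $ m * X $ m $ j)" for m
    by (subst add.commute, intro gr_mult X Y)
qed

lemma graded_comm_supp:
  assumes X: "\<And>i j. supp S (X $ i $ j)" and Y: "\<And>i j. supp S (Y $ i $ j)"
  shows "supp S (graded_comm s t X Y $ i $ j)"
  unfolding graded_comm_expand by (intro supp_diff supp_smul supp_sum supp_mult X Y)

context
  fixes T :: "'a::finite \<Rightarrow> complex^'m::finite^'m" and n :: nat
begin

definition BRS_value :: "ladder \<Rightarrow> 'a \<Rightarrow> nat \<Rightarrow> 'a alg"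
  where "BRS_value = (\<lambda>A a p. case A of
      Phi1 \<Rightarrow> lie_comp T a (d_prev T n Phi1 p) + cst (1/2) * lie_comp T a
        (\<Sum>q\<le>p. graded_comm True True (phi_mat T n Phi1 q) (phi_mat T n Phi1 (p - q)))
    | Phi2 \<Rightarrow> lie_comp T a (d_prev T n Phi2 p) + lie_comp T a
        (\<Sum>q\<le>p. graded_comm True (odd n) (phi_mat T n Phi1 q) (phi_mat T n Phi2 (p - q))))"

lemma BRS_value: "BRS T n = field_derivation n True BRS_value"
  unfolding BRS_def BRS_value_def ..

lemma BRS_value_gr: "gr (tot n) (ldeg n A + 1) (BRS_value A a p)"
proof -
  have g1: "gr (tot n) 1 (phi_mat T n Phi1 q $ i $ j)" for q i j
    using phi_mat_gr[of n Phi1 T q i j] by (simp add: ldeg_def)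
  have gA: "gr (tot n) (ldeg n A + 1) (lie_comp T a (\<Sum>q\<le>p. graded_comm True s (phi_mat T n Phi1 q) (phi_mat T n A (p - q))))" for A s
    by (subst add.commute, intro lie_comp_gr) (auto intro!: gr_sum graded_comm_gr g1 phi_mat_gr)
  show ?thesis
    by (cases A) (auto simp: BRS_value_def simp flip: smul_def simp del: sum_component
      intro!: gr_add gr_smul gA lie_comp_gr[OF d_prev_gr])
qed

lemma BRS_value_supp: "supp (jets n UNIV False) (BRS_value A a p)"
  by (cases A) (auto simp: BRS_value_def simp flip: smul_def
    intro!: supp_add supp_smul lie_comp_supp d_prev_supp supp_sum graded_comm_supp phi_mat_supp)

lemma gder_BRS: "gder n 1 (BRS T n)"
  unfolding BRS_value by (rule gder_field_derivation[OF BRS_value_gr]) simp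

lemma BRS_feq: "functional_eq n X Y \<Longrightarrow> functional_eq n (BRS T n X) (BRS T n Y)"
  unfolding BRS_value by (rule field_derivation_feq[OF BRS_value_gr]) simp_all

lemma BRS_supp: "supp (jets n UNIV False) X \<Longrightarrow> supp (jets n UNIV False) (BRS T n X)"
  unfolding BRS_value by (rule field_derivation_supp) (rule BRS_value_supp)

definition square_form :: "nat \<Rightarrow> 'a alg^'m^'m"
  where "square_form p = (\<Sum>q\<le>p. phi_mat T n Phi1 q ** phi_mat T n Phi1 (p - q))"

lemma square_form_expand: "square_form p $ i $ j =
    (\<Sum>q\<le>p. \<Sum>k\<in>UNIV. phi_mat T n Phi1 q $ i $ k * phi_mat T n Phi1 (p - q) $ k $ j)"
  by (simp add: square_form_def matrix_matrix_mult_def)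

text \<open>In the graded commutator of odd forms the second product is the first with q replaced by
  p - q, so the factor 1/2 leaves the plain square.\<close>

lemma BRS_value_Phi1: "BRS_value Phi1 a p = lie_comp T a (d_prev T n Phi1 p + square_form p)"
proof -
  let ?G = "\<Sum>q\<le>p. graded_comm True True (phi_mat T n Phi1 q) (phi_mat T n Phi1 (p - q))"
  have "?G $ i $ j = 2 \<odot> square_form p $ i $ j" for i j
  proof -
    have two: "2 \<odot> Y = Y + Y" for Y :: "'a alg" using alg.scale_left_distrib[of 1 1 Y] by simp
    have "?G $ i $ j = square_form p $ i $ j +
      (\<Sum>q\<le>p. \<Sum>k\<in>UNIV. phi_mat T n Phi1 (p - q) $ i $ k * phi_mat T n Phi1 q $ k $ j)"
      by (simp add: graded_comm_expand koszul_def square_form_expand sum.distrib)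
    also have "(\<Sum>q\<le>p. \<Sum>k\<in>UNIV. phi_mat T n Phi1 (p - q) $ i $ k * phi_mat T n Phi1 q $ k $ j) = square_form p $ i $ j"
      unfolding square_form_expand
      by (rule sum.reindex_bij_witness[of _ "\<lambda>q. p - q" "\<lambda>q. p - q"]) auto
    finally show ?thesis by (simp add: two)
  qed
  then have "lie_comp T a ?G = 2 \<odot> lie_comp T a (square_form p)"
    by (simp add: lie_comp_expand alg.scale_sum_right mult.commute)
  then show ?thesis by (simp add: BRS_value_def lie_comp_add flip: smul_def)
qed

lemma BRS_Phi1: "BRS T n (gen (Fld Phi1 a I {#})) =
    (-1) ^ card I \<odot> form_comp n I (BRS_value Phi1 a (card I))"
  by (simp add: BRS_value field_derivation_gen koszul_True)

end

lemma BRS_Dx [simp]: "BRS T n (dx \<mu>) = 0"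
  by (simp add: BRS_value field_derivation_gen)

section \<open>BRS variation of the ladder climbing operator\<close>

text \<open>The Lie derivative along a constant vector is the partial derivative. On a field
  component only the differential of direction \<mu> survives the contraction.\<close>

lemma Cartan_formula:
  fixes X :: "'a alg"
  assumes \<mu>: "\<mu> < n + 2"
  shows "ceq n (ext_d n (contract n \<mu> X)) (- contract n \<mu> (ext_d n X) + partial n \<mu> X)"
proof -
  have H: "gder n (1 + -1) (partial n \<mu> :: 'a alg \<Rightarrow> 'a alg)" using gder_partial by simp
  have "ceq n (ext_d n (contract n \<mu> X)) (sg 1 (-1) \<odot> contract n \<mu> (ext_d n X) + partial n \<mu> X)"
  proof (rule gder_commutator_eq[where S = UNIV, OF gder_ext_d gder_contract H])
    fix x :: "'a gen"
    show "ceq n (ext_d n (contract n \<mu> (gen x))) (sg 1 (-1) \<odot> contract n \<mu> (ext_d n (gen x)) + partial n \<mu> (gen x))"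
    proof (cases x)
      case (Fld A a I J)
      have "contract n \<mu> (ext_d n (gen x)) = (\<Sum>\<nu><n+2. if \<nu> = \<mu> then gen (Fld A a I (add_mset \<mu> J)) else 0)"
        by (auto simp: Fld ext_d_gen gder_sum[OF gder_contract] contract_dx_mult contract_Fld intro!: sum.cong)
      then show ?thesis using \<mu>
        by (simp add: Fld contract_Fld gder_0[OF gder_ext_d] partial_gen sg_def koszul_def)
    qed (use gder_1[OF gder_ext_d] in \<open>auto simp: contract_gen ext_d_gen partial_gen gder_0[OF gder_ext_d] gder_0[OF gder_contract]\<close>)
  qed simp
  then show ?thesis by (simp add: sg_def koszul_def)
qed

text \<open>A top form is closed, so Cartan's formula exhibits its translation as exact.\<close>

lemma partial_top_form:
  assumes X: "supp (jets n UNIV False) X" "gr fdeg (int n + 2) X" and \<mu>: "\<mu> < n + 2"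
  shows "functional_eq n (partial n \<mu> X) 0"
proof -
  have "gr fdeg (int n + 2 + 1) (ext_d n X)"
    unfolding ext_d_def
    by (rule derivation_gr_UNIV[OF _ X(2)]) (auto split: gen.split intro!: gr_sum simp flip: mon_append)
  then have "ceq n (ext_d n X) 0"
    by (rule form_degree_bound[OF ext_d_supp[OF X(1)]]) auto
  then have z: "ceq n (contract n \<mu> (ext_d n X)) 0" by (rule gder_ceq_0[OF gder_contract])
  have "ceq n (partial n \<mu> X + (- contract n \<mu> (ext_d n X))) (ext_d n (contract n \<mu> X))"
    using ceq_sym[OF Cartan_formula[OF \<mu>, of X]] by (simp add: add.commute)
  from ceq_add[OF this z] have "ceq n (partial n \<mu> X) (ext_d n (contract n \<mu> X))" by simp
  then show ?thesis using feq_ext_d feq_ceq_trans(2) by blast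
qed

lemma contract_partial: "ceq n (contract n \<mu> (partial n \<nu> X)) (partial n \<nu> (contract n \<mu> X))"
proof -
  have "ceq n (contract n \<mu> (partial n \<nu> X)) (sg (-1) 0 \<odot> partial n \<nu> (contract n \<mu> X))"
  proof (rule gder_commute[where S = UNIV, OF gder_contract gder_partial])
    fix x
    show "ceq n (contract n \<mu> (partial n \<nu> (gen x))) (sg (-1) 0 \<odot> partial n \<nu> (contract n \<mu> (gen x)))"
      by (cases x) (auto simp: contract_gen partial_gen gder_0[OF gder_contract] gder_0[OF gder_partial] partial_1)
  qed simp
  then show ?thesis by simp
qed

lemma form_comp_partial: "ceq n (form_comp n I (partial n \<nu> X)) (partial n \<nu> (form_comp n I X))"
proof -
  have "ceq n (fold (contract n) xs (partial n \<nu> X)) (partial n \<nu> (fold (contract n) xs X))" for xs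
  proof (induction xs arbitrary: X)
    case (Cons x xs)
    have "ceq n (fold (contract n) xs (contract n x (partial n \<nu> X))) (fold (contract n) xs (partial n \<nu> (contract n x X)))"
      by (intro fold_contract_ceq contract_partial)
    with Cons[of "contract n x X"] show ?case by (auto intro: ceq_trans)
  qed simp
  then show ?thesis by (simp add: form_comp_def)
qed

lemma WS_contract:
  assumes X: "supp (jets n UNIV False) X"
  shows "ceq n (WS n \<mu> (contract n \<nu> X)) (- contract n \<nu> (WS n \<mu> X))"
proof -
  have "ceq n (WS n \<mu> (contract n \<nu> X)) (sg (-1) (-1) \<odot> contract n \<nu> (WS n \<mu> X))"
  proof (rule gder_commute[OF gder_WS gder_contract _ X])
    fix x :: "'a gen" assume x: "x \<in> jets n UNIV False"
    show "ceq n (WS n \<mu> (contract n \<nu> (gen x))) (sg (-1) (-1) \<odot> contract n \<nu> (WS n \<mu> (gen x)))"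
    proof (cases x)
      case (Fld A a I J)
      with x have I: "I \<subseteq> {..<n+2}" by simp
      have "ceq n (contract n \<nu> (WS n \<mu> (gen x))) 0"
        using gder_ceq[OF gder_contract WS_Fld[OF I, of \<mu> A a J], of \<nu>]
        by (auto simp: Fld gder_smul[OF gder_contract] gder_0[OF gder_contract] contract_Fld split: if_splits)
      from ceq_sym[OF ceq_smul[OF this, of "sg (-1) (-1)"]]
      show ?thesis by (simp add: Fld contract_Fld gder_0[OF gder_WS])
    qed (use x gder_1[OF gder_WS] in \<open>auto simp: contract_gen gder_0[OF gder_WS] gder_0[OF gder_contract]\<close>)
  qed
  then show ?thesis by (simp add: sg_def koszul_def)
qed

lemma WS_form_comp:
  assumes X: "supp (jets n UNIV False) X"
  shows "ceq n (WS n \<mu> (form_comp n I X)) ((-1) ^ card I \<odot> form_comp n I (WS n \<mu> X))"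
proof -
  have "ceq n (WS n \<mu> (fold (contract n) xs X)) ((-1) ^ length xs \<odot> fold (contract n) xs (WS n \<mu> X))" for xs
    using X
  proof (induction xs arbitrary: X)
    case (Cons x xs)
    have "ceq n (WS n \<mu> (fold (contract n) xs (contract n x X))) ((-1) ^ length xs \<odot> fold (contract n) xs (WS n \<mu> (contract n x X)))"
      by (intro Cons.IH contract_supp Cons.prems)
    also have "ceq n \<dots> ((-1) ^ length xs \<odot> fold (contract n) xs (- contract n x (WS n \<mu> X)))"
      by (intro ceq_smul fold_contract_ceq WS_contract Cons.prems)
    finally show ?case by (simp add: module_hom.neg[OF clin_fold_contract])
  qed simp
  from this[of "sorted_list_of_set I"] show ?thesis by (simp add: form_comp_def)
qed

lemma contract_phi_term:
  assumes "finite I"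
  shows "contract n \<mu> (mon (map Dx (sorted_list_of_set I)) * gen (Fld A a I' J)) = (if \<mu> \<in> I then
    (-1) ^ below \<mu> I \<odot> (mon (map Dx (sorted_list_of_set (I - {\<mu>}))) * gen (Fld A a I' J)) else 0)"
  using assms
  by (auto simp: contract_Dx_in[OF contract_Fld] contract_Dx_notin[OF contract_Fld] length_filter_sorted_list
      sorted_list_of_set_remove)

text \<open>\<open>WS\<close> is implemented on components; this recovers its defining relation on
  forms. Inserting \<mu> matches the index sets of degree p without \<mu> with those of degree p + 1
  containing it.\<close>

lemma WS_phi:
  fixes a :: 'a
  assumes \<mu>: "\<mu> < n + 2"
  shows "ceq n (WS n \<mu> (phi n A a p)) (- contract n \<mu> (phi n A a (p + 1)))"
proof -
  let ?m = "\<lambda>I. mon (map Dx (sorted_list_of_set I)) :: 'a alg" and ?F = "\<lambda>I. gen (Fld A a I {#})"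
  let ?S = "\<lambda>p. {I. I \<subseteq> {..<n+2} \<and> card I = p}"
  have fin: "finite I" if "I \<in> ?S p" for I p using that finite_subset[of I "{..<n+2}"] by simp
  have finS: "finite (?S p)" for p by (rule finite_subset[of _ "Pow {..<n+2}"]) auto
  have mclosed: "WS n \<mu> (mon (map Dx xs) :: 'a alg) = 0" for xs
  proof -
    have "supp (range Dx) (mon (map Dx xs) :: 'a alg)" by auto
    then show ?thesis
      unfolding WS_def field_derivation_def by (rule derivation_zero[rotated]) auto
  qed
  have "WS n \<mu> (phi n A a p) = (\<Sum>I\<in>?S p. WS n \<mu> (?m I * ?F I))"
    unfolding phi_def by (rule gder_sum[OF gder_WS])
  also have "ceq n \<dots> (\<Sum>I\<in>?S p. sg (-1) (int p) \<odot> (?m I * (if \<mu> \<in> I then 0 else sigma \<mu> I \<odot> ?F (insert \<mu> I))))"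
  proof (rule ceq_sum)
    fix I assume I: "I \<in> ?S p"
    have "ceq n (WS n \<mu> (?m I * ?F I)) (sg (-1) (int p) \<odot> (?m I * WS n \<mu> (?F I)))"
      using I by (intro gder_mult_closed[OF gder_WS]) (auto simp: comp_def sum_list_triv mclosed)
    also have "ceq n \<dots> (sg (-1) (int p) \<odot> (?m I * (if \<mu> \<in> I then 0 else sigma \<mu> I \<odot> ?F (insert \<mu> I))))"
      using WS_Fld[of I n \<mu> A a "{#}"] I \<mu> by (intro ceq_smul ceq_mult ceq_refl) auto
    finally show "ceq n (WS n \<mu> (?m I * ?F I))
      (sg (-1) (int p) \<odot> (?m I * (if \<mu> \<in> I then 0 else sigma \<mu> I \<odot> ?F (insert \<mu> I))))" .
  qed
  also have "(\<Sum>I\<in>?S p. sg (-1) (int p) \<odot> (?m I * (if \<mu> \<in> I then 0 else sigma \<mu> I \<odot> ?F (insert \<mu> I))))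
    = (\<Sum>I\<in>{I \<in> ?S p. \<mu> \<notin> I}. - ((-1) ^ below \<mu> I \<odot> (?m I * ?F (insert \<mu> I))))"
  proof (rule sum.mono_neutral_cong_right[OF finS])
    fix I assume I: "I \<in> {I \<in> ?S p. \<mu> \<notin> I}"
    have "sg (-1) (int p) * sigma \<mu> I = - ((-1) ^ below \<mu> I)"
      using I by (auto simp: sg_def koszul_def sigma_def power_add)
    then show "sg (-1) (int p) \<odot> (?m I * (if \<mu> \<in> I then 0 else sigma \<mu> I \<odot> ?F (insert \<mu> I)))
      = - ((-1) ^ below \<mu> I \<odot> (?m I * ?F (insert \<mu> I)))"
      using I by simp
  qed auto
  also have "\<dots> = (\<Sum>I\<in>{I \<in> ?S (p + 1). \<mu> \<in> I}. - ((-1) ^ below \<mu> I \<odot> (?m (I - {\<mu>}) * ?F I)))"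
  proof (rule sum.reindex_bij_witness[of _ "\<lambda>I. I - {\<mu>}" "insert \<mu>"])
    fix I assume I: "I \<in> {I \<in> ?S p. \<mu> \<notin> I}"
    then have fI: "finite I" using fin[of I p] by simp
    with I show "insert \<mu> I \<in> {I \<in> ?S (p + 1). \<mu> \<in> I}" using \<mu> by simp
    have "below \<mu> (insert \<mu> I) = below \<mu> I" using I by (subst below_insert[OF fI]) auto
    then show "- ((-1) ^ below \<mu> (insert \<mu> I) \<odot> (?m (insert \<mu> I - {\<mu>}) * ?F (insert \<mu> I))) =
      - ((-1) ^ below \<mu> I \<odot> (?m I * ?F (insert \<mu> I)))" using I by simp
  next
    fix I assume I: "I \<in> {I \<in> ?S (p + 1). \<mu> \<in> I}"
    then have "finite I" using fin[of I "p + 1"] by simp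
    with I show "I - {\<mu>} \<in> {I \<in> ?S p. \<mu> \<notin> I}" by auto
  qed auto
  also have "\<dots> = - (\<Sum>I\<in>?S (p + 1). contract n \<mu> (?m I * ?F I))"
    unfolding sum_negf
    by (intro arg_cong[of _ _ uminus] sum.mono_neutral_cong_left[OF finS])
       (auto simp: contract_phi_term[OF fin])
  also have "\<dots> = - contract n \<mu> (phi n A a (p + 1))"
    unfolding phi_def by (simp only: gder_sum[OF gder_contract])
  finally show ?thesis .
qed

section \<open>The Lie algebra basis and the commutator of BRS with vector supersymmetry\<close>

lemma lie_basis_orthonormal:
  assumes "simple_lie_basis T"
  shows "trace (T a ** T b) = (if a = b then 1 else 0)"
  using assms by (simp add: simple_lie_basis_def)

text \<open>The span is closed under commutators, and orthonormality reads off the coefficients by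
  tracing against \<open>T d\<close>.\<close>

lemma lie_basis_commutator:
  fixes T :: "'a::finite \<Rightarrow> complex^'m::finite^'m"
  assumes T: "simple_lie_basis T"
  shows "mat_commutator (T a) (T b) $ i $ j =
    (\<Sum>d\<in>UNIV. trace (T d ** mat_commutator (T a) (T b)) * T d $ i $ j)"
proof -
  have mem: "T a \<in> lie_span T" for a
  proof -
    have "(\<Sum>b\<in>UNIV. (if b = a then 1 else 0) * T b $ i $ j) = T a $ i $ j" for i j
      by (subst sum.remove[of _ a]) auto
    then have "T a = lin_comb T (\<lambda>b. if b = a then 1 else 0)"
      by (simp add: lin_comb_def vec_eq_iff)
    then show ?thesis by (auto simp: lie_span_def)
  qed
  then have "mat_commutator (T a) (T b) \<in> lie_span T"
    using T by (simp add: simple_lie_basis_def simple_lie_algebra_def)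
  then obtain z where z: "mat_commutator (T a) (T b) = lin_comb T z" by (auto simp: lie_span_def)
  have "trace (T d ** lin_comb T z) = z d" for d
  proof -
    have "trace (T d ** lin_comb T z) = (\<Sum>i\<in>UNIV. \<Sum>k\<in>UNIV. \<Sum>e\<in>UNIV. z e * (T d $ i $ k * T e $ k $ i))"
      by (simp add: trace_def matrix_matrix_mult_def lin_comb_def sum_distrib_left mult_ac)
    also have "\<dots> = (\<Sum>e\<in>UNIV. z e * trace (T d ** T e))"
      by (simp add: trace_def matrix_matrix_mult_def sum_distrib_left sum.swap[of _ "UNIV :: 'a set"])
    also have "\<dots> = (\<Sum>e\<in>UNIV. if e = d then z e else 0)"
      by (intro sum.cong) (auto simp: lie_basis_orthonormal[OF T])
    finally show ?thesis by simp
  qed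
  then show ?thesis unfolding z by (simp add: lin_comb_def)
qed

lemma lie_comp_phi_mat:
  assumes T: "simple_lie_basis T"
  shows "lie_comp T a (phi_mat T n A p) = phi n A a p"
proof -
  have "lie_comp T a (phi_mat T n A p) = (\<Sum>i\<in>UNIV. \<Sum>k\<in>UNIV. \<Sum>b\<in>UNIV. (T a $ i $ k * T b $ k $ i) \<odot> phi n A b p)"
    by (simp add: lie_comp_expand phi_mat_expand alg.scale_sum_right)
  also have "\<dots> = (\<Sum>b\<in>UNIV. trace (T a ** T b) \<odot> phi n A b p)"
    by (simp add: trace_def matrix_matrix_mult_def alg.scale_sum_left sum.swap[of _ "UNIV :: 'a set"])
  also have "\<dots> = (\<Sum>b\<in>UNIV. if b = a then phi n A b p else 0)"
    by (intro sum.cong) (auto simp: lie_basis_orthonormal[OF T])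
  finally show ?thesis by simp
qed

lemma WS_phi_mat:
  assumes "\<mu> < n + 2"
  shows "ceq n (WS n \<mu> (phi_mat T n A p $ i $ j)) (- contract n \<mu> (phi_mat T n A (p + 1) $ i $ j))"
proof -
  have "WS n \<mu> (phi_mat T n A p $ i $ j) = (\<Sum>a\<in>UNIV. T a $ i $ j \<odot> WS n \<mu> (phi n A a p))"
    by (simp add: phi_mat_expand gder_sum[OF gder_WS] gder_smul[OF gder_WS])
  also have "ceq n \<dots> (\<Sum>a\<in>UNIV. T a $ i $ j \<odot> (- contract n \<mu> (phi n A a (p + 1))))"
    by (intro ceq_sum ceq_smul WS_phi assms)
  also have "\<dots> = - contract n \<mu> (phi_mat T n A (p + 1) $ i $ j)"
    by (simp add: phi_mat_expand gder_sum[OF gder_contract] gder_smul[OF gder_contract] sum_negf)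
  finally show ?thesis .
qed

lemma contract_phi_mat_0: "contract n \<mu> (phi_mat T n Phi1 0 $ i $ j) = 0"
  by (simp add: phi_mat_0 jet_mat_entry gder_sum[OF gder_contract] gder_smul[OF gder_contract] contract_Fld)

text \<open>\<open>WS\<close> passes d with a sign and acts as minus contraction, so Cartan's
  formula produces the translation term. At p = 0 the default 0 of \<open>d_prev\<close> agrees with
  the vanishing contraction of a 0-form.\<close>

lemma WS_d_prev:
  assumes \<mu>: "\<mu> < n + 2"
  shows "ceq n (WS n \<mu> (d_prev T n Phi1 p $ i $ j))
    (- contract n \<mu> (d_prev T n Phi1 (p + 1) $ i $ j) + partial n \<mu> (phi_mat T n Phi1 p $ i $ j))"
proof -
  have "ceq n (WS n \<mu> (d_prev T n Phi1 p $ i $ j)) (ext_d n (contract n \<mu> (phi_mat T n Phi1 p $ i $ j)))"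
  proof (cases p)
    case 0
    then show ?thesis by (simp add: d_prev_def contract_phi_mat_0 gder_0[OF gder_WS] gder_0[OF gder_ext_d])
  next
    case (Suc q)
    have "ceq n (WS n \<mu> (ext_d n (phi_mat T n Phi1 q $ i $ j))) (- ext_d n (WS n \<mu> (phi_mat T n Phi1 q $ i $ j)))"
      by (rule WS_ext_d)
    also have "ceq n \<dots> (- ext_d n (- contract n \<mu> (phi_mat T n Phi1 (q + 1) $ i $ j)))"
      by (intro ceq_minus gder_ceq[OF gder_ext_d] WS_phi_mat \<mu>)
    finally show ?thesis by (simp add: Suc d_prev_def gder_minus[OF gder_ext_d])
  qed
  also have "ceq n \<dots> (- contract n \<mu> (ext_d n (phi_mat T n Phi1 p $ i $ j)) + partial n \<mu> (phi_mat T n Phi1 p $ i $ j))"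
    by (rule Cartan_formula[OF \<mu>])
  finally show ?thesis by (simp add: d_prev_def)
qed

text \<open>Both sides become the same two sums over q up to p + 1; the terms added at the ends, q =
  0 and q = p + 1, contain the contraction of a 0-form and vanish.\<close>

lemma WS_square_form:
  assumes \<mu>: "\<mu> < n + 2"
  shows "ceq n (WS n \<mu> (square_form T n p $ i $ j)) (- contract n \<mu> (square_form T n (p + 1) $ i $ j))"
proof -
  let ?\<Phi> = "phi_mat T n Phi1" and ?i = "contract n \<mu>"
  have g: "gr (tot n) 1 (?\<Phi> q $ i $ j)" for q i j
    using phi_mat_gr[of n Phi1 T q i j] by (simp add: ldeg_def)
  have s: "sg (-1) 1 = -1" by (simp add: sg_def koszul_def)
  let ?L = "\<lambda>q. \<Sum>k\<in>UNIV. ?i (?\<Phi> q $ i $ k) * ?\<Phi> (p + 1 - q) $ k $ j"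
  let ?R = "\<lambda>q. \<Sum>k\<in>UNIV. ?\<Phi> q $ i $ k * ?i (?\<Phi> (p + 1 - q) $ k $ j)"
  have "WS n \<mu> (square_form T n p $ i $ j) = (\<Sum>q\<le>p. \<Sum>k\<in>UNIV. WS n \<mu> (?\<Phi> q $ i $ k * ?\<Phi> (p - q) $ k $ j))"
    by (simp add: square_form_expand gder_sum[OF gder_WS])
  also have "ceq n \<dots> (\<Sum>q\<le>p. \<Sum>k\<in>UNIV. WS n \<mu> (?\<Phi> q $ i $ k) * ?\<Phi> (p - q) $ k $ j
      + sg (-1) 1 \<odot> (?\<Phi> q $ i $ k * WS n \<mu> (?\<Phi> (p - q) $ k $ j)))"
    by (intro ceq_sum gder_mult[OF gder_WS] g)
  also have "ceq n \<dots> (\<Sum>q\<le>p. \<Sum>k\<in>UNIV. (- ?i (?\<Phi> (q + 1) $ i $ k)) * ?\<Phi> (p - q) $ k $ j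
      + sg (-1) 1 \<odot> (?\<Phi> q $ i $ k * (- ?i (?\<Phi> (p - q + 1) $ k $ j))))"
    by (intro ceq_sum ceq_add ceq_mult ceq_smul ceq_refl WS_phi_mat \<mu>)
  also have "\<dots> = - (\<Sum>q\<le>p. ?L (Suc q)) + (\<Sum>q\<le>p. ?R q)"
    by (simp add: s sum.distrib sum_negf sum_subtractf Suc_diff_le)
  also have "(\<Sum>q\<le>p. ?L (Suc q)) = (\<Sum>q\<le>p + 1. ?L q)"
    by (simp add: sum.atMost_Suc_shift contract_phi_mat_0 del: sum.atMost_Suc)
  also have "(\<Sum>q\<le>p. ?R q) = (\<Sum>q\<le>p + 1. ?R q)"
    by (simp add: contract_phi_mat_0)
  finally have 1: "ceq n (WS n \<mu> (square_form T n p $ i $ j)) (- (\<Sum>q\<le>p + 1. ?L q) + (\<Sum>q\<le>p + 1. ?R q))" .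
  have "?i (square_form T n (p + 1) $ i $ j) = (\<Sum>q\<le>p + 1. \<Sum>k\<in>UNIV. ?i (?\<Phi> q $ i $ k * ?\<Phi> (p + 1 - q) $ k $ j))"
    by (simp only: square_form_expand gder_sum[OF gder_contract])
  also have "ceq n \<dots> (\<Sum>q\<le>p + 1. \<Sum>k\<in>UNIV. ?i (?\<Phi> q $ i $ k) * ?\<Phi> (p + 1 - q) $ k $ j
      + sg (-1) 1 \<odot> (?\<Phi> q $ i $ k * ?i (?\<Phi> (p + 1 - q) $ k $ j)))"
    by (intro ceq_sum gder_mult[OF gder_contract] g)
  also have "\<dots> = (\<Sum>q\<le>p + 1. ?L q) - (\<Sum>q\<le>p + 1. ?R q)"
    by (simp add: s sum.distrib sum_negf sum_subtractf del: sum.atMost_Suc)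
  finally have "ceq n (- ?i (square_form T n (p + 1) $ i $ j)) (- ((\<Sum>q\<le>p + 1. ?L q) - (\<Sum>q\<le>p + 1. ?R q)))"
    by (rule ceq_minus)
  from ceq_sym[OF this] 1 show ?thesis by (metis (no_types, lifting) ceq_trans minus_diff_eq uminus_add_conv_diff)
qed

text \<open>The square contributes only the contraction, d also a translation. Applying
  \<open>lie_comp\<close> is linear and, by orthonormality, returns \<open>phi\<close> from its
  matrix.\<close>

lemma WS_BRS_value:
  fixes T :: "'a::finite \<Rightarrow> complex^'m::finite^'m"
  assumes \<mu>: "\<mu> < n + 2" and T: "simple_lie_basis T"
  shows "ceq n (WS n \<mu> (BRS_value T n Phi1 a p)) (partial n \<mu> (phi n Phi1 a p) - contract n \<mu> (BRS_value T n Phi1 a (p + 1)))"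
proof -
  let ?M = "\<lambda>p. d_prev T n Phi1 p + square_form T n p"
  have "WS n \<mu> (BRS_value T n Phi1 a p) = lie_comp T a (\<chi> i j. WS n \<mu> (?M p $ i $ j))"
    unfolding BRS_value_Phi1 by (rule lie_comp_clin[OF gder_clin[OF gder_WS]])
  also have "ceq n \<dots> (lie_comp T a (\<chi> i j. partial n \<mu> (phi_mat T n Phi1 p $ i $ j) - contract n \<mu> (?M (p + 1) $ i $ j)))"
  proof (rule lie_comp_ceq)
    fix i j
    have "ceq n (WS n \<mu> (d_prev T n Phi1 p $ i $ j) + WS n \<mu> (square_form T n p $ i $ j))
      ((- contract n \<mu> (d_prev T n Phi1 (p + 1) $ i $ j) + partial n \<mu> (phi_mat T n Phi1 p $ i $ j)) +
       (- contract n \<mu> (square_form T n (p + 1) $ i $ j)))"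
      by (intro ceq_add WS_d_prev WS_square_form \<mu>)
    then show "ceq n ((\<chi> i j. WS n \<mu> (?M p $ i $ j)) $ i $ j)
      ((\<chi> i j. partial n \<mu> (phi_mat T n Phi1 p $ i $ j) - contract n \<mu> (?M (p + 1) $ i $ j)) $ i $ j)"
      by (simp add: gder_add[OF gder_WS] gder_add[OF gder_contract] algebra_simps)
  qed
  also have "lie_comp T a (\<chi> i j. partial n \<mu> (phi_mat T n Phi1 p $ i $ j) - contract n \<mu> (?M (p + 1) $ i $ j))
    = lie_comp T a (\<chi> i j. partial n \<mu> (phi_mat T n Phi1 p $ i $ j)) - lie_comp T a (\<chi> i j. contract n \<mu> (?M (p + 1) $ i $ j))"
    by (simp add: lie_comp_expand alg.scale_right_diff_distrib sum_subtractf)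
  also have "\<dots> = partial n \<mu> (phi n Phi1 a p) - contract n \<mu> (BRS_value T n Phi1 a (p + 1))"
    unfolding BRS_value_Phi1 lie_comp_phi_mat[OF T, symmetric]
    by (simp only: lie_comp_clin[OF gder_clin[OF gder_partial]] lie_comp_clin[OF gder_clin[OF gder_contract]])
  finally show ?thesis .
qed

text \<open>The relation {BRS, W_\<mu>} = translation, on derivative-free words in the first ladder,
  the only ones reached by climbing from c. For \<mu> in \<open>I\<close> the W-variation vanishes,
  and so does the remaining term, in which \<mu> is contracted twice.\<close>

lemma BRS_WS:
  fixes T :: "'a::finite \<Rightarrow> complex^'m::finite^'m"
  assumes \<mu>: "\<mu> < n + 2" and T: "simple_lie_basis T" and X: "supp (jets n {Phi1} True) X"
  shows "ceq n (BRS T n (WS n \<mu> X)) (- WS n \<mu> (BRS T n X) + partial n \<mu> X)"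
proof -
  have H: "gder n (1 + -1) (partial n \<mu> :: 'a alg \<Rightarrow> 'a alg)" using gder_partial by simp
  have sg: "sg 1 (-1) = -1" by (simp add: sg_def koszul_def)
  have "ceq n (BRS T n (WS n \<mu> X)) (sg 1 (-1) \<odot> WS n \<mu> (BRS T n X) + partial n \<mu> X)"
  proof (rule gder_commutator_eq[OF gder_BRS gder_WS H _ X])
    fix x :: "'a gen" assume x: "x \<in> jets n {Phi1} True"
    show "ceq n (BRS T n (WS n \<mu> (gen x))) (sg 1 (-1) \<odot> WS n \<mu> (BRS T n (gen x)) + partial n \<mu> (gen x))"
    proof (cases x)
      case (Fld A a I J)
      with x have x: "x = Fld Phi1 a I {#}" and I: "I \<subseteq> {..<n+2}" by auto
      then have fin: "finite I" using finite_subset[of I "{..<n+2}"] by simp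
      let ?p = "card I" and ?R = "BRS_value T n Phi1 a"
      have g: "form_comp n I (phi n Phi1 a ?p) = gen x" using form_comp_phi[OF I] x by simp
      have "WS n \<mu> (BRS T n (gen x)) = (-1) ^ ?p \<odot> WS n \<mu> (form_comp n I (?R ?p))"
        by (simp add: x BRS_Phi1 gder_smul[OF gder_WS])
      also have "ceq n \<dots> ((-1) ^ ?p \<odot> (-1) ^ ?p \<odot> form_comp n I (WS n \<mu> (?R ?p)))"
        by (intro ceq_smul WS_form_comp BRS_value_supp)
      also have "\<dots> = form_comp n I (WS n \<mu> (?R ?p))" by (simp flip: power_add mult_2)
      also have "ceq n \<dots> (form_comp n I (partial n \<mu> (phi n Phi1 a ?p) - contract n \<mu> (?R (?p + 1))))"
        by (intro form_comp_ceq WS_BRS_value \<mu> T)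
      also have "\<dots> = form_comp n I (partial n \<mu> (phi n Phi1 a ?p)) - form_comp n I (contract n \<mu> (?R (?p + 1)))"
        by (rule module_hom.diff[OF clin_form_comp])
      also have "ceq n \<dots> (partial n \<mu> (gen x) - form_comp n I (contract n \<mu> (?R (?p + 1))))"
        unfolding g[symmetric] by (intro ceq_diff form_comp_partial ceq_refl)
      finally have R: "ceq n (- WS n \<mu> (BRS T n (gen x)) + partial n \<mu> (gen x)) (form_comp n I (contract n \<mu> (?R (?p + 1))))"
        using ceq_add[OF ceq_minus ceq_refl[of n "partial n \<mu> (gen x)"]] by fastforce
      have "ceq n (BRS T n (WS n \<mu> (gen x))) (form_comp n I (contract n \<mu> (?R (?p + 1))))"
      proof (cases "\<mu> \<in> I")
        case True
        have "ceq n (WS n \<mu> (gen x)) 0" using WS_Fld[OF I, of \<mu> Phi1 a "{#}"] True x by simp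
        then have "ceq n (BRS T n (WS n \<mu> (gen x))) 0" by (rule gder_ceq_0[OF gder_BRS])
        then show ?thesis using ceq_sym[OF form_comp_contract_in[OF fin True]] by (rule ceq_trans)
      next
        case False
        have "ceq n (WS n \<mu> (gen x)) (sigma \<mu> I \<odot> gen (Fld Phi1 a (insert \<mu> I) {#}))"
          using WS_Fld[OF I, of \<mu> Phi1 a "{#}"] False x \<mu> by simp
        then have "ceq n (BRS T n (WS n \<mu> (gen x))) (BRS T n (sigma \<mu> I \<odot> gen (Fld Phi1 a (insert \<mu> I) {#})))"
          by (rule gder_ceq[OF gder_BRS])
        also have "\<dots> = (sigma \<mu> I * (-1) ^ (?p + 1)) \<odot> form_comp n (insert \<mu> I) (?R (?p + 1))"
          using False fin by (simp add: gder_smul[OF gder_BRS] BRS_Phi1)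
        also have "sigma \<mu> I * (-1) ^ (?p + 1) = (-1) ^ below \<mu> I"
          by (simp add: sigma_def power_add flip: power_mult_distrib)
        also have "ceq n ((-1) ^ below \<mu> I \<odot> form_comp n (insert \<mu> I) (?R (?p + 1))) (form_comp n I (contract n \<mu> (?R (?p + 1))))"
          by (rule ceq_sym[OF form_comp_contract[OF fin False]])
        finally show ?thesis .
      qed
      from ceq_trans[OF this ceq_sym[OF R]] show ?thesis by (simp add: sg)
    qed (use x in \<open>simp_all add: gder_0[OF gder_WS] gder_0[OF gder_BRS] partial_gen\<close>)
  qed
  then show ?thesis by (simp add: sg)
qed

lemma climb_supp: "supp (jets n As b) X \<Longrightarrow> supp (jets n As b) (climb n X)"
  unfolding climb_climb_upto by (intro supp_smul climb_upto_supp) auto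

text \<open>Multiplied by the differentials and summed, the translations of \<open>BRS_WS\<close>
  assemble into d.\<close>

lemma BRS_climb:
  fixes T :: "'a::finite \<Rightarrow> complex^'m::finite^'m"
  assumes T: "simple_lie_basis T" and X: "supp (jets n {Phi1} True) X"
  shows "ceq n (BRS T n (climb n X)) (climb n (BRS T n X) + ext_d n X)"
proof -
  have "BRS T n (climb n X) = - (\<Sum>\<mu><n+2. BRS T n (dx \<mu> * WS n \<mu> X))"
    by (simp add: climb_def gder_minus[OF gder_BRS] gder_sum[OF gder_BRS])
  also have "ceq n \<dots> (- (\<Sum>\<mu><n+2. sg 1 1 \<odot> (dx \<mu> * BRS T n (WS n \<mu> X))))"
    by (intro ceq_minus ceq_sum gder_mult_closed[OF gder_BRS]) auto
  also have "ceq n \<dots> (- (\<Sum>\<mu><n+2. sg 1 1 \<odot> (dx \<mu> * (- WS n \<mu> (BRS T n X) + partial n \<mu> X))))"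
    by (intro ceq_minus ceq_sum ceq_smul ceq_mult ceq_refl BRS_WS T X) auto
  also have "\<dots> = climb n (BRS T n X) + (\<Sum>\<mu><n+2. dx \<mu> * partial n \<mu> X)"
    by (simp add: sg_def koszul_def climb_def sum_negf distrib_left sum.distrib sum_subtractf right_diff_distrib)
  also have "ceq n \<dots> (climb n (BRS T n X) + ext_d n X)"
    by (intro ceq_add ceq_refl ceq_sym[OF ext_d_partial])
  finally show ?thesis .
qed

lemma climb_feq_0:
  assumes "functional_eq n X 0" shows "functional_eq n (climb n X) 0"
proof -
  have "functional_eq n (dx \<mu> * WS n \<mu> X) 0" for \<mu>
    using WS_feq[OF assms, of \<mu>]
    by (intro feq_lmult_0[OF ext_d_closed_mult]) (simp_all add: ext_d_gen gder_0[OF gder_WS])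
  then have "functional_eq n (- (\<Sum>\<mu><n+2. dx \<mu> * WS n \<mu> X)) (- (\<Sum>\<mu><n+2. 0))"
    by (intro feq_minus feq_sum)
  then show ?thesis by (simp add: climb_def)
qed

text \<open>Each rung changes the BRS variation by a total derivative, and climbing maps total
  derivatives to total derivatives.\<close>

lemma BRS_climb_power:
  fixes T :: "'a::finite \<Rightarrow> complex^'m::finite^'m"
  assumes T: "simple_lie_basis T" and X: "supp (jets n {Phi1} True) X" and B: "ceq n (BRS T n X) 0"
  shows "functional_eq n (BRS T n ((climb n ^^ k) X)) 0"
proof (induction k)
  case 0
  show ?case using ceq_feq[OF B] by simp
next
  case (Suc k)
  let ?Y = "(climb n ^^ k) X"
  have "ceq n (BRS T n (climb n ?Y)) (climb n (BRS T n ?Y) + ext_d n ?Y)"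
    by (intro BRS_climb T funpow_supp climb_supp X)
  also have "functional_eq n \<dots> (0 + 0)"
    by (intro feq_add climb_feq_0 Suc feq_ext_d)
  finally show ?case by simp
qed

section \<open>BRS closure of products of traces of odd powers of c\<close>

text \<open>\<open>BRS\<close> is defined by projecting on the basis \<open>T a\<close>, so c^2 must
  be recognised as Lie-algebra-valued: the components of c anticommute, hence only commutators of
  basis matrices enter, and these expand by \<open>lie_basis_commutator\<close>.\<close>

lemma BRS_c_mat:
  fixes T :: "'a::finite \<Rightarrow> complex^'m::finite^'m"
  assumes T: "simple_lie_basis T"
  shows "ceq n (BRS T n (c_mat T $ i $ j)) ((c_mat T ** c_mat T) $ i $ j)"
proof -
  let ?c = "\<lambda>a. gen (Fld Phi1 a {} {#}) :: 'a alg"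
  \<comment> \<open>Anticommuting variables see only the antisymmetric part of the
    coefficients.\<close>
  have anti: "ceq n (\<Sum>a\<in>UNIV. \<Sum>b\<in>UNIV. M a b \<odot> (?c a * ?c b))
     (\<Sum>a\<in>UNIV. \<Sum>b\<in>UNIV. ((M a b - M b a) / 2) \<odot> (?c a * ?c b))" for M
  proof -
    have *: "(\<Sum>a\<in>UNIV. \<Sum>b\<in>UNIV. M b a \<odot> (?c b * ?c a)) = (\<Sum>a\<in>UNIV. \<Sum>b\<in>UNIV. M a b \<odot> (?c a * ?c b))"
      by (rule sum.swap)
    have "(\<Sum>a\<in>UNIV. \<Sum>b\<in>UNIV. M a b \<odot> (?c a * ?c b)) = (1/2) \<odot> (\<Sum>a\<in>UNIV. \<Sum>b\<in>UNIV. M a b \<odot> (?c a * ?c b))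
        + (1/2) \<odot> (\<Sum>a\<in>UNIV. \<Sum>b\<in>UNIV. M b a \<odot> (?c b * ?c a))"
      unfolding * by (simp flip: alg.scale_left_distrib)
    also have "ceq n \<dots> ((1/2) \<odot> (\<Sum>a\<in>UNIV. \<Sum>b\<in>UNIV. M a b \<odot> (?c a * ?c b))
        + (1/2) \<odot> (\<Sum>a\<in>UNIV. \<Sum>b\<in>UNIV. M b a \<odot> (sg 1 1 \<odot> (?c a * ?c b))))"
      by (intro ceq_add ceq_smul ceq_sum ceq_refl supercommute) (simp_all add: ldeg_def)
    also have "\<dots> = (\<Sum>a\<in>UNIV. \<Sum>b\<in>UNIV. ((M a b - M b a) / 2) \<odot> (?c a * ?c b))"
      by (simp add: sg_def koszul_def alg.scale_sum_right diff_divide_distrib alg.scale_left_diff_distrib sum_subtractf sum_negf)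
    finally show ?thesis .
  qed
  have cc: "(c_mat T ** c_mat T) $ i $ j = (\<Sum>a\<in>UNIV. \<Sum>b\<in>UNIV. (T a ** T b) $ i $ j \<odot> (?c a * ?c b))" for i j
  proof -
    have "(c_mat T ** c_mat T) $ i $ j = (\<Sum>k\<in>UNIV. \<Sum>a\<in>UNIV. \<Sum>b\<in>UNIV. (T a $ i $ k * T b $ k $ j) \<odot> (?c a * ?c b))"
      by (simp add: matrix_matrix_mult_def jet_mat_entry sum_product mult.commute)
    also have "\<dots> = (\<Sum>a\<in>UNIV. \<Sum>k\<in>UNIV. \<Sum>b\<in>UNIV. (T a $ i $ k * T b $ k $ j) \<odot> (?c a * ?c b))"
      by (rule sum.swap)
    also have "\<dots> = (\<Sum>a\<in>UNIV. \<Sum>b\<in>UNIV. \<Sum>k\<in>UNIV. (T a $ i $ k * T b $ k $ j) \<odot> (?c a * ?c b))"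
      by (intro sum.cong[OF refl] sum.swap)
    finally show ?thesis by (simp add: matrix_matrix_mult_def alg.scale_sum_left)
  qed
  have lie: "lie_comp T d (c_mat T ** c_mat T) = (\<Sum>a\<in>UNIV. \<Sum>b\<in>UNIV. trace (T d ** (T a ** T b)) \<odot> (?c a * ?c b))" for d
  proof -
    have "lie_comp T d (c_mat T ** c_mat T) = (\<Sum>i\<in>UNIV. \<Sum>k\<in>UNIV. \<Sum>a\<in>UNIV. \<Sum>b\<in>UNIV. (T d $ i $ k * (T a ** T b) $ k $ i) \<odot> (?c a * ?c b))"
      by (simp add: lie_comp_expand cc alg.scale_sum_right)
    also have "\<dots> = (\<Sum>a\<in>UNIV. \<Sum>b\<in>UNIV. \<Sum>i\<in>UNIV. \<Sum>k\<in>UNIV. (T d $ i $ k * (T a ** T b) $ k $ i) \<odot> (?c a * ?c b))"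
      by (simp add: sum.swap[of _ "UNIV :: 'a set" "UNIV :: 'm set"])
    also have "\<dots> = (\<Sum>a\<in>UNIV. \<Sum>b\<in>UNIV. trace (T d ** (T a ** T b)) \<odot> (?c a * ?c b))"
      by (simp add: trace_def matrix_matrix_mult_def[of "T d"] alg.scale_sum_left)
    finally show ?thesis .
  qed
  let ?C = "\<lambda>a b. mat_commutator (T a) (T b)"
  have tr: "trace (T d ** (T a ** T b)) - trace (T d ** (T b ** T a)) = trace (T d ** ?C a b)" for a b d
    by (simp add: mat_commutator_def trace_def matrix_matrix_mult_def sum_subtractf right_diff_distrib)
  have "d_prev T n Phi1 0 + square_form T n 0 = c_mat T ** c_mat T"
    by (simp add: d_prev_def square_form_def phi_mat_0)
  then have "BRS T n (?c d) = lie_comp T d (c_mat T ** c_mat T)" for d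
    by (simp add: BRS_Phi1 BRS_value_Phi1 form_comp_def)
  then have "BRS T n (c_mat T $ i $ j) = (\<Sum>d\<in>UNIV. T d $ i $ j \<odot> lie_comp T d (c_mat T ** c_mat T))"
    by (simp add: jet_mat_entry gder_sum[OF gder_BRS] gder_smul[OF gder_BRS])
  also have "ceq n \<dots> (\<Sum>d\<in>UNIV. T d $ i $ j \<odot> (\<Sum>a\<in>UNIV. \<Sum>b\<in>UNIV. (trace (T d ** ?C a b) / 2) \<odot> (?c a * ?c b)))"
    unfolding lie tr[symmetric] by (intro ceq_sum ceq_smul anti)
  also have "\<dots> = (\<Sum>d\<in>UNIV. \<Sum>a\<in>UNIV. \<Sum>b\<in>UNIV. (trace (T d ** ?C a b) * T d $ i $ j / 2) \<odot> (?c a * ?c b))"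
    by (simp add: alg.scale_sum_right mult.commute)
  also have "\<dots> = (\<Sum>a\<in>UNIV. \<Sum>d\<in>UNIV. \<Sum>b\<in>UNIV. (trace (T d ** ?C a b) * T d $ i $ j / 2) \<odot> (?c a * ?c b))"
    by (rule sum.swap)
  also have "\<dots> = (\<Sum>a\<in>UNIV. \<Sum>b\<in>UNIV. \<Sum>d\<in>UNIV. (trace (T d ** ?C a b) * T d $ i $ j / 2) \<odot> (?c a * ?c b))"
    by (intro sum.cong[OF refl] sum.swap)
  also have "\<dots> = (\<Sum>a\<in>UNIV. \<Sum>b\<in>UNIV. (((T a ** T b) $ i $ j - (T b ** T a) $ i $ j) / 2) \<odot> (?c a * ?c b))"
  proof (intro sum.cong[OF refl])
    fix a b
    have "(\<Sum>d\<in>UNIV. trace (T d ** ?C a b) * T d $ i $ j / 2) = ?C a b $ i $ j / 2"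
      by (simp add: lie_basis_commutator[OF T, symmetric] flip: sum_divide_distrib)
    then show "(\<Sum>d\<in>UNIV. (trace (T d ** ?C a b) * T d $ i $ j / 2) \<odot> (?c a * ?c b))
      = (((T a ** T b) $ i $ j - (T b ** T a) $ i $ j) / 2) \<odot> (?c a * ?c b)"
      by (simp add: mat_commutator_def flip: alg.scale_sum_left)
  qed
  also have "ceq n \<dots> ((c_mat T ** c_mat T) $ i $ j)"
    unfolding cc by (rule ceq_sym[OF anti])
  finally show ?thesis .
qed

text \<open>The Leibniz rule yields k copies of c^(k+1) with alternating signs, which sum to one
  copy for odd k and to none for even k.\<close>

lemma BRS_c_mat_power:
  fixes T :: "'a::finite \<Rightarrow> complex^'m::finite^'m"
  assumes T: "simple_lie_basis T"
  shows "ceq n (BRS T n (mat_power (c_mat T) k $ i $ j)) (if odd k then mat_power (c_mat T) (k + 1) $ i $ j else 0)"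
proof (induction k arbitrary: i)
  case 0
  show ?case using gder_1[OF gder_BRS] by (auto simp: mat_def gder_0[OF gder_BRS])
next
  case (Suc k)
  let ?C = "c_mat T"
  define P where "P = mat_power ?C k"
  let ?z = "if odd k then 1 else 0 :: complex"
  have P: "ceq n (BRS T n (P $ i $ j)) (?z \<odot> (?C ** P) $ i $ j)" for i
    using Suc[of i] by (auto simp: P_def)
  have s: "sg 1 1 = -1" by (simp add: sg_def koszul_def)
  have "BRS T n (mat_power ?C (Suc k) $ i $ j) = (\<Sum>l\<in>UNIV. BRS T n (?C $ i $ l * P $ l $ j))"
    by (simp add: P_def matrix_matrix_mult_def[of ?C] gder_sum[OF gder_BRS])
  also have "ceq n \<dots> (\<Sum>l\<in>UNIV. BRS T n (?C $ i $ l) * P $ l $ j + sg 1 1 \<odot> (?C $ i $ l * BRS T n (P $ l $ j)))"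
    by (intro ceq_sum gder_mult[OF gder_BRS] c_mat_gr)
  also have "ceq n \<dots> (\<Sum>l\<in>UNIV. (?C ** ?C) $ i $ l * P $ l $ j + sg 1 1 \<odot> (?C $ i $ l * (?z \<odot> (?C ** P) $ l $ j)))"
    by (intro ceq_sum ceq_add ceq_smul ceq_mult ceq_refl BRS_c_mat T P)
  also have "\<dots> = ((?C ** ?C) ** P) $ i $ j - ?z \<odot> ((?C ** (?C ** P)) $ i $ j)"
    unfolding s by (simp add: matrix_matrix_mult_def[of "?C ** ?C"] matrix_matrix_mult_def[of ?C "?C ** P"]
        sum_subtractf alg.scale_sum_right)
  also have "\<dots> = (if odd (Suc k) then mat_power ?C (Suc k + 1) $ i $ j else 0)"
    by (simp add: P_def matrix_mul_assoc)
  finally show ?case .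
qed

lemma BRS_c_power:
  fixes T :: "'a::finite \<Rightarrow> complex^'m::finite^'m"
  assumes T: "simple_lie_basis T" and "\<forall>k\<in>set ks. odd k"
  shows "ceq n (BRS T n (c_power T ks)) 0"
  using assms(2)
proof (induction ks)
  case Nil
  show ?case using gder_1[OF gder_BRS] by (simp add: c_power_def)
next
  case (Cons k ks)
  let ?t = "tr_power (c_mat T) k"
  have "gr (tot n) (int k) ?t"
    unfolding tr_power_def trace_def by (intro gr_sum mat_power_gr c_mat_gr)
  moreover have "ceq n (BRS T n ?t) 0"
  proof -
    have "BRS T n ?t = (\<Sum>i\<in>UNIV. BRS T n (mat_power (c_mat T) k $ i $ i))"
      by (simp add: tr_power_def trace_def gder_sum[OF gder_BRS])
    also have "ceq n \<dots> (\<Sum>i\<in>UNIV. if odd k then mat_power (c_mat T) (k + 1) $ i $ i else 0)"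
      by (intro ceq_sum BRS_c_mat_power T)
    also have "\<dots> = tr_power (c_mat T) (k + 1)" using Cons.prems by (simp add: tr_power_def trace_def)
    also have "ceq n \<dots> 0" using Cons.prems by (intro tr_power_even c_mat_gr) auto
    finally show ?thesis .
  qed
  ultimately have "ceq n (BRS T n (?t * c_power T ks)) (sg 1 (int k) \<odot> (?t * BRS T n (c_power T ks)))"
    by (rule gder_mult_closed[OF gder_BRS])
  also have "ceq n \<dots> (sg 1 (int k) \<odot> (?t * 0))"
    using Cons by (intro ceq_smul ceq_mult ceq_refl) auto
  finally show ?case by (simp add: c_power_def)
qed

lemma counterterm_c_power: "counterterm T n ks = (1 / fact (n + 2)) \<odot> (climb n ^^ (n + 2)) (c_power T ks)"
  by (simp add: counterterm_def phi_mat_0 c_power_def smul_def)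

lemma c_power_supp: "supp (jets n {Phi1} True) (c_power T ks)"
proof (induction ks)
  case (Cons k ks)
  have "supp (jets n {Phi1} True) (mat_power (c_mat T) k $ i $ j)" for i j
  proof (induction k arbitrary: i)
    case (Suc k)
    have "supp (jets n {Phi1} True) (c_mat T $ i $ l)" for l
      by (auto simp: jet_mat_entry intro!: supp_sum supp_smul)
    with Suc show ?case by (simp add: matrix_matrix_mult_def[of "c_mat T"]) (intro supp_sum supp_mult)
  qed (simp add: mat_def)
  then have "supp (jets n {Phi1} True) (tr_power (c_mat T) k)"
    unfolding tr_power_def trace_def by (intro supp_sum)
  with Cons show ?case by (simp add: c_power_def supp_mult)
qed (simp add: c_power_def)

lemma counterterm_supp: "supp (jets n {Phi1} True) (counterterm T n ks)"
  unfolding counterterm_c_power by (intro supp_smul funpow_supp climb_supp c_power_supp)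

lemma BRS_counterterm:
  fixes T :: "'a::finite \<Rightarrow> complex^'m::finite^'m"
  assumes T: "simple_lie_basis T" and "\<forall>k\<in>set ks. odd k"
  shows "functional_eq n (BRS T n (counterterm T n ks)) 0"
proof -
  have "functional_eq n (BRS T n ((climb n ^^ (n + 2)) (c_power T ks))) 0"
    by (intro BRS_climb_power T c_power_supp BRS_c_power assms)
  from feq_smul[OF this, of "1 / fact (n + 2)"] show ?thesis
    by (simp add: counterterm_c_power gder_smul[OF gder_BRS])
qed

section \<open>Functionals independent of the global ghosts\<close>

text \<open>
  The derivative with respect to a global ghost, which extracts the coefficient of that ghost
  from the coboundary.
\<close>

definition ghost_deriv :: "nat \<Rightarrow> 'a gen \<Rightarrow> 'a alg \<Rightarrow> 'a alg"
  where "ghost_deriv n y = derivation n (odd (tot n y)) (\<lambda>x. if x = y then 1 else 0)"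

lemma gder_ghost_deriv: "gder n (- tot n y) (ghost_deriv n y)"
  unfolding ghost_deriv_def by (rule gder_derivation) auto

lemma ghost_deriv_zero: "y \<notin> S \<Longrightarrow> supp S X \<Longrightarrow> ghost_deriv n y X = 0"
  unfolding ghost_deriv_def by (rule derivation_zero) auto

lemma ghost_deriv_mult:
  assumes "y \<notin> S" "supp S X"
  shows "ghost_deriv n y (gen x * X) = (if x = y then X else 0)"
proof -
  have "ghost_deriv n y (gen x * X) = ghost_deriv n y (gen x) * X
      + koszul (odd (tot n y)) (odd (tot n x)) \<odot> (gen x * ghost_deriv n y X)"
    unfolding ghost_deriv_def by (rule derivation_mult) simp
  then show ?thesis
    by (simp add: ghost_deriv_zero[OF assms]) (simp add: ghost_deriv_def mon_Nil)
qed

text \<open>Global ghosts are constants, so differentiating by one is compatible with total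
  derivatives.\<close>

lemma ghost_deriv_feq:
  assumes y: "y \<notin> range Dx" "\<not> is_field y" and X: "functional_eq n X Y"
  shows "functional_eq n (ghost_deriv n y X) (ghost_deriv n y Y)"
proof (rule gder_feq[OF gder_ghost_deriv gder_ext_d_commute[OF gder_ghost_deriv] X])
  have gen: "ghost_deriv n y (gen x) = (if x = y then 1 else 0)" for x
    by (simp add: ghost_deriv_def mon_Nil)
  show "ceq n (ghost_deriv n y (dx \<mu>)) 0" for \<mu> using y by (auto simp: gen)
  fix \<mu> and Z :: "'a alg"
  have "ceq n (ghost_deriv n y (partial n \<mu> Z)) (sg (- tot n y) 0 \<odot> partial n \<mu> (ghost_deriv n y Z))"
  proof (rule gder_commute[where S = UNIV, OF gder_ghost_deriv gder_partial])
    fix x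
    show "ceq n (ghost_deriv n y (partial n \<mu> (gen x))) (sg (- tot n y) 0 \<odot> partial n \<mu> (ghost_deriv n y (gen x)))"
      using y by (cases x) (auto simp: gen partial_gen gder_0[OF gder_ghost_deriv] gder_0[OF gder_partial] partial_1)
  qed simp
  then show "ceq n (ghost_deriv n y (partial n \<mu> Z)) (partial n \<mu> (ghost_deriv n y Z))" by simp
qed

section \<open>Ghost coefficients of the coboundary\<close>

lemma field_derivation_ghost_supp:
  assumes R: "\<And>A a p. supp (jets n UNIV False \<union> G) (R A a p)" and G: "\<And>x. x \<in> G \<Longrightarrow> \<not> is_field x"
    and X: "supp (jets n UNIV False) X"
  shows "supp (jets n UNIV False \<union> G) (field_derivation n s R X)"
  unfolding field_derivation_def
proof (rule derivation_supp)
  let ?S = "jets n UNIV False \<union> G"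
  show "supp ?S X" using X by (rule supp_mono) simp
  have p: "supp ?S (partial n \<mu> Y)" if "\<mu> < n + 2" "supp ?S Y" for \<mu> and Y
    unfolding partial_def
    by (rule derivation_supp[OF _ that(2)]) (use that(1) G in \<open>force split: gen.split\<close>)
  have fp: "supp ?S (fold (partial n) xs Y)" if "set xs \<subseteq> {..<n+2}" "supp ?S Y" for xs Y
    using that by (induction xs arbitrary: Y) (auto intro: p)
  fix x assume "x \<in> ?S"
  then show "supp ?S (case x of Fld A a I J \<Rightarrow> cst (koszul s (odd (card I))) *
          fold (partial n) (sorted_list_of_multiset J) (form_comp n I (R A a (card I))) | _ \<Rightarrow> 0)"
    using G[of x] by (cases x) (auto simp flip: smul_def intro!: supp_smul fp form_comp_supp R)
qed

lemma WS_ghost_value_gr: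
  "gr (tot n) (ldeg n A + 1) (- (\<Sum>\<mu><n+2. gen (Xi \<mu>) * contract n \<mu> (phi n A a (p + 1))))"
proof -
  have "gr (tot n) (2 + (ldeg n A + -1)) (gen (Xi \<mu>) * contract n \<mu> (phi n A a (p + 1)))" for \<mu>
    by (intro gr_mult gder_gr[OF gder_contract] phi_gr) simp
  then show ?thesis by (intro gr_minus gr_sum) (simp add: add.commute)
qed

lemma WT_ghost_value_gr:
  "gr (tot n) (ldeg n A + 1) (\<Sum>\<mu><n+2. gen (Eps \<mu>) * partial n \<mu> (phi n A a p))"
proof -
  have "gr (tot n) (1 + (ldeg n A + 0)) (gen (Eps \<mu>) * partial n \<mu> (phi n A a p))" for \<mu>
    by (intro gr_mult gder_gr[OF gder_partial] phi_gr) simp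
  then show ?thesis by (intro gr_sum) (simp add: add.commute)
qed

lemma uG_value_gr:
  "gr (tot n) (ldeg n A + 1) (if A = Phi2 \<and> p = 0 then gen (U b) else 0)"
  by (auto simp: ldeg_def)

lemma fold_partial_ghost_mult:
  assumes "\<And>\<nu>. partial n \<nu> g = 0"
  shows "fold (partial n) xs (g * X) = g * fold (partial n) xs X"
  by (induction xs arbitrary: X) (simp_all add: partial_mult assms)

lemma contract_ghost_mult:
  assumes "contract n \<nu> (gen x) = 0"
  shows "contract n \<nu> (gen x * X) = koszul True (odd (tot n x)) \<odot> (gen x * contract n \<nu> X)"
  using assms unfolding contract_def by (subst derivation_mult[where k = "tot n x"]) auto

lemma form_comp_even_mult:
  assumes "\<And>\<nu>. contract n \<nu> (gen x) = 0" "even (tot n x)"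
  shows "form_comp n I (gen x * X) = gen x * form_comp n I X"
proof -
  have "fold (contract n) xs (gen x * X) = gen x * fold (contract n) xs X" for xs
    by (induction xs arbitrary: X) (use assms in \<open>simp_all add: contract_ghost_mult koszul_def\<close>)
  then show ?thesis by (simp add: form_comp_def)
qed

text \<open>Every contraction is odd and passes the odd ghost with a minus sign.\<close>

lemma form_comp_odd_mult:
  assumes "\<And>\<nu>. contract n \<nu> (gen x) = 0" "odd (tot n x)"
  shows "form_comp n I (gen x * X) = (-1) ^ card I \<odot> (gen x * form_comp n I X)"
proof -
  have "fold (contract n) xs (gen x * X) = (-1) ^ length xs \<odot> (gen x * fold (contract n) xs X)" for xs
    by (induction xs arbitrary: X) (use assms in \<open>simp_all add: contract_ghost_mult koszul_def
      module_hom.neg[OF clin_fold_contract] module_hom.scale[OF clin_fold_contract]\<close>)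
  then show ?thesis by (simp add: form_comp_def)
qed

lemma WS_ghost_expand: "ceq n (WS_ghost n (X :: 'a alg)) (\<Sum>\<mu><n+2. gen (Xi \<mu>) * WS n \<mu> X)"
proof (rule gder_cong[where S = UNIV and e = 1 and F = "WS_ghost n" and
      G = "\<lambda>X. \<Sum>\<mu><n+2. gen (Xi \<mu>) * WS n \<mu> X"])
  show "gder n 1 (WS_ghost n :: 'a alg \<Rightarrow> 'a alg)"
    unfolding WS_ghost_def by (rule gder_field_derivation[OF WS_ghost_value_gr]) simp
  have "gder n (2 + -1) (\<lambda>X :: 'a alg. \<Sum>\<mu><n+2. gen (Xi \<mu>) * WS n \<mu> X)"
    by (intro gder_Sum gder_lmult gder_WS) simp
  then show "gder n 1 (\<lambda>X :: 'a alg. \<Sum>\<mu><n+2. gen (Xi \<mu>) * WS n \<mu> X)" by simp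
  fix x :: "'a gen"
  have fc: "form_comp n I (gen (Xi \<mu>) * X) = gen (Xi \<mu>) * form_comp n I X" for I \<mu> and X :: "'a alg"
    by (rule form_comp_even_mult) (simp_all add: contract_gen)
  have fp: "fold (partial n) xs (gen (Xi \<mu>) * X) = gen (Xi \<mu>) * fold (partial n) xs X" for xs \<mu> and X :: "'a alg"
    by (rule fold_partial_ghost_mult) (simp add: partial_gen)
  show "ceq n (WS_ghost n (gen x)) (\<Sum>\<mu><n+2. gen (Xi \<mu>) * WS n \<mu> (gen x))"
    by (cases x) (simp_all add: WS_ghost_def WS_def field_derivation_gen
      module_hom.neg[OF clin_form_comp] module_hom.neg[OF clin_fold_partial]
      module_hom.sum[OF clin_form_comp] module_hom.sum[OF clin_fold_partial] fc fp alg.scale_sum_right sum_negf)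
qed simp

text \<open>The sign from moving the odd ghost through the contractions cancels the one inserted by
  \<open>field_derivation\<close> for odd operators.\<close>

lemma WT_ghost_expand:
  fixes X :: "'a alg"
  assumes X: "supp (jets n UNIV False) X"
  shows "ceq n (WT_ghost n X) (\<Sum>\<mu><n+2. gen (Eps \<mu>) * partial n \<mu> X)"
proof (rule gder_cong[OF _ _ _ X, where e = 1])
  show "gder n 1 (WT_ghost n :: 'a alg \<Rightarrow> 'a alg)"
    unfolding WT_ghost_def by (rule gder_field_derivation[OF WT_ghost_value_gr]) simp
  have "gder n (1 + 0) (\<lambda>X :: 'a alg. \<Sum>\<mu><n+2. gen (Eps \<mu>) * partial n \<mu> X)"
    by (intro gder_Sum gder_lmult gder_partial) simp
  then show "gder n 1 (\<lambda>X :: 'a alg. \<Sum>\<mu><n+2. gen (Eps \<mu>) * partial n \<mu> X)" by simp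
  fix x :: "'a gen" assume x: "x \<in> jets n UNIV False"
  have fc: "form_comp n I (gen (Eps \<mu>) * X) = (-1) ^ card I \<odot> (gen (Eps \<mu>) * form_comp n I X)" for I \<mu> and X :: "'a alg"
    by (rule form_comp_odd_mult) (simp_all add: contract_gen)
  have fp: "fold (partial n) xs (gen (Eps \<mu>) * X) = gen (Eps \<mu>) * fold (partial n) xs X" for xs \<mu> and X :: "'a alg"
    by (rule fold_partial_ghost_mult) (simp add: partial_gen)
  show "ceq n (WT_ghost n (gen x)) (\<Sum>\<mu><n+2. gen (Eps \<mu>) * partial n \<mu> (gen x))"
  proof (cases x)
    case (Fld A a I J)
    with x have I: "I \<subseteq> {..<n+2}" by simp
    let ?\<phi> = "phi n A a (card I)" and ?D = "fold (partial n) (sorted_list_of_multiset J)"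
    have "WT_ghost n (gen x) = (\<Sum>\<mu><n+2. (-1) ^ card I \<odot> (-1) ^ card I \<odot> (gen (Eps \<mu>) * ?D (form_comp n I (partial n \<mu> ?\<phi>))))"
      by (simp add: Fld WT_ghost_def field_derivation_gen koszul_True
        module_hom.sum[OF clin_form_comp] module_hom.sum[OF clin_fold_partial] fc fp
        module_hom.scale[OF clin_fold_partial] alg.scale_sum_right)
    also have "\<dots> = (\<Sum>\<mu><n+2. gen (Eps \<mu>) * ?D (form_comp n I (partial n \<mu> ?\<phi>)))"
      by (simp flip: power_add mult_2)
    also have "ceq n \<dots> (\<Sum>\<mu><n+2. gen (Eps \<mu>) * ?D (partial n \<mu> (form_comp n I ?\<phi>)))"
      by (intro ceq_sum ceq_mult ceq_refl fold_partial_ceq form_comp_partial)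
    also have "\<dots> = (\<Sum>\<mu><n+2. gen (Eps \<mu>) * partial n \<mu> (gen x))"
      by (simp add: form_comp_phi[OF I] Fld fold_partial_Cons[unfolded fold_simps(2)] fold_partial_Fld)
    finally show ?thesis .
  qed (simp_all add: WT_ghost_def field_derivation_gen partial_gen)
qed

lemma gder_uG: "gder n 1 (uG n)"
  unfolding uG_def by (rule gder_field_derivation[OF uG_value_gr]) simp

lemma fold_partial_U: "fold (partial n) (sorted_list_of_multiset J) (gen (U a)) = (if J = {#} then gen (U a) else 0)"
  by (induction J) (simp_all add: fold_partial_insort partial_gen gder_0[OF gder_partial])

lemma uG_expand:
  fixes X :: "'a::finite alg"
  assumes X: "supp (jets n UNIV False) X"
  shows "ceq n (uG n X) (\<Sum>a\<in>UNIV. gen (U a) * opG n a X)"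
proof (rule gder_cong[OF gder_uG _ _ X])
  have "gder n (int n + 1 + (- int n)) (\<lambda>X :: 'a alg. \<Sum>a\<in>UNIV. gen (U a) * opG n a X)"
    by (intro gder_Sum gder_lmult gder_opG) simp
  then show "gder n 1 (\<lambda>X :: 'a alg. \<Sum>a\<in>UNIV. gen (U a) * opG n a X)" by simp
  fix x :: "'a gen" assume x: "x \<in> jets n UNIV False"
  show "ceq n (uG n (gen x)) (\<Sum>a\<in>UNIV. gen (U a) * opG n a (gen x))"
  proof (cases x)
    case (Fld A b I J)
    with x have "finite I" using finite_subset[of I "{..<n+2}"] by simp
    have "uG n (gen x) = (if A = Phi2 \<and> I = {} \<and> J = {#} then gen (U b) else 0)"
      using \<open>finite I\<close> by (auto simp: Fld uG_def field_derivation_gen form_comp_def koszul_def fold_partial_U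
        module_hom.zero[OF clin_fold_contract] module_hom.zero[OF clin_fold_partial])
    also have "\<dots> = (\<Sum>a\<in>UNIV. if a = b then (if A = Phi2 \<and> I = {} \<and> J = {#} then gen (U b) else 0) else 0)"
      by simp
    also have "\<dots> = (\<Sum>a\<in>UNIV. gen (U a) * opG n a (gen x))"
      by (intro sum.cong) (auto simp: Fld opG_Fld[OF \<open>finite I\<close>])
    finally show ?thesis by simp
  qed (use x in \<open>simp_all add: uG_def opG_Dx field_derivation_gen\<close>)
qed

context
  fixes T :: "'a::finite \<Rightarrow> complex^'m::finite^'m" and n :: nat
begin

definition vF_value :: "ladder \<Rightarrow> 'a \<Rightarrow> nat \<Rightarrow> 'a alg"
  where "vF_value = (\<lambda>A b p. case A of
      Phi1 \<Rightarrow> 0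
    | Phi2 \<Rightarrow> lie_comp T b (graded_comm (odd n) True
        (\<chi> i j. \<Sum>a\<in>UNIV. cst (T a $ i $ j) * gen (V a)) (phi_mat T n Phi1 p)))"

lemma vF_value: "vF T n = field_derivation n True vF_value"
  unfolding vF_def vF_value_def ..

lemma vF_value_gr: "gr (tot n) (ldeg n A + 1) (vF_value A b p)"
proof (cases A)
  case Phi2
  have "gr (tot n) 1 (phi_mat T n Phi1 p $ i $ j)" for i j
    using phi_mat_gr[of n Phi1 T p i j] by (simp add: ldeg_def)
  then show ?thesis
    unfolding Phi2 vF_value_def
    by (auto simp: ldeg_def simp flip: smul_def intro!: lie_comp_gr graded_comm_gr gr_sum gr_smul)
qed (simp add: vF_value_def)

lemma vF_feq: "functional_eq n X Y \<Longrightarrow> functional_eq n (vF T n X) (vF T n Y)"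
  unfolding vF_value by (rule field_derivation_feq[OF vF_value_gr]) simp_all

lemma gder_vF: "gder n 1 (vF T n)"
  unfolding vF_value by (rule gder_field_derivation[OF vF_value_gr]) simp

text \<open>Its result contains no global ghosts except \<open>V\<close>, so this term is invisible
  to derivatives with respect to \<open>Xi\<close> and \<open>U\<close>.\<close>

lemma vF_supp: "supp (jets n UNIV False) X \<Longrightarrow> supp (jets n UNIV False \<union> range V) (vF T n X)"
  unfolding vF_value
proof (rule field_derivation_ghost_supp)
  show "supp (jets n UNIV False \<union> range V) (vF_value A b p)" for A b p
  proof (cases A)
    case Phi2
    have "supp (jets n UNIV False \<union> range V) (phi_mat T n Phi1 p $ i $ j)" for i j
      by (rule supp_mono[OF phi_mat_supp[of Phi1 UNIV]]) auto
    then show ?thesis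
      unfolding Phi2 vF_value_def
      by (auto simp flip: smul_def intro!: lie_comp_supp graded_comm_supp supp_sum supp_smul)
  qed (simp add: vF_value_def)
qed auto

lemma vF_Phi1: "supp (jets n {Phi1} True) X \<Longrightarrow> vF T n X = 0"
  unfolding vF_value field_derivation_def
proof (rule derivation_zero[where S = "jets n {Phi1} True"])
  fix x :: "'a gen" assume "x \<in> jets n {Phi1} True"
  then show "(case x of Fld A a I J \<Rightarrow> cst (koszul True (odd (card I))) *
      fold (partial n) (sorted_list_of_multiset J) (form_comp n I (vF_value A a (card I))) | _ \<Rightarrow> 0) = 0"
    by (cases x) (auto simp: vF_value_def module_hom.zero[OF clin_form_comp] module_hom.zero[OF clin_fold_partial])
qed

text \<open>The ghost shift acts on ghosts only and so vanishes on a ghost-free density; the other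
  terms appear with their ghosts in front, ready for extraction.\<close>

lemma coboundary_expand:
  assumes X: "supp (jets n UNIV False) X"
  shows "ceq n (coboundary T n X) (BRS T n X + (\<Sum>\<mu><n+2. gen (Xi \<mu>) * WS n \<mu> X) +
    (\<Sum>\<mu><n+2. gen (Eps \<mu>) * partial n \<mu> X) + ((\<Sum>a\<in>UNIV. gen (U a) * opG n a X) + vF T n X))"
proof -
  have "ghost_shift n X = 0"
    unfolding ghost_shift_def by (rule derivation_zero[OF _ X]) (auto split: gen.split)
  then show ?thesis
    unfolding coboundary_def add_0_right
    by (simp, intro ceq_add ceq_refl WS_ghost_expand WT_ghost_expand uG_expand X)
qed

lemma ghost_deriv_coboundary:
  assumes X: "supp (jets n UNIV False) X"
  shows "\<mu> < n + 2 \<Longrightarrow> ceq n (ghost_deriv n (Xi \<mu>) (coboundary T n X)) (WS n \<mu> X)"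
    and "ceq n (ghost_deriv n (U a) (coboundary T n X)) (opG n a X)"
proof -
  let ?J = "jets n UNIV False :: 'a gen set"
  have expand: "ceq n (ghost_deriv n y (coboundary T n X)) (
      (\<Sum>\<mu><n+2. if Xi \<mu> = y then WS n \<mu> X else 0) + (\<Sum>a\<in>UNIV. if U a = y then opG n a X else 0))"
    if y: "y \<notin> ?J \<union> range V" "y \<notin> range Eps" for y
  proof -
    have yJ: "y \<notin> ?J" using y by simp
    note lin = gder_add[OF gder_ghost_deriv] gder_sum[OF gder_ghost_deriv]
    have "(\<Sum>\<mu><n+2. ghost_deriv n y (gen (Eps \<mu>) * partial n \<mu> X)) = 0"
      by (intro sum.neutral ballI, subst ghost_deriv_mult[OF yJ partial_supp[OF _ X]]) (use y in auto)
    then have "ghost_deriv n y (BRS T n X + (\<Sum>\<mu><n+2. gen (Xi \<mu>) * WS n \<mu> X) +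
      (\<Sum>\<mu><n+2. gen (Eps \<mu>) * partial n \<mu> X) + ((\<Sum>a\<in>UNIV. gen (U a) * opG n a X) + vF T n X))
      = (\<Sum>\<mu><n+2. if Xi \<mu> = y then WS n \<mu> X else 0) + (\<Sum>a\<in>UNIV. if U a = y then opG n a X else 0)"
      by (simp add: lin ghost_deriv_zero[OF yJ BRS_supp[OF X]] ghost_deriv_zero[OF y(1) vF_supp[OF X]]
        ghost_deriv_mult[OF yJ WS_supp[OF X]] ghost_deriv_mult[OF yJ opG_supp[OF X]])
    with gder_ceq[OF gder_ghost_deriv coboundary_expand[OF X], of y] show ?thesis by simp
  qed
  show "\<mu> < n + 2 \<Longrightarrow> ceq n (ghost_deriv n (Xi \<mu>) (coboundary T n X)) (WS n \<mu> X)"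
    using expand[of "Xi \<mu>"] by auto
  show "ceq n (ghost_deriv n (U a) (coboundary T n X)) (opG n a X)"
    using expand[of "U a"] by auto
qed

end

text \<open>A ghost-free \<open>R\<close> forces the coefficients of the ghosts \<xi> and u to
  vanish as functionals, which are the hypotheses of \<open>invariant_functional\<close>. The v-term
  then vanishes because the counterterms contain only the first ladder, and the translation term
  because \<open>X\<close> is a top form.\<close>

lemma coboundary_trivial:
  fixes T :: "'a::finite \<Rightarrow> complex^'m::finite^'m"
  assumes T: "simple_lie_basis T" and X: "local_functional T n \<eta> (-1) X"
    and R: "ghost_free n R" "functional_eq n (coboundary T n X) R"
  shows "functional_eq n (coboundary T n X) 0"
proof -
  have sp: "supp (jets n UNIV False) X" and top: "gr fdeg (int n + 2) X"
  proof -
    have int_sum: "sum_list (map (\<lambda>x. int (h x)) w) = int (sum_list (map h w))" for h and w :: "'a gen list"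
      by (induction w) auto
    show "supp (jets n UNIV False) X" "gr fdeg (int n + 2) X"
      using X by (auto simp: local_functional_def ghost_free_jets gr_def int_sum)
  qed
  have sR: "supp (jets n UNIV False) R" using R(1) by (simp add: ghost_free_jets)
  have WS: "functional_eq n (WS n \<mu> X) 0" if "\<mu> < n + 2" for \<mu>
  proof -
    have "functional_eq n (ghost_deriv n (Xi \<mu>) (coboundary T n X)) (ghost_deriv n (Xi \<mu>) R)"
      by (rule ghost_deriv_feq[OF _ _ R(2)]) auto
    also have "ghost_deriv n (Xi \<mu>) R = 0" by (rule ghost_deriv_zero[OF _ sR]) simp
    finally show ?thesis
      using ghost_deriv_coboundary(1)[OF sp that, where T = T] ceq_sym feq_ceq_trans(2) by blast
  qed
  have G: "functional_eq n (opG n a X) 0" for a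
  proof -
    have "functional_eq n (ghost_deriv n (U a) (coboundary T n X)) (ghost_deriv n (U a) R)"
      by (rule ghost_deriv_feq[OF _ _ R(2)]) auto
    also have "ghost_deriv n (U a) R = 0" by (rule ghost_deriv_zero[OF _ sR]) simp
    finally show ?thesis
      using ghost_deriv_coboundary(2)[OF sp, where T = T and a = a] ceq_sym feq_ceq_trans(2) by blast
  qed
  \<comment> \<open>Ghost number -1 leaves n + 2 - 1 = n + 1 factors c.\<close>
  obtain z where z: "functional_eq n X (\<Sum>ks\<in>odd_parts (n + 1). z ks \<odot> counterterm T n ks)"
    using invariant_functional[OF X _ _ WS G, of "n + 1"] by auto
  have B: "functional_eq n (BRS T n X) 0"
  proof -
    have "functional_eq n (BRS T n X) (\<Sum>ks\<in>odd_parts (n + 1). z ks \<odot> BRS T n (counterterm T n ks))"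
      using BRS_feq[OF z, of T] by (simp add: gder_sum[OF gder_BRS] gder_smul[OF gder_BRS])
    also have "functional_eq n \<dots> (\<Sum>ks\<in>odd_parts (n + 1). z ks \<odot> 0)"
      by (intro feq_sum feq_smul BRS_counterterm T) (simp add: odd_parts_def)
    finally show ?thesis by simp
  qed
  have F: "functional_eq n (vF T n X) 0"
    using vF_feq[OF z, of T]
    by (simp add: gder_sum[OF gder_vF] gder_smul[OF gder_vF] vF_Phi1 counterterm_supp)
  have mult: "functional_eq n (gen x * Y) 0" if "functional_eq n Y 0" "\<not> is_field x" for x and Y :: "'a alg"
    by (rule feq_lmult_0[OF ext_d_closed_mult that(1)]) (use that(2) in \<open>cases x; simp add: ext_d_gen\<close>)
  have "functional_eq n (BRS T n X + (\<Sum>\<mu><n+2. gen (Xi \<mu>) * WS n \<mu> X) +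
    (\<Sum>\<mu><n+2. gen (Eps \<mu>) * partial n \<mu> X) + ((\<Sum>a\<in>UNIV. gen (U a) * opG n a X) + vF T n X))
    (0 + (\<Sum>\<mu><n+2. 0) + (\<Sum>\<mu><n+2. 0) + ((\<Sum>a\<in>(UNIV :: 'a set). 0) + 0))"
    by (intro feq_add feq_sum B F mult WS G partial_top_form sp top) auto
  then show ?thesis using feq_ceq_trans(2)[OF coboundary_expand[OF sp]] by simp
qed

theorem mainTheorem3:
  fixes n :: nat
    and T :: "'a::finite \<Rightarrow> complex^'m::finite^'m"
    and \<eta> :: "nat \<Rightarrow> real"
  assumes n: "n \<ge> 1"
    and T: "simple_lie_basis T"
    and \<eta>: "\<forall>\<mu><n+2. \<eta> \<mu> \<in> {1, -1}"
  shows
    "(\<forall>\<Delta>. local_functional T n \<eta> 0 \<Delta> \<and>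
        functional_eq n (BRS T n \<Delta>) 0 \<and>
        (\<forall>\<xi>. functional_eq n (WS_vec n \<xi> \<Delta>) 0) \<and>
        (\<forall>a. functional_eq n (opG n a \<Delta>) 0) \<and>
        (\<forall>a. functional_eq n (opF T n a \<Delta>) 0) \<longrightarrow>
        (\<exists>z :: nat list \<Rightarrow> complex. functional_eq n \<Delta>
          (\<Sum>ks | sum_list ks = n + 2 \<and> (\<forall>k\<in>set ks. odd k). cst (z ks) * counterterm T n ks)))
     \<and>
     (\<forall>\<Delta>m. local_functional T n \<eta> (-1) \<Delta>m \<and>
        (\<exists>R. ghost_free n R \<and> functional_eq n (coboundary T n \<Delta>m) R) \<longrightarrow>
        functional_eq n (coboundary T n \<Delta>m) 0)"
proof (intro conjI allI impI)
  fix \<Delta> :: "'a alg"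
  assume \<Delta>: "local_functional T n \<eta> 0 \<Delta> \<and>
        functional_eq n (BRS T n \<Delta>) 0 \<and>
        (\<forall>\<xi>. functional_eq n (WS_vec n \<xi> \<Delta>) 0) \<and>
        (\<forall>a. functional_eq n (opG n a \<Delta>) 0) \<and>
        (\<forall>a. functional_eq n (opF T n a \<Delta>) 0)"
  have WS: "functional_eq n (WS n \<mu> \<Delta>) 0" if "\<mu> < n + 2" for \<mu>
  proof -
    \<comment> \<open>Unit vectors extract the single components of the supersymmetry from the
      hypothesis for all \<xi>.\<close>
    have "WS_vec n (\<lambda>\<nu>. if \<nu> = \<mu> then 1 else 0) \<Delta> = (\<Sum>\<nu><n+2. if \<nu> = \<mu> then WS n \<nu> \<Delta> else 0)"
      unfolding WS_vec_def by (intro sum.cong) auto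
    then have "WS_vec n (\<lambda>\<nu>. if \<nu> = \<mu> then 1 else 0) \<Delta> = WS n \<mu> \<Delta>" using that by simp
    with \<Delta> show ?thesis by metis
  qed
  from \<Delta> have loc: "local_functional T n \<eta> 0 \<Delta>" and G: "\<And>a. functional_eq n (opG n a \<Delta>) 0" by auto
  obtain z where "functional_eq n \<Delta> (\<Sum>ks\<in>odd_parts (n + 2). z ks \<odot> counterterm T n ks)"
    using invariant_functional[OF loc _ _ WS G, of "n + 2"] by auto
  then show "\<exists>z :: nat list \<Rightarrow> complex. functional_eq n \<Delta>
      (\<Sum>ks | sum_list ks = n + 2 \<and> (\<forall>k\<in>set ks. odd k). cst (z ks) * counterterm T n ks)"
    unfolding odd_parts_def smul_def by blast
qed (use T coboundary_trivial in blast)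

end
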